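(* Let $\mathcal{C}$ be a subcritical family of labelled connected graphs, and let $R_1,R_2,\ldots$ be a sequence of random graphs (defined on a common probability space) such that, for each $n$, $R_n$ is a uniformly random element of $\mathcal{C}$ with $n$ vertices. Then the sequence $R_1,R_2,\ldots$ converges almost surely in the Benjamini-Schramm sense; that is, with probability $1$, the realised sequence of (deterministic) finite graphs is Benjamini-Schramm convergent.
   Context: Graph classes consist of finite simple graphs and are closed under isomorphism. A block of a graph is a maximal $2$-connected subgraph, where $K_2$ counts as $2$-connected (so the one-vertex graph has no blocks). A class $\mathcal{G}$ of graphs is block-stable if it contains $K_2$ and a graph belongs to $\mathcal{G}$ if and only if each of its blocks belongs to $\mathcal{G}$. Let $\mathcal{C}$ be the class of connected graphs in $\mathcal{G}$ and $\mathcal{B}$ the class of blocks ($2$-connected graphs, including $K_2$) in $\mathcal{G}$. Labelled setting: graphs on $n$ vertices are labelled by $\{1,\ldots,n\}$. Let $C(z)$ and $B(z)$ be the exponential generating functions of the labelled graphs in $\mathcal{C}$ and $\mathcal{B}$, and let $C^{\bullet}(z)=zC'(z)$, the exponential generating function of the class $\mathcal{C}^{\bullet}$ of graphs in $\mathcal{C}$ with a distinguished root vertex; it satisfies $C^{\bullet}(z)=z\exp(B'(C^{\bullet}(z)))$. Let $\rho$ and $\eta$ be the radii of convergence of $C(z)$ and $B(y)$ respectively. The class is called subcritical if $C^{\bullet}(\rho)<\eta$. A "subcritical family of labelled connected graphs" is the class $\mathcal{C}$ of connected graphs of such a block-stable class. A sequence of (possibly random) rooted graphs $(R_n)$ converges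 weakly if for every $r\in\mathbb{N}$ the ball of radius $r$ in $R_n$ centred at its root, considered up to isomorphism of rooted (unlabelled) graphs, converges in distribution as $n\to\infty$. A sequence of finite unrooted graphs $(G_n)$ converges in the Benjamini-Schramm sense if the random rooted graphs obtained by rooting each $G_n$ at a uniformly random vertex of $G_n$ converge weakly. *)

theory Defs
  imports
    "HOL-Probability.Probability"
    "Graph_Theory.Graph_Theory"
begin

text \<open>
  Finite simple graphs are symmetric loop-free finite pair digraphs (\<open>pair_graph\<close>), an undirected
  edge being a pair of opposite arcs. Graph classes are sets of graphs with vertices in \<open>nat\<close>;
  every finite graph is isomorphic to one of these.
\<close>

type_synonym ngraph = "nat pair_pre_digraph"

definition iso_closed :: "ngraph set \<Rightarrow> bool" where
  "iso_closed \<G> \<longleftrightarrow>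
    (\<forall>G H. G \<in> \<G> \<longrightarrow> pair_graph H \<longrightarrow> digraph_iso (with_proj G) (with_proj H) \<longrightarrow> H \<in> \<G>)"

definition is_connected :: "'a pair_pre_digraph \<Rightarrow> bool" where
  "is_connected G \<longleftrightarrow> Digraph_Component.connected (with_proj G)"

definition two_connected :: "('a, 'b) pre_digraph \<Rightarrow> bool" where
  "two_connected D \<longleftrightarrow> K\<^bsub>2\<^esub> D \<or>
    (graph D \<and> card (verts D) > 2 \<and> Digraph_Component.connected D \<and>
      (\<forall>v\<in>verts D. Digraph_Component.connected (pre_digraph.del_vert D v)))"

definition is_block :: "'a pair_pre_digraph \<Rightarrow> 'a pair_pre_digraph \<Rightarrow> bool" where
  "is_block H G \<longleftrightarrow> pre_digraph.max_subgraph (with_proj G) two_connected (with_proj H)"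

definition block_stable :: "ngraph set \<Rightarrow> bool" where
  "block_stable \<G> \<longleftrightarrow>
    (\<forall>G. K\<^bsub>2\<^esub> (with_proj G) \<longrightarrow> G \<in> \<G>) \<and>
    (\<forall>G. pair_graph G \<longrightarrow> (G \<in> \<G> \<longleftrightarrow> (\<forall>H. is_block H G \<longrightarrow> H \<in> \<G>)))"

definition labelled :: "ngraph set \<Rightarrow> nat \<Rightarrow> ngraph set" where
  "labelled \<A> n = {G \<in> \<A>. pverts G = {1..n}}"

definition egf :: "ngraph set \<Rightarrow> real fps" where
  "egf \<A> = Abs_fps (\<lambda>n. real (card (labelled \<A> n)) / fact n)"

text \<open>
  The value of a power series with nonnegative coefficients at a point of \<open>[0, \<infinity>]\<close>. It is taken in
  the extended reals, so that a series diverging at its radius of convergence has the value \<open>\<infinity>\<close>.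
\<close>

definition ereal_eval :: "real fps \<Rightarrow> ereal \<Rightarrow> ereal" where
  "ereal_eval F x = (\<Sum>n. ereal (fps_nth F n) * x ^ n)"

text \<open>
  Below, \<open>\<C>\<close> and \<open>\<B>\<close> are the connected and the 2-connected members of a block-stable class \<open>\<G>\<close>, and
  \<open>fps_X * fps_deriv (egf \<C>)\<close> is the exponential generating function of the rooted graphs in \<open>\<C>\<close>.
\<close>

definition subcritical_family :: "ngraph set \<Rightarrow> bool" where
  "subcritical_family \<C> \<longleftrightarrow>
    (\<exists>\<G> \<B>. (\<forall>G\<in>\<G>. pair_graph G) \<and> iso_closed \<G> \<and> block_stable \<G> \<and>
      \<C> = {G \<in> \<G>. is_connected G} \<and>
      \<B> = {G \<in> \<G>. two_connected (with_proj G)} \<and>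
      ereal_eval (fps_X * fps_deriv (egf \<C>)) (fps_conv_radius (egf \<C>))
        < fps_conv_radius (egf \<B>))"

text \<open>The set of vertices at distance at most \<open>r\<close> from \<open>v\<close>.\<close>

definition ball_verts :: "'a pair_pre_digraph \<Rightarrow> 'a \<Rightarrow> nat \<Rightarrow> 'a set" where
  "ball_verts G v r = {u. \<exists>p. pre_digraph.awalk (with_proj G) v p u \<and> length p \<le> r}"

definition rooted_iso :: "('a, 'b) pre_digraph \<Rightarrow> 'a \<Rightarrow> ('c, 'd) pre_digraph \<Rightarrow> 'c \<Rightarrow> bool" where
  "rooted_iso D u E v \<longleftrightarrow>
    (\<exists>f. pre_digraph.digraph_isomorphism D f \<and> E = app_iso f D \<and> iso_verts f u = v)"

text \<open>
  The ball of radius \<open>r\<close> centred at the root, as an unlabelled rooted graph: the isomorphism class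
  of the rooted graph induced on the vertices at distance at most \<open>r\<close>.
\<close>

definition ball_class :: "nat \<Rightarrow> ngraph \<times> nat \<Rightarrow> (ngraph \<times> nat) set" where
  "ball_class r = (\<lambda>(G, v). {(H, w). rooted_iso (with_proj G \<restriction> ball_verts G v r) v (with_proj H) w})"

text \<open>
  Convergence in distribution on a countable discrete space, where every bounded function is a
  continuous test function. The limit \<open>q\<close> is a probability distribution, so no mass escapes.
\<close>

definition converges_in_distr :: "(nat \<Rightarrow> 'c pmf) \<Rightarrow> 'c pmf \<Rightarrow> bool" where
  "converges_in_distr p q \<longleftrightarrow>
    (\<forall>f :: 'c \<Rightarrow> real. bounded (range f) \<longrightarrow>
      (\<lambda>n. measure_pmf.expectation (p n) f) \<longlonglongrightarrow> measure_pmf.expectation q f)"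

text \<open>A sequence of random finite rooted graphs is given by the sequence of their laws.\<close>

definition weakly_convergent :: "(nat \<Rightarrow> (ngraph \<times> nat) pmf) \<Rightarrow> bool" where
  "weakly_convergent \<mu> \<longleftrightarrow>
    (\<forall>r. \<exists>q. converges_in_distr (\<lambda>n. map_pmf (ball_class r) (\<mu> n)) q)"

definition benjamini_schramm_convergent :: "(nat \<Rightarrow> ngraph) \<Rightarrow> bool" where
  "benjamini_schramm_convergent G \<longleftrightarrow>
    weakly_convergent (\<lambda>n. map_pmf (\<lambda>v. (G n, v)) (pmf_of_set (pverts (G n))))"

text \<open>A uniformly random element of the finite nonempty set \<open>A\<close>, defined on the space \<open>M\<close>.\<close>

definition uniformly_random :: "'w measure \<Rightarrow> ('w \<Rightarrow> 'c) \<Rightarrow> 'c set \<Rightarrow> bool" where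
  "uniformly_random M X A \<longleftrightarrow>
    X \<in> M \<rightarrow>\<^sub>M count_space A \<and> distr M (count_space A) X = uniform_count_measure A"

end

theory Submission
  imports Defs
begin

text \<open>
Root a connected graph \<open>G\<close> at a vertex \<open>x\<close>. A vertex \<open>u\<close> dominates \<open>w\<close> if every walk from \<open>x\<close> to \<open>w\<close>
meets \<open>u\<close>, and the vertices dominated by \<open>u\<close> span the fringe subgraph at \<open>u\<close>. Apart from \<open>x\<close> and \<open>w\<close>, the
dominators of \<open>w\<close> are the cut vertices that separate \<open>w\<close> from \<open>x\<close>; they describe the block structure
without mentioning blocks. The vertices dominated only by \<open>x\<close> and themselves are the children of \<open>x\<close>.
Together with \<open>x\<close> they induce a core, a connected graph in which only \<open>x\<close> may be a cut vertex; what is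
left is a disjoint union of the fringe subgraphs of the children. Conversely every core can be glued to arbitrary rooted graphs
(\<open>root_glue\<close>, \<open>rooted_graph\<close>), and in a block-stable class membership of the whole is membership of
the parts (\<open>block_stable_glue\<close>). For the generating functions \<open>C\<close> of rooted connected graphs and
\<open>\<Phi>\<close> of cores this says \<open>C(z) = z \<Phi>(C(z))\<close>, and a weighted form of the equation holds for every weight
that is multiplicative over the parts (\<open>root_sum_fps\<close>). Since the blocks of a core all contain its
root, \<open>\<Phi>\<close> is dominated by the exponential of \<open>B'\<close> and converges inside the radius of convergence \<open>\<eta>\<close> of \<open>B\<close>.

Let \<open>\<rho>\<close> be the radius of convergence of \<open>C\<close> and \<open>\<tau> = C(\<rho>) < \<eta>\<close>. Partial sums of \<open>C\<close> at \<open>x\<close> stay below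
\<open>y\<close> as soon as \<open>x \<Phi>(y) \<le> y\<close>. Such a pair with \<open>x > \<rho>\<close> would exist if \<open>\<rho> \<Phi>'(\<tau>) < 1\<close>, because \<open>\<Phi>\<close> converges
beyond \<open>\<tau>\<close>; so \<open>\<rho> \<Phi>'(\<tau>) \<ge> 1\<close> (\<open>critical\<close>): in the Boltzmann model at \<open>\<rho>\<close> the mean number of vertices
in every level is at least 1 (\<open>mean_level\<close>). This is where subcriticality enters.

Let \<open>N\<close> be the sum of a statistic \<open>h\<close> over all fringe subgraphs of a graph, and \<open>\<mu>\<close> the Boltzmann mean
of \<open>h\<close> over rooted graphs with at most \<open>K\<close> vertices. Under the weight \<open>u^N\<close> with \<open>u = 1 - t\<close>
the equation loses to first order at least the amount \<open>\<tau> \<mu> t\<close>, so the weighted series stays bounded by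
\<open>\<tau>\<close> at \<open>\<rho> (1 + \<beta> t)\<close> for every \<open>\<beta> < \<mu>\<close> and small \<open>t\<close>. The coefficients of \<open>C\<close> have
exponential growth rate \<open>1/\<rho>\<close> along all indices, by supermultiplicativity. Hence the probability that
\<open>N \<le> \<alpha> n\<close> in a uniform graph with \<open>n\<close> vertices decays exponentially for \<open>\<alpha> < \<mu>\<close> (\<open>lower_tail\<close>). The
random graphs may depend on each other in any way, so it is essential that these tails are summable:
Borel-Cantelli then gives \<open>liminf N/n \<ge> \<mu>\<close> almost surely.

Finally, if \<open>w\<close> lies \<open>r\<close> levels below \<open>u\<close>, then the ball of radius \<open>r\<close> around \<open>w\<close> does not leave the fringe
subgraph at \<open>u\<close>, since an arc changes the level by at most one (\<open>ball_fringe\<close>). Let \<open>h\<close> count the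
vertices at level \<open>r\<close> whose ball has a given isomorphism class. Then \<open>N\<close> bounds the number of
vertices with this class from below, and the limiting lower bounds of all classes add up, as \<open>K\<close>
grows, to the mean size of level \<open>r\<close>, which is at least 1. Lower bounds of total mass 1 leave no
room, so the frequencies converge (\<open>converges_in_distr_of_lower_bounds\<close>).
\<close>

section \<open>Connectedness and blocks\<close>

definition induced :: "'a pair_pre_digraph \<Rightarrow> 'a set \<Rightarrow> 'a pair_pre_digraph" where
  "induced G S = \<lparr>pverts = S, parcs = parcs G \<inter> S \<times> S\<rparr>"

definition glue :: "'a pair_pre_digraph \<Rightarrow> 'a pair_pre_digraph \<Rightarrow> 'a pair_pre_digraph" where
  "glue G H = \<lparr>pverts = pverts G \<union> pverts H, parcs = parcs G \<union> parcs H\<rparr>"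

definition psubgraph :: "'a pair_pre_digraph \<Rightarrow> 'a pair_pre_digraph \<Rightarrow> bool" where
  "psubgraph H G \<longleftrightarrow> pverts H \<subseteq> pverts G \<and> parcs H \<subseteq> parcs G"

definition avoid :: "'a pair_pre_digraph \<Rightarrow> 'a \<Rightarrow> 'a rel" where
  "avoid G u = {(x, y) \<in> parcs G. x \<noteq> u \<and> y \<noteq> u}"

definition pconnected :: "'a pair_pre_digraph \<Rightarrow> bool" where
  "pconnected G \<longleftrightarrow> pverts G \<noteq> {} \<and> (\<forall>a\<in>pverts G. \<forall>b\<in>pverts G. (a, b) \<in> (parcs G)\<^sup>*)"

text \<open>
A form of 2-connectedness in which the complete graph on two vertices is not a special case: after
the deletion of a vertex there is only one vertex left.
\<close>

definition biconnected :: "'a pair_pre_digraph \<Rightarrow> bool" where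
  "biconnected G \<longleftrightarrow> pair_graph G \<and> card (pverts G) \<ge> 2 \<and> pconnected G \<and>
    (\<forall>v\<in>pverts G. \<forall>a\<in>pverts G - {v}. \<forall>b\<in>pverts G - {v}. (a, b) \<in> (avoid G v)\<^sup>*)"

lemma induced_simps[simp]: "pverts (induced G S) = S" "parcs (induced G S) = parcs G \<inter> S \<times> S"
  by (auto simp: induced_def)

lemma glue_simps[simp]:
  "pverts (glue G H) = pverts G \<union> pverts H" "parcs (glue G H) = parcs G \<union> parcs H"
  by (auto simp: glue_def)

lemma graph_eqI: "pverts G = pverts H \<Longrightarrow> parcs G = parcs H \<Longrightarrow> G = (H :: 'a pair_pre_digraph)"
  by simp

lemma pair_graph_iff:
  "pair_graph G \<longleftrightarrow> finite (pverts G) \<and> parcs G \<subseteq> pverts G \<times> pverts G \<and> sym (parcs G) \<and>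
    (\<forall>x. (x, x) \<notin> parcs G)" (is "?L = ?R")
proof
  assume ?L
  then interpret pair_graph G .
  show ?R using pair_finite_verts arc_fst_in_verts arc_snd_in_verts pair_sym_arcs no_loops'
    by (fastforce simp: symmetric_def)
next
  assume R: ?R
  then have "finite (parcs G)" by (meson finite_SigmaI finite_subset)
  with R show ?L by unfold_locales (auto simp: symmetric_def)
qed

lemma rtrancl_on_eq:
  assumes "E \<subseteq> V \<times> V" "u \<in> V"
  shows "(u, v) \<in> rtrancl_on V E \<longleftrightarrow> (u, v) \<in> E\<^sup>*"
proof
  show "(u, v) \<in> rtrancl_on V E \<Longrightarrow> (u, v) \<in> E\<^sup>*"
    by (induct rule: rtrancl_on.induct) auto
  show "(u, v) \<in> E\<^sup>* \<Longrightarrow> (u, v) \<in> rtrancl_on V E"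
  proof (induct rule: rtrancl_induct)
    case base then show ?case using assms by auto
  next
    case (step y z) then show ?case using assms
      by (meson SigmaD1 SigmaD2 rtrancl_on.rtrancl_on_into_rtrancl_on subsetD)
  qed
qed

lemma connected_with_proj:
  assumes "parcs G \<subseteq> pverts G \<times> pverts G" "sym (parcs G)"
  shows "Digraph_Component.connected (with_proj G) \<longleftrightarrow> pconnected G"
proof -
  have "mk_symmetric (with_proj G) = G"
    using assms(2) by (intro graph_eqI) (auto simp: mk_symmetric_def sym_def)
  then show ?thesis
    unfolding Digraph_Component.connected_def strongly_connected_def reachable_def pconnected_def
    using rtrancl_on_eq[OF assms(1)] by auto
qed

lemma sym_avoid: "sym (parcs G) \<Longrightarrow> sym (avoid G u)"
  by (auto simp: sym_def avoid_def)

lemma pair_graphD: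
  assumes "pair_graph G"
  shows "finite (pverts G)" "sym (parcs G)" "sym ((parcs G)\<^sup>*)" "sym ((avoid G u)\<^sup>*)"
    "(x, y) \<in> parcs G \<Longrightarrow> x \<in> pverts G" "(x, y) \<in> parcs G \<Longrightarrow> y \<in> pverts G"
    "(x, x) \<notin> parcs G" "(x, y) \<in> parcs G \<Longrightarrow> (y, x) \<in> parcs G"
  using assms sym_avoid[of G u] unfolding pair_graph_iff by (auto intro: sym_rtrancl dest: symD)

lemma two_connected_with_proj: "two_connected (with_proj G) \<longleftrightarrow> biconnected G"
proof (cases "pair_graph G")
  case False
  then have "\<not> graph (with_proj G)" using pair_graphI_graph by auto
  then show ?thesis using False by (auto simp: two_connected_def biconnected_def complete_digraph_def)
next
  case pg: True
  then interpret pair_graph G .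
  note pgs = pg[unfolded pair_graph_iff]
  have gr: "graph (with_proj G)" by (rule pair_graphD_graph)
  have dv: "pre_digraph.del_vert (with_proj G) v = with_proj \<lparr>pverts = pverts G - {v}, parcs = avoid G v\<rparr>" for v
    unfolding pre_digraph.del_vert_def with_proj_def avoid_def by auto
  have cv: "Digraph_Component.connected (pre_digraph.del_vert (with_proj G) v) \<longleftrightarrow>
      pverts G - {v} \<noteq> {} \<and> (\<forall>a\<in>pverts G - {v}. \<forall>b\<in>pverts G - {v}. (a, b) \<in> (avoid G v)\<^sup>*)" for v
    unfolding dv using pgs sym_avoid[of G v]
    by (subst connected_with_proj) (auto simp: pconnected_def avoid_def)
  have cG: "Digraph_Component.connected (with_proj G) \<longleftrightarrow> pconnected G"
    using pgs connected_with_proj by blast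
  show ?thesis
  proof
    assume "two_connected (with_proj G)"
    then consider "complete_digraph 2 (with_proj G)"
      | "card (pverts G) > 2" "pconnected G" "\<forall>v\<in>pverts G. Digraph_Component.connected (pre_digraph.del_vert (with_proj G) v)"
      using cG by (auto simp: two_connected_def)
    then show "biconnected G"
    proof cases
      case 1
      then have c: "card (pverts G) = 2" and a: "parcs G = {(u, v). (u, v) \<in> pverts G \<times> pverts G \<and> u \<noteq> v}"
        by (auto simp: complete_digraph_def)
      from c obtain x y where xy: "pverts G = {x, y}" "x \<noteq> y" by (auto simp: card_2_iff)
      have "pconnected G" unfolding pconnected_def xy using a xy by auto
      moreover have "\<forall>v\<in>pverts G. \<forall>a\<in>pverts G - {v}. \<forall>b\<in>pverts G - {v}. (a, b) \<in> (avoid G v)\<^sup>*"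
        unfolding xy by auto
      ultimately show ?thesis using c pg by (auto simp: biconnected_def)
    next
      case 2
      then show ?thesis using pg cv by (auto simp: biconnected_def)
    qed
  next
    assume t: "biconnected G"
    show "two_connected (with_proj G)"
    proof (cases "card (pverts G) > 2")
      case True
      have "pverts G - {v} \<noteq> {}" for v
      proof
        assume "pverts G - {v} = {}"
        then have "card (pverts G) \<le> card {v}" by (intro card_mono) auto
        then show False using True by simp
      qed
      then have "\<forall>v\<in>pverts G. Digraph_Component.connected (pre_digraph.del_vert (with_proj G) v)"
        using t cv unfolding biconnected_def by blast
      then show ?thesis using True t gr cG by (auto simp: two_connected_def biconnected_def)
    next
      case False
      then have c: "card (pverts G) = 2" using t by (auto simp: biconnected_def)
      then obtain x y where xy: "pverts G = {x, y}" "x \<noteq> y" by (auto simp: card_2_iff)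
      have "(x, y) \<in> (parcs G)\<^sup>*" using t xy by (auto simp: biconnected_def pconnected_def)
      then obtain z where "(x, z) \<in> parcs G" using xy(2) by (meson converse_rtranclE)
      then have "(x, y) \<in> parcs G" using pgs xy by (metis insertE mem_Sigma_iff singletonD subsetD)
      then have "parcs G = {(u, v). (u, v) \<in> pverts G \<times> pverts G \<and> u \<noteq> v}"
        using pgs xy by (auto dest: symD)
      then have "complete_digraph 2 (with_proj G)" using c gr by (auto simp: complete_digraph_def)
      then show ?thesis by (auto simp: two_connected_def)
    qed
  qed
qed

lemma subgraph_with_proj:
  assumes "pair_graph H" "pair_graph G"
  shows "subgraph (with_proj H) (with_proj G) \<longleftrightarrow> psubgraph H G"
proof -
  have "wf_digraph (with_proj H)" "wf_digraph (with_proj G)"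
    using assms by (simp_all add: wf_digraph_wp_iff pair_graph_def pair_digraph_def pair_fin_digraph_def)
  then show ?thesis by (auto simp: subgraph_def psubgraph_def compatible_def)
qed

text \<open>
A subgraph of \<open>with_proj G\<close> shares its tail and head functions, so the maximality that
defines blocks can be tested on pair digraphs alone.
\<close>

lemma is_block_iff:
  assumes "pair_graph G"
  shows "is_block H G \<longleftrightarrow> psubgraph H G \<and> biconnected H \<and> (\<forall>H'. psubgraph H H' \<and> psubgraph H' G \<and> biconnected H' \<longrightarrow> H' = H)"
    (is "?L \<longleftrightarrow> ?R")
proof
  assume ?L
  then have 1: "subgraph (with_proj H) (with_proj G)" "two_connected (with_proj H)"
    and 2: "\<And>H'. H' \<noteq> with_proj H \<Longrightarrow> subgraph (with_proj H) H' \<Longrightarrow> \<not> (subgraph H' (with_proj G) \<and> two_connected H')"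
    by (auto simp: is_block_def pre_digraph.max_subgraph_def)
  have tH: "biconnected H" using 1 two_connected_with_proj by auto
  moreover have "psubgraph H G" using tH 1 assms subgraph_with_proj by (auto simp: biconnected_def)
  moreover have "H' = H" if "psubgraph H H'" "psubgraph H' G" "biconnected H'" for H'
  proof (rule ccontr)
    assume "H' \<noteq> H"
    then have "with_proj H' \<noteq> with_proj H" by (metis graph_eqI with_proj_simps(1) with_proj_simps(2))
    from 2[OF this] that show False
      using tH assms subgraph_with_proj two_connected_with_proj by (auto simp: biconnected_def)
  qed
  ultimately show ?R by blast
next
  assume R: ?R
  then have pH: "pair_graph H" by (auto simp: biconnected_def)
  show ?L unfolding is_block_def pre_digraph.max_subgraph_def
  proof (intro conjI allI impI)
    show "subgraph (with_proj H) (with_proj G)" using R pH assms subgraph_with_proj by auto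
    show "two_connected (with_proj H)" using R two_connected_with_proj by auto
    fix H' assume a: "H' \<noteq> with_proj H \<and> subgraph (with_proj H) H'"
    show "\<not> (subgraph H' (with_proj G) \<and> two_connected H')"
    proof
      assume b: "subgraph H' (with_proj G) \<and> two_connected H'"
      define K where "K = \<lparr>pverts = verts H', parcs = arcs H'\<rparr>"
      have "tail H' = fst" "head H' = snd" using b by (auto simp: subgraph_def compatible_def)
      then have K: "H' = with_proj K" unfolding K_def with_proj_def by simp
      have tK: "biconnected K" using b K two_connected_with_proj by auto
      then have pK: "pair_graph K" by (auto simp: biconnected_def)
      have "psubgraph H K" "psubgraph K G" using a b K pK pH assms subgraph_with_proj by auto
      then show False using R tK a K by blast
    qed
  qed
qed

lemma psubgraph_trans: "psubgraph A B \<Longrightarrow> psubgraph B C \<Longrightarrow> psubgraph A C" by (auto simp: psubgraph_def)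

lemma biconnected_has_arc:
  assumes "biconnected B" shows "parcs B \<noteq> {}"
proof -
  have "\<not> (\<exists>x. pverts B \<subseteq> {x})"
  proof
    assume "\<exists>x. pverts B \<subseteq> {x}"
    then obtain x where "pverts B \<subseteq> {x}" by auto
    then have "card (pverts B) \<le> card {x}" by (intro card_mono) auto
    then show False using assms by (auto simp: biconnected_def)
  qed
  then obtain x y where "x \<in> pverts B" "y \<in> pverts B" "x \<noteq> y" by blast
  then have "(x, y) \<in> (parcs B)\<^sup>*" using assms by (auto simp: biconnected_def pconnected_def)
  with \<open>x \<noteq> y\<close> show ?thesis by auto
qed

lemma rtrancl_exit:
  assumes "(x, y) \<in> R\<^sup>*" "x \<in> A" "y \<notin> A"
  obtains p q where "(x, p) \<in> R\<^sup>*" "(p, q) \<in> R" "p \<in> A" "q \<notin> A"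
  using assms by (induct rule: rtrancl_induct) blast+

text \<open>
Let \<open>F\<close> be attached to \<open>H\<close> with each component of \<open>F\<close> meeting \<open>H\<close> in at most one vertex. A vertex of \<open>B\<close>
outside \<open>H\<close> lies in a component of \<open>F\<close> that can be left only through its attachment vertex, so
deleting that vertex would disconnect \<open>B\<close> unless \<open>B\<close> stays inside the component.
\<close>

lemma biconnected_in_glue:
  assumes H: "pair_graph H" and F: "pair_graph F"
    and one: "\<And>a b. a \<in> pverts H \<inter> pverts F \<Longrightarrow> b \<in> pverts H \<inter> pverts F \<Longrightarrow> (a, b) \<in> (parcs F)\<^sup>* \<Longrightarrow> a = b"
    and B: "biconnected B" "psubgraph B (glue H F)"
  shows "psubgraph B H \<or> psubgraph B F"
proof -
  have pB: "pair_graph B" using B by (auto simp: biconnected_def)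
  show ?thesis
  proof (cases "pverts B \<subseteq> pverts H")
    case True
    have "(x, y) \<in> parcs H" if "(x, y) \<in> parcs B" for x y
    proof (rule ccontr)
      assume "(x, y) \<notin> parcs H"
      then have f: "(x, y) \<in> parcs F" using that B by (auto simp: psubgraph_def)
      then have "x = y" using one[of x y] that True pair_graphD[OF pB] pair_graphD[OF F] by blast
      then show False using f pair_graphD[OF F] by auto
    qed
    then show ?thesis using True by (auto simp: psubgraph_def)
  next
    case False
    then obtain x where x: "x \<in> pverts B" "x \<notin> pverts H" by auto
    then have xF: "x \<in> pverts F" using B by (auto simp: psubgraph_def)
    define A where "A = {y. (x, y) \<in> (parcs F)\<^sup>*}"
    have oneA: "a = b" if "a \<in> A \<inter> pverts H" "b \<in> A \<inter> pverts H" for a b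
    proof -
      have "(a, x) \<in> (parcs F)\<^sup>*" using that pair_graphD(3)[OF F] by (auto simp: A_def dest: symD)
      then have r: "(a, b) \<in> (parcs F)\<^sup>*" using that by (auto simp: A_def)
      have "c \<in> pverts F" if "(x, c) \<in> (parcs F)\<^sup>*" for c
        using that xF by (induct rule: rtrancl_induct) (auto dest: pair_graphD(5,6)[OF F])
      then show ?thesis using r that one[of a b] by (auto simp: A_def)
    qed
    have step: "q \<in> A" if "p \<in> A" "p \<notin> pverts H" "(p, q) \<in> parcs B" for p q
    proof -
      have "(p, q) \<in> parcs F" using that B pair_graphD[OF H] by (auto simp: psubgraph_def)
      then show ?thesis using that by (auto simp: A_def)
    qed
    have VA: "pverts B \<subseteq> A"
    proof
      fix y assume y: "y \<in> pverts B"
      show "y \<in> A"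
      proof (rule ccontr)
        assume yA: "y \<notin> A"
        have xA: "x \<in> A" by (auto simp: A_def)
        show False
        proof (cases "\<exists>v. v \<in> A \<inter> pverts H \<inter> pverts B")
          case True
          then obtain v where v: "v \<in> A \<inter> pverts H" "v \<in> pverts B" by auto
          have "(x, y) \<in> (avoid B v)\<^sup>*" using B(1) v x y yA unfolding biconnected_def by blast
          from rtrancl_exit[OF this xA yA] obtain p q where pq: "(p, q) \<in> avoid B v" "p \<in> A" "q \<notin> A" by blast
          then have "p \<notin> pverts H" using oneA v by (auto simp: avoid_def)
          then show False using pq step by (auto simp: avoid_def)
        next
          case False
          have "(x, y) \<in> (parcs B)\<^sup>*" using B(1) x y unfolding biconnected_def pconnected_def by blast
          from rtrancl_exit[OF this xA yA] obtain p q where pq: "(p, q) \<in> parcs B" "p \<in> A" "q \<notin> A" by blast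
          then have "p \<notin> pverts H" using False pair_graphD[OF pB] by blast
          then show False using pq step by auto
        qed
      qed
    qed
    have "(a, b) \<in> parcs F" if ab: "(a, b) \<in> parcs B" for a b
    proof (rule ccontr)
      assume "(a, b) \<notin> parcs F"
      then have h: "(a, b) \<in> parcs H" using B ab by (auto simp: psubgraph_def)
      then have "a \<in> A \<inter> pverts H" "b \<in> A \<inter> pverts H" using VA ab pair_graphD[OF pB] pair_graphD[OF H] by blast+
      then have "a = b" by (rule oneA)
      then show False using h pair_graphD[OF H] by auto
    qed
    moreover have "pverts B \<subseteq> pverts F"
    proof -
      have "c \<in> pverts F" if "(x, c) \<in> (parcs F)\<^sup>*" for c
        using that xF by (induct rule: rtrancl_induct) (auto dest: pair_graphD(5,6)[OF F])
      then show ?thesis using VA by (auto simp: A_def)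
    qed
    ultimately show ?thesis by (auto simp: psubgraph_def)
  qed
qed

lemma pair_graph_glue: "pair_graph H \<Longrightarrow> pair_graph F \<Longrightarrow> pair_graph (glue H F)"
  unfolding pair_graph_iff by (auto simp: sym_def)

lemma pair_graph_induced: "pair_graph G \<Longrightarrow> S \<subseteq> pverts G \<Longrightarrow> pair_graph (induced G S)"
  unfolding pair_graph_iff by (auto simp: sym_def intro: finite_subset)

text \<open>
By the previous lemma the blocks of the glued graph are those of the two parts: a common
2-connected subgraph of both parts would contain a common arc.
\<close>

lemma block_stable_glue:
  assumes bs: "block_stable \<G>" and H: "pair_graph H" and F: "pair_graph F"
    and one: "\<And>a b. a \<in> pverts H \<inter> pverts F \<Longrightarrow> b \<in> pverts H \<inter> pverts F \<Longrightarrow> (a, b) \<in> (parcs F)\<^sup>* \<Longrightarrow> a = b"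
  shows "glue H F \<in> \<G> \<longleftrightarrow> H \<in> \<G> \<and> F \<in> \<G>"
proof -
  note G = pair_graph_glue[OF H F]
  have disj: "parcs H \<inter> parcs F = {}"
  proof -
    have False if "(x, y) \<in> parcs H" "(x, y) \<in> parcs F" for x y
    proof -
      have "x = y" using one[of x y] that pair_graphD[OF H] pair_graphD[OF F] by blast
      then show False using that pair_graphD[OF F] by auto
    qed
    then show ?thesis by auto
  qed
  have cm: False if "biconnected B" "psubgraph B H" "psubgraph B F" for B
    using biconnected_has_arc[OF that(1)] that disj by (auto simp: psubgraph_def)
  have "is_block B (glue H F) \<longleftrightarrow> is_block B H \<or> is_block B F" for B
  proof
    assume b: "is_block B (glue H F)"
    then have b': "psubgraph B (glue H F)" "biconnected B" "\<And>H'. psubgraph B H' \<Longrightarrow> psubgraph H' (glue H F) \<Longrightarrow> biconnected H' \<Longrightarrow> H' = B"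
      using is_block_iff[OF G] by auto
    have up: "psubgraph X (glue H F)" if "psubgraph X H \<or> psubgraph X F" for X using that by (auto simp: psubgraph_def)
    from biconnected_in_glue[OF H F one b'(2,1)] show "is_block B H \<or> is_block B F"
      unfolding is_block_iff[OF H] is_block_iff[OF F] using b' up by blast
  next
    have *: "B' = B" if "psubgraph B H \<and> psubgraph B' F \<or> psubgraph B F \<and> psubgraph B' H" "psubgraph B B'" "biconnected B" for B'
      using cm[OF that(3)] that psubgraph_trans by metis
    assume "is_block B H \<or> is_block B F"
    then show "is_block B (glue H F)"
    proof
      assume b: "is_block B H"
      then have b': "psubgraph B H" "biconnected B" "\<And>H'. psubgraph B H' \<Longrightarrow> psubgraph H' H \<Longrightarrow> biconnected H' \<Longrightarrow> H' = B"
        using is_block_iff[OF H] by auto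
      have "B' = B" if "psubgraph B B'" "psubgraph B' (glue H F)" "biconnected B'" for B'
        using biconnected_in_glue[OF H F one that(3,2)] b' that * by blast
      moreover have "psubgraph B (glue H F)" using b' by (auto simp: psubgraph_def)
      ultimately show ?thesis using b' is_block_iff[OF G] by auto
    next
      assume b: "is_block B F"
      then have b': "psubgraph B F" "biconnected B" "\<And>H'. psubgraph B H' \<Longrightarrow> psubgraph H' F \<Longrightarrow> biconnected H' \<Longrightarrow> H' = B"
        using is_block_iff[OF F] by auto
      have "B' = B" if "psubgraph B B'" "psubgraph B' (glue H F)" "biconnected B'" for B'
        using biconnected_in_glue[OF H F one that(3,2)] b' that * by blast
      moreover have "psubgraph B (glue H F)" using b' by (auto simp: psubgraph_def)
      ultimately show ?thesis using b' is_block_iff[OF G] by auto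
    qed
  qed
  then show ?thesis using bs H F G unfolding block_stable_def by blast
qed

section \<open>Domination and the decomposition at the root\<close>

text \<open>
Reachability and domination are taken relative to a set \<open>K\<close> of roots, one in each component, so
that a rooted connected graph and the forest of fringe subgraphs below its root are treated alike.
\<close>

definition reach_avoiding :: "'a pair_pre_digraph \<Rightarrow> 'a set \<Rightarrow> 'a \<Rightarrow> 'a set" where
  "reach_avoiding G K u = {w. \<exists>c\<in>K - {u}. (c, w) \<in> (avoid G u)\<^sup>*}"

definition dominated :: "'a pair_pre_digraph \<Rightarrow> 'a set \<Rightarrow> 'a \<Rightarrow> 'a set" where
  "dominated G K u = pverts G - reach_avoiding G K u"

definition core :: "'a pair_pre_digraph \<Rightarrow> 'a \<Rightarrow> bool" where
  "core H x \<longleftrightarrow> pair_graph H \<and> x \<in> pverts H \<and> pconnected H \<and>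
    (\<forall>c\<in>pverts H - {x}. \<forall>w\<in>pverts H - {c}. (x, w) \<in> (avoid H c)\<^sup>*)"

text \<open>
A disjoint union of connected graphs with one root each; \<open>K\<close> is the set of roots.
\<close>

definition rooted_parts :: "'a pair_pre_digraph \<Rightarrow> 'a set \<Rightarrow> bool" where
  "rooted_parts F K \<longleftrightarrow> pair_graph F \<and> K \<subseteq> pverts F \<and>
    (\<forall>w\<in>pverts F. \<exists>!c. c \<in> K \<and> (c, w) \<in> (parcs F)\<^sup>*)"

definition root_children :: "'a pair_pre_digraph \<Rightarrow> 'a \<Rightarrow> 'a set" where
  "root_children G x = {c \<in> pverts G - {x}. \<forall>u\<in>pverts G - {x, c}. c \<notin> dominated G {x} u}"

definition below_root :: "'a pair_pre_digraph \<Rightarrow> 'a \<Rightarrow> 'a pair_pre_digraph" where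
  "below_root G x = \<lparr>pverts = pverts G - {x},
     parcs = parcs G - insert x (root_children G x) \<times> insert x (root_children G x)\<rparr>"

lemma avoid_subset: "avoid G u \<subseteq> parcs G" by (auto simp: avoid_def)

lemma rtrancl_verts:
  assumes "pair_graph G" "(a, b) \<in> (parcs G)\<^sup>*" "a \<in> pverts G"
  shows "b \<in> pverts G"
  using assms(2,3) by (induct rule: rtrancl_induct) (auto dest: pair_graphD(5,6)[OF assms(1)])

lemma rtrancl_mono_rev: "R \<subseteq> S \<Longrightarrow> p \<in> R\<^sup>* \<Longrightarrow> p \<in> S\<^sup>*"
  using rtrancl_mono by blast

lemma dominated_root: "dominated G {x} x = pverts G"
  by (auto simp: dominated_def reach_avoiding_def)

lemma dominated_single: "u \<noteq> x \<Longrightarrow> dominated G {x} u = {w \<in> pverts G. (x, w) \<notin> (avoid G u)\<^sup>*}"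
  by (auto simp: dominated_def reach_avoiding_def)

lemma rooted_parts_single: "rooted_parts G {x} \<longleftrightarrow> pair_graph G \<and> x \<in> pverts G \<and> pconnected G"
proof
  assume r: "rooted_parts G {x}"
  then have *: "(x, w) \<in> (parcs G)\<^sup>*" if "w \<in> pverts G" for w
    using that by (auto simp: rooted_parts_def)
  have pg: "pair_graph G" using r by (auto simp: rooted_parts_def)
  have "(a, b) \<in> (parcs G)\<^sup>*" if "a \<in> pverts G" "b \<in> pverts G" for a b
    using *[OF that(1)] *[OF that(2)] pair_graphD(3)[OF pg] by (meson rtrancl_trans symD)
  then show "pair_graph G \<and> x \<in> pverts G \<and> pconnected G" using r by (auto simp: rooted_parts_def pconnected_def)
qed (auto simp: rooted_parts_def pconnected_def)

lemma rooted_parts_unique: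
  assumes "rooted_parts F K" "c \<in> K" "c' \<in> K" "(c, w) \<in> (parcs F)\<^sup>*" "(c', w) \<in> (parcs F)\<^sup>*"
  shows "c = c'"
proof -
  have "w \<in> pverts F" using assms rtrancl_verts[of F c w] by (auto simp: rooted_parts_def)
  then show ?thesis using assms by (auto simp: rooted_parts_def)
qed

lemma rooted_parts_root:
  assumes "rooted_parts F K" "w \<in> pverts F"
  obtains c where "c \<in> K" "(c, w) \<in> (parcs F)\<^sup>*"
  using assms by (auto simp: rooted_parts_def)

lemma rtrancl_avoid_outside:
  assumes "(a, w) \<in> (parcs F)\<^sup>*" "(a, u) \<notin> (parcs F)\<^sup>*"
  shows "(a, w) \<in> (avoid F u)\<^sup>*"
  using assms(1)
proof (induct rule: rtrancl_induct)
  case (step y z)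
  have "(a, z) \<in> (parcs F)\<^sup>*" using step by auto
  then have "(y, z) \<in> avoid F u" using step assms(2) by (auto simp: avoid_def)
  with step(3) show ?case by (rule rtrancl_into_rtrancl)
qed auto

text \<open>
A root \<open>c\<close> dominates exactly its component, because all other components are reached from their own
roots without \<open>c\<close>.
\<close>

lemma dominated_child:
  assumes r: "rooted_parts F K" and c: "c \<in> K"
  shows "dominated F K c = {w. (c, w) \<in> (parcs F)\<^sup>*}"
proof (intro set_eqI iffI)
  fix w assume w: "w \<in> dominated F K c"
  then obtain c2 where c2: "c2 \<in> K" "(c2, w) \<in> (parcs F)\<^sup>*"
    using rooted_parts_root[OF r] by (auto simp: dominated_def)
  have "c2 = c"
  proof (rule ccontr)
    assume n: "c2 \<noteq> c"
    then have "(c2, c) \<notin> (parcs F)\<^sup>*" using rooted_parts_unique[OF r c2(1) c] by blast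
    from rtrancl_avoid_outside[OF c2(2) this] show False using w n c2 by (auto simp: dominated_def reach_avoiding_def)
  qed
  then show "w \<in> {w. (c, w) \<in> (parcs F)\<^sup>*}" using c2 by auto
next
  fix w assume w: "w \<in> {w. (c, w) \<in> (parcs F)\<^sup>*}"
  have "w \<in> pverts F" using w r c rtrancl_verts[of F c w] by (auto simp: rooted_parts_def)
  moreover have "w \<notin> reach_avoiding F K c"
  proof
    assume "w \<in> reach_avoiding F K c"
    then obtain c2 where "c2 \<in> K" "c2 \<noteq> c" "(c2, w) \<in> (avoid F c)\<^sup>*" by (auto simp: reach_avoiding_def)
    then show False using rooted_parts_unique[OF r c, of c2 w] w
        rtrancl_mono_rev[OF avoid_subset, of "(c2, w)" F c] by auto
  qed
  ultimately show "w \<in> dominated F K c" by (auto simp: dominated_def)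
qed

text \<open>
Assembly of a rooted graph from a core and a forest whose roots are the other vertices of the core. The inverse
decomposition takes place in \<open>rooted_graph\<close>.
\<close>

locale root_glue =
  fixes H F :: "'a pair_pre_digraph" and x :: 'a and K :: "'a set"
  assumes core: "core H x" and parts: "rooted_parts F K"
    and vH: "pverts H = insert x K" and xF: "x \<notin> pverts F"
begin

lemma pgH: "pair_graph H" and pgF: "pair_graph F" and KF: "K \<subseteq> pverts F"
  using core parts by (auto simp: core_def rooted_parts_def)

lemma H_arcs: "(a, b) \<in> parcs H \<Longrightarrow> a \<in> insert x K \<and> b \<in> insert x K"
  using pair_graphD(5,6)[OF pgH] vH by blast

lemma verts_glue: "pverts (glue H F) = insert x (pverts F)"
  using vH KF by auto

lemma pg_glue: "pair_graph (glue H F)"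
  by (rule pair_graph_glue[OF pgH pgF])

lemma one_common:
  assumes "a \<in> pverts H \<inter> pverts F" "b \<in> pverts H \<inter> pverts F" "(a, b) \<in> (parcs F)\<^sup>*"
  shows "a = b"
  using assms vH xF rooted_parts_unique[OF parts, of a b b] by auto

text \<open>
Gluing a forest below a core changes nothing for domination by a vertex \<open>u\<close> of the forest: the core stays
connected without \<open>u\<close>, so \<open>x\<close> reaches every other root of the forest while avoiding \<open>u\<close>.
\<close>

lemma dominated_glue:
  assumes u: "u \<in> pverts F"
  shows "dominated (glue H F) {x} u = dominated F K u"
proof -
  have ux: "u \<noteq> x" using u xF by auto
  have 1: "w = x \<or> w \<in> reach_avoiding F K u" if "(x, w) \<in> (avoid (glue H F) u)\<^sup>*" for w
    using that
  proof (induct rule: rtrancl_induct)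
    case (step y z)
    then have zu: "z \<noteq> u" and yu: "y \<noteq> u" and "(y, z) \<in> parcs H \<or> (y, z) \<in> parcs F"
      by (auto simp: avoid_def)
    then show ?case
    proof (elim disjE)
      assume "(y, z) \<in> parcs H"
      then have "z \<in> insert x K" using pair_graphD(6)[OF pgH] vH by auto
      then show ?thesis using zu by (auto simp: reach_avoiding_def)
    next
      assume f: "(y, z) \<in> parcs F"
      then have "y \<noteq> x" using pair_graphD(5)[OF pgF] xF by auto
      then obtain c where "c \<in> K - {u}" "(c, y) \<in> (avoid F u)\<^sup>*" using step by (auto simp: reach_avoiding_def)
      moreover have "(y, z) \<in> avoid F u" using f yu zu by (auto simp: avoid_def)
      ultimately show ?thesis unfolding reach_avoiding_def by (blast intro: rtrancl_into_rtrancl)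
    qed
  qed auto
  have base: "(x, c) \<in> (avoid (glue H F) u)\<^sup>*" if c: "c \<in> K" "c \<noteq> u" for c
  proof -
    have "(x, c) \<in> (avoid H u)\<^sup>*"
    proof (cases "u \<in> K")
      case True
      then show ?thesis using core c ux vH unfolding core_def by blast
    next
      case False
      then have "avoid H u = parcs H" using ux by (auto simp: avoid_def dest: H_arcs)
      then show ?thesis using core vH c by (auto simp: core_def pconnected_def)
    qed
    then show ?thesis by (rule rtrancl_mono_rev[rotated]) (auto simp: avoid_def)
  qed
  have 2: "(x, w) \<in> (avoid (glue H F) u)\<^sup>*" if w: "w \<in> reach_avoiding F K u" for w
  proof -
    obtain c where c: "c \<in> K" "c \<noteq> u" "(c, w) \<in> (avoid F u)\<^sup>*" using w by (auto simp: reach_avoiding_def)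
    have "(c, w) \<in> (avoid (glue H F) u)\<^sup>*"
      by (rule rtrancl_mono_rev[OF _ c(3)]) (auto simp: avoid_def)
    with base[OF c(1,2)] show ?thesis by (rule rtrancl_trans)
  qed
  show ?thesis unfolding dominated_single[OF ux] verts_glue using 1 2 xF
    by (auto simp: dominated_def)
qed

lemma root_children_glue: "root_children (glue H F) x = K"
proof (intro set_eqI iffI)
  fix c assume c: "c \<in> root_children (glue H F) x"
  then have cF: "c \<in> pverts F" and *: "\<And>u. u \<in> pverts F \<Longrightarrow> u \<noteq> c \<Longrightarrow> c \<notin> dominated F K u"
    using xF dominated_glue unfolding root_children_def verts_glue by auto
  obtain c2 where c2: "c2 \<in> K" "(c2, c) \<in> (parcs F)\<^sup>*" using rooted_parts_root[OF parts cF] .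
  then have "c \<in> dominated F K c2" using dominated_child[OF parts] by auto
  then show "c \<in> K" using *[of c2] KF c2 by auto
next
  fix c assume c: "c \<in> K"
  have "c \<notin> dominated F K u" if "u \<noteq> c" "u \<in> pverts F" for u
  proof -
    have "c \<in> reach_avoiding F K u" using c that by (auto simp: reach_avoiding_def)
    then show ?thesis by (auto simp: dominated_def)
  qed
  then show "c \<in> root_children (glue H F) x"
    using c KF xF dominated_glue unfolding root_children_def verts_glue by auto
qed

lemma no_arcs_in_K: "(a, b) \<in> parcs F \<Longrightarrow> a \<in> insert x K \<Longrightarrow> b \<in> insert x K \<Longrightarrow> False"
  using one_common[of a b] pair_graphD[OF pgF] vH by blast

lemma induced_glue: "induced (glue H F) (insert x K) = H"
  using vH by (intro graph_eqI) (auto dest: H_arcs no_arcs_in_K)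

lemma below_root_glue: "below_root (glue H F) x = F"
  unfolding below_root_def root_children_glue verts_glue
  using xF by (intro graph_eqI) (auto dest: H_arcs no_arcs_in_K)

lemma pconnected_glue: "pconnected (glue H F)"
proof -
  have "(x, w) \<in> (parcs (glue H F))\<^sup>*" if "w \<in> pverts (glue H F)" for w
  proof (cases "w = x")
    case False
    then have "w \<in> pverts F" using that verts_glue by auto
    then obtain c where c: "c \<in> K" "(c, w) \<in> (parcs F)\<^sup>*" using rooted_parts_root[OF parts] by blast
    have "(x, c) \<in> (parcs H)\<^sup>*" using c core vH by (auto simp: core_def pconnected_def)
    then have "(x, c) \<in> (parcs (glue H F))\<^sup>*" by (rule rtrancl_mono_rev[rotated]) auto
    moreover have "(c, w) \<in> (parcs (glue H F))\<^sup>*" by (rule rtrancl_mono_rev[OF _ c(2)]) auto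
    ultimately show ?thesis by (rule rtrancl_trans)
  qed auto
  then have "rooted_parts (glue H F) {x}" using pg_glue vH by (auto simp: rooted_parts_def)
  then show ?thesis by (simp add: rooted_parts_single)
qed

end

locale rooted_graph =
  fixes G :: "'a pair_pre_digraph" and x :: 'a
  assumes pg: "pair_graph G" and xG: "x \<in> pverts G" and cG: "pconnected G"
begin

abbreviation "fringe u \<equiv> dominated G {x} u"
abbreviation "children \<equiv> root_children G x"

lemma fringe_iff: "u \<noteq> x \<Longrightarrow> w \<in> fringe u \<longleftrightarrow> w \<in> pverts G \<and> (x, w) \<notin> (avoid G u)\<^sup>*"
  by (simp add: dominated_single)

lemma fringe_verts: "fringe u \<subseteq> pverts G"
  by (auto simp: dominated_def)

lemma fringe_self: "u \<in> pverts G \<Longrightarrow> u \<in> fringe u"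
proof (cases "u = x")
  case False
  assume u: "u \<in> pverts G"
  have "w \<noteq> u" if "(x, w) \<in> (avoid G u)\<^sup>*" for w
    using that False by (induct rule: rtrancl_induct) (auto simp: avoid_def)
  then show ?thesis using fringe_iff[OF False] u by auto
qed (simp add: dominated_root)

lemma root_notin_fringe: "u \<noteq> x \<Longrightarrow> x \<notin> fringe u"
  by (simp add: fringe_iff)

text \<open>
A neighbour of \<open>a\<close> that \<open>x\<close> reaches while avoiding \<open>c\<close> makes \<open>a\<close> reachable as well, unless \<open>a = c\<close>. So a
fringe can be entered and left only through its root.
\<close>

lemma exit_fringe:
  assumes "(a, b) \<in> parcs G" "a \<in> fringe c" "b \<notin> fringe c"
  shows "a = c"
proof (rule ccontr)
  assume n: "a \<noteq> c"
  have c: "c \<noteq> x" using assms pair_graphD(6)[OF pg] by (auto simp: dominated_root)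
  have b: "b \<in> pverts G" using assms pair_graphD(6)[OF pg] by auto
  have xb: "(x, b) \<in> (avoid G c)\<^sup>*" using assms(3) b fringe_iff[OF c] by auto
  have "b \<noteq> c" using fringe_self b assms(3) by auto
  then have "(b, a) \<in> avoid G c" using n assms(1) pair_graphD(8)[OF pg] by (auto simp: avoid_def)
  with xb have "(x, a) \<in> (avoid G c)\<^sup>*" by (rule rtrancl_into_rtrancl)
  then show False using assms(2) fringe_iff[OF c] by auto
qed

lemma reach_x: "w \<in> pverts G \<Longrightarrow> (x, w) \<in> (parcs G)\<^sup>*"
  using cG xG by (auto simp: pconnected_def)

lemma reach_in_fringe:
  assumes "w \<in> fringe c" "c \<noteq> x"
  shows "(c, w) \<in> (parcs G \<inter> fringe c \<times> fringe c)\<^sup>*"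
proof -
  have "(x, w) \<in> (parcs G)\<^sup>*" using assms reach_x fringe_iff by auto
  then show ?thesis using assms(1)
  proof (induct rule: rtrancl_induct)
    case base then show ?case using root_notin_fringe assms by auto
  next
    case (step y z)
    show ?case
    proof (cases "y \<in> fringe c")
      case True
      then have "(y, z) \<in> parcs G \<inter> fringe c \<times> fringe c" using step by auto
      with step(3)[OF True] show ?thesis by (rule rtrancl_into_rtrancl)
    next
      case False
      then have "z = c" using exit_fringe[of z y c] step pair_graphD(8)[OF pg] by auto
      then show ?thesis by auto
    qed
  qed
qed

lemma fringe_trans:
  assumes "u \<in> fringe v" shows "fringe u \<subseteq> fringe v"
proof (cases "v = x \<or> u = x")
  case True
  then show ?thesis using assms fringe_verts[of u] fringe_verts[of v] root_notin_fringe[of v] by (auto simp: dominated_root)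
next
  case False
  show ?thesis
  proof
    fix w assume w: "w \<in> fringe u"
    show "w \<in> fringe v"
    proof (rule ccontr)
      assume "w \<notin> fringe v"
      then have "(x, w) \<in> (avoid G v)\<^sup>*" using w False fringe_iff by auto
      then have "(x, w) \<in> (avoid G u)\<^sup>*"
      proof (induct rule: rtrancl_induct)
        case (step y z)
        have "(x, z) \<in> (avoid G v)\<^sup>*" using step(1,2) by (rule rtrancl_into_rtrancl)
        then have "y \<noteq> u" "z \<noteq> u" using step assms False fringe_iff[of v u] by auto
        then have "(y, z) \<in> avoid G u" using step by (auto simp: avoid_def)
        with step(3) show ?case by (rule rtrancl_into_rtrancl)
      qed auto
      then show False using w False fringe_iff by auto
    qed
  qed
qed

lemma fringe_antisym:
  assumes "u \<in> fringe v" "v \<in> fringe u" shows "u = v"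
proof (rule ccontr)
  assume n: "u \<noteq> v"
  have nx: "u \<noteq> x" "v \<noteq> x" using assms n root_notin_fringe by auto
  have "z \<noteq> u \<and> z \<noteq> v \<and> (x, z) \<in> (avoid G u)\<^sup>* \<and> (x, z) \<in> (avoid G v)\<^sup>*" if "(x, z) \<in> (parcs G)\<^sup>*" for z
    using that
  proof (induct rule: rtrancl_induct)
    case base then show ?case using nx by auto
  next
    case (step y z)
    have "z \<noteq> u"
    proof
      assume "z = u"
      then have "(y, u) \<in> avoid G v" using step n by (auto simp: avoid_def)
      then have "(x, u) \<in> (avoid G v)\<^sup>*" using step(3) by (blast intro: rtrancl_into_rtrancl)
      then show False using assms(1) nx fringe_iff by auto
    qed
    moreover have "z \<noteq> v"
    proof
      assume "z = v"
      then have "(y, v) \<in> avoid G u" using step n by (auto simp: avoid_def)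
      then have "(x, v) \<in> (avoid G u)\<^sup>*" using step(3) by (blast intro: rtrancl_into_rtrancl)
      then show False using assms(2) nx fringe_iff by auto
    qed
    ultimately have "(y, z) \<in> avoid G u" "(y, z) \<in> avoid G v" using step by (auto simp: avoid_def)
    then show ?case using step(3) \<open>z \<noteq> u\<close> \<open>z \<noteq> v\<close> by (blast intro: rtrancl_into_rtrancl)
  qed
  moreover have "u \<in> pverts G" using assms fringe_verts by auto
  ultimately show False using reach_x by blast
qed

lemma child_notin_fringe: "c \<in> children \<Longrightarrow> u \<noteq> x \<Longrightarrow> u \<noteq> c \<Longrightarrow> u \<in> pverts G \<Longrightarrow> c \<notin> fringe u"
  by (auto simp: root_children_def)

lemma children_verts: "children \<subseteq> pverts G" "x \<notin> children"
  by (auto simp: root_children_def)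

text \<open>
If a vertex were dominated by two children, \<open>x\<close> would reach it through the first child without
the second one, since neither child dominates the other.
\<close>

lemma fringe_disjoint:
  assumes "c \<in> children" "c' \<in> children" "w \<in> fringe c" "w \<in> fringe c'"
  shows "c = c'"
proof (rule ccontr)
  assume n: "c \<noteq> c'"
  have nx: "c \<noteq> x" "c' \<noteq> x" and vs: "c \<in> pverts G" "c' \<in> pverts G" using assms children_verts by auto
  have nd: "c \<notin> fringe c'" "c' \<notin> fringe c" using child_notin_fringe assms n nx vs by auto
  have "(c, w) \<in> (avoid G c')\<^sup>*"
    by (rule rtrancl_mono_rev[OF _ reach_in_fringe[OF assms(3) nx(1)]]) (use nd in \<open>auto simp: avoid_def\<close>)
  moreover have "(x, c) \<in> (avoid G c')\<^sup>*" using nd nx vs fringe_iff by auto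
  ultimately have "(x, w) \<in> (avoid G c')\<^sup>*" by (meson rtrancl_trans)
  then show False using assms(4) nx fringe_iff by auto
qed

lemma obtain_max_card:
  assumes "w \<in> S" "finite S"
  shows "\<exists>c\<in>S. \<forall>u\<in>S. card (f u) \<le> card (f c)"
proof -
  let ?f = "\<lambda>u. card (f u)"
  have "Max (?f ` S) \<in> ?f ` S" using assms by (intro Max_in) auto
  then obtain c where "c \<in> S" "Max (?f ` S) = ?f c" by auto
  moreover have "?f u \<le> Max (?f ` S)" if "u \<in> S" for u using that assms by (intro Max_ge) auto
  ultimately show ?thesis by auto
qed

text \<open>
Domination is a partial order, and a maximal fringe containing \<open>w\<close>, other than the whole graph,
belongs to a child of the root.
\<close>

lemma ex_child:
  assumes w: "w \<in> pverts G" "w \<noteq> x"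
  obtains c where "c \<in> children" "w \<in> fringe c"
proof -
  define S where "S = {u \<in> pverts G - {x}. w \<in> fringe u}"
  have "w \<in> S" using w fringe_self by (auto simp: S_def)
  moreover have fin: "finite S" using pair_graphD(1)[OF pg] by (auto simp: S_def)
  ultimately obtain c where c: "c \<in> S" and mx: "\<And>u. u \<in> S \<Longrightarrow> card (fringe u) \<le> card (fringe c)"
    using obtain_max_card[of w S fringe] by blast
  have "c \<in> children"
  proof -
    have "c \<notin> fringe u" if u: "u \<in> pverts G - {x, c}" for u
    proof
      assume cu: "c \<in> fringe u"
      have sub: "fringe c \<subseteq> fringe u" by (rule fringe_trans[OF cu])
      have "u \<notin> fringe c" using fringe_antisym cu u by blast
      then have "fringe c \<subset> fringe u" using sub fringe_self[of u] u by auto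
      moreover have "finite (fringe u)" using pair_graphD(1)[OF pg] fringe_verts finite_subset by blast
      ultimately have "card (fringe c) < card (fringe u)" by (simp add: psubset_card_mono)
      moreover have "u \<in> S" using u sub c by (auto simp: S_def)
      ultimately show False using mx by fastforce
    qed
    then show ?thesis using c by (auto simp: root_children_def S_def)
  qed
  then show ?thesis using that c by (auto simp: S_def)
qed

text \<open>
The retraction of the graph onto its core, which collapses each fringe to its root. Arcs map to arcs
of the core or collapse, so walks of the graph project to walks of the core.
\<close>

definition branch :: "'a \<Rightarrow> 'a" where
  "branch w = (if w = x then x else (THE c. c \<in> children \<and> w \<in> fringe c))"

lemma branch_eq: "c \<in> children \<Longrightarrow> w \<in> fringe c \<Longrightarrow> branch w = c"
  using fringe_disjoint root_notin_fringe[of c] children_verts unfolding branch_def by (auto intro!: the_equality)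

lemma branch_child: "c \<in> children \<Longrightarrow> branch c = c"
  using branch_eq fringe_self children_verts by blast

lemma branch_root: "branch x = x" by (simp add: branch_def)

lemma branch_in: "w \<in> pverts G \<Longrightarrow> w \<noteq> x \<Longrightarrow> branch w \<in> children \<and> w \<in> fringe (branch w)"
  using ex_child branch_eq by metis

lemma arc_branch:
  assumes "(y, z) \<in> parcs G" "branch y \<noteq> branch z"
  shows "branch y = y \<and> y \<in> insert x children"
proof (cases "y = x")
  case False
  have v: "y \<in> pverts G" "z \<in> pverts G" using assms pair_graphD(5,6)[OF pg] by auto
  note y = branch_in[OF v(1) False]
  have "z \<notin> fringe (branch y)" using branch_eq y assms(2) by metis
  then have "y = branch y" using exit_fringe[OF assms(1)] y by blast
  then show ?thesis using y by (metis insertCI)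
qed (simp add: branch_root)

lemma core_induced: "core (induced G (insert x children)) x"
proof -
  let ?H = "induced G (insert x children)"
  have pgH: "pair_graph ?H" using pair_graph_induced[OF pg] xG children_verts by auto
  have st: "branch y = branch z \<or> (y, z) \<in> parcs ?H \<and> branch y = y \<and> branch z = z" if "(y, z) \<in> parcs G" for y z
    using arc_branch[OF that] arc_branch[of z y] pair_graphD(8)[OF pg that] that by auto
  have a: "(x, branch w) \<in> (parcs ?H)\<^sup>*" if "(x, w) \<in> (parcs G)\<^sup>*" for w
    using that
  proof (induct rule: rtrancl_induct)
    case (step y z)
    show ?case using st[OF step(2)] step(3) by (metis rtrancl.rtrancl_into_rtrancl)
  qed (simp add: branch_root)
  have b: "(x, branch w) \<in> (avoid ?H c)\<^sup>*" if "(x, w) \<in> (avoid G c)\<^sup>*" for w c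
    using that
  proof (induct rule: rtrancl_induct)
    case (step y z)
    then have "(y, z) \<in> parcs G" "y \<noteq> c" "z \<noteq> c" by (auto simp: avoid_def)
    then have "branch y = branch z \<or> (branch y, branch z) \<in> avoid ?H c" using st[of y z] by (auto simp: avoid_def)
    then show ?case using step(3) by (metis rtrancl.rtrancl_into_rtrancl)
  qed (simp add: branch_root)
  have "rooted_parts ?H {x}"
    using a[OF reach_x] pgH branch_child children_verts unfolding rooted_parts_def
    by (auto simp: subset_iff) (metis branch_child)
  then have "pconnected ?H" by (simp add: rooted_parts_single)
  moreover have "(x, w) \<in> (avoid ?H c)\<^sup>*" if c: "c \<in> children" and w: "w \<in> insert x children" "w \<noteq> c" for c w
  proof (cases "w = x")
    case False
    then have "w \<in> children" using w by auto
    then have "w \<notin> fringe c" using child_notin_fringe[of w c] c children_verts w by auto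
    then have "(x, w) \<in> (avoid G c)\<^sup>*" using fringe_iff[of c w] c children_verts \<open>w \<in> children\<close> by auto
    from b[OF this] show ?thesis using branch_child[OF \<open>w \<in> children\<close>] by simp
  qed auto
  ultimately show ?thesis using pgH unfolding core_def by auto
qed

lemma pg_below: "pair_graph (below_root G x)"
proof -
  have "(a, b) \<in> parcs G \<Longrightarrow> a = x \<Longrightarrow> b \<in> children" for a b
    using arc_branch[of b a] branch_root branch_in[of b] pair_graphD[OF pg] by (metis insertE root_notin_fringe children_verts(2))
  then have "(x, b) \<in> parcs G \<Longrightarrow> b \<in> children" for b by auto
  moreover have "(b, x) \<in> parcs G \<Longrightarrow> b \<in> children" for b using calculation pair_graphD(8)[OF pg] by auto
  ultimately show ?thesis using pg unfolding pair_graph_iff below_root_def by (auto simp: sym_def)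
qed

lemma parts_below: "rooted_parts (below_root G x) children"
proof -
  let ?F = "below_root G x"
  have F: "pverts ?F = pverts G - {x}" "parcs ?F = parcs G - insert x children \<times> insert x children"
    by (auto simp: below_root_def)
  have a: "(c, w) \<in> (parcs ?F)\<^sup>*" if c: "c \<in> children" and w: "w \<in> fringe c" for c w
  proof -
    have nx: "c \<noteq> x" using c children_verts by auto
    have "a = c" if "a \<in> fringe c" "a \<in> insert x children" for a
      using that branch_child branch_eq[OF c] root_notin_fringe[OF nx] by (metis insertE)
    then have "parcs G \<inter> fringe c \<times> fringe c \<subseteq> parcs ?F"
      unfolding F using pair_graphD(7)[OF pg] by auto
    then show ?thesis using reach_in_fringe[OF w nx] rtrancl_mono_rev by blast
  qed
  have b: "w \<in> fringe c" if "(c, w) \<in> (parcs ?F)\<^sup>*" "c \<in> children" for c w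
    using that(1)
  proof (induct rule: rtrancl_induct)
    case base then show ?case using that fringe_self children_verts by auto
  next
    case (step y z)
    have yz: "(y, z) \<in> parcs G" "\<not> (y \<in> insert x children \<and> z \<in> insert x children)" using step F by auto
    have "branch y = branch z" using arc_branch[of y z] arc_branch[of z y] yz pair_graphD(8)[OF pg] by metis
    then have "branch z = c" using branch_eq[OF that(2) step(3)] by simp
    moreover have "z \<noteq> x" using calculation branch_root that children_verts by auto
    ultimately show ?case using branch_in[of z] pair_graphD(6)[OF pg yz(1)] by auto
  qed
  show ?thesis unfolding rooted_parts_def
  proof (intro conjI ballI)
    show "children \<subseteq> pverts ?F" using children_verts F by auto
    fix w assume "w \<in> pverts ?F"
    then obtain c where c: "c \<in> children" "w \<in> fringe c" using ex_child F by auto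
    show "\<exists>!c. c \<in> children \<and> (c, w) \<in> (parcs ?F)\<^sup>*"
      using a[OF c] b fringe_disjoint c by (metis (no_types, lifting))
  qed (rule pg_below)
qed

lemma root_glue_axioms: "root_glue (induced G (insert x children)) (below_root G x) x children"
  by unfold_locales (use core_induced parts_below in \<open>auto simp: below_root_def\<close>)

lemma glue_decomposition: "glue (induced G (insert x children)) (below_root G x) = G"
  using xG children_verts by (intro graph_eqI) (auto simp: below_root_def)

end

section \<open>Disjoint unions of rooted graphs\<close>

lemma rtrancl_disjoint_Un:
  assumes "(c, w) \<in> (R1 \<union> R2)\<^sup>*" "c \<in> V1" "R1 \<subseteq> V1 \<times> V1" "R2 \<subseteq> V2 \<times> V2" "V1 \<inter> V2 = {}"
  shows "(c, w) \<in> R1\<^sup>* \<and> w \<in> V1"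
  using assms(1,2)
proof (induct rule: rtrancl_induct)
  case (step y z)
  then have "(y, z) \<in> R1" using assms(3-5) by blast
  then show ?case using step assms(3) by (auto intro: rtrancl_into_rtrancl)
qed auto

lemma pair_graph_arcs: "pair_graph G \<Longrightarrow> parcs G \<subseteq> pverts G \<times> pverts G"
  by (auto simp: pair_graph_iff)

lemma avoid_arcs: "pair_graph G \<Longrightarrow> avoid G u \<subseteq> pverts G \<times> pverts G"
  using pair_graph_arcs avoid_subset by fastforce

lemma avoid_glue: "avoid (glue G H) u = avoid G u \<union> avoid H u"
  by (auto simp: avoid_def)

lemma avoid_outside: "pair_graph G \<Longrightarrow> u \<notin> pverts G \<Longrightarrow> avoid G u = parcs G"
  using pair_graph_arcs by (fastforce simp: avoid_def)

lemma glue_comm: "glue G H = glue H G"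
  by (auto simp: glue_def)

lemma induced_self: "pair_graph G \<Longrightarrow> induced G (pverts G) = G"
  using pair_graph_arcs by (intro graph_eqI) auto

lemma induced_induced: "S \<subseteq> T \<Longrightarrow> induced (induced G T) S = induced G S"
  by (intro graph_eqI) auto

locale disjoint_parts =
  fixes F1 F2 :: "'a pair_pre_digraph" and K1 K2 :: "'a set"
  assumes parts1: "rooted_parts F1 K1" and parts2: "rooted_parts F2 K2"
    and disj: "pverts F1 \<inter> pverts F2 = {}"
begin

lemma pg1: "pair_graph F1" and pg2: "pair_graph F2" and KV1: "K1 \<subseteq> pverts F1" and KV2: "K2 \<subseteq> pverts F2"
  using parts1 parts2 by (auto simp: rooted_parts_def)

lemma reach_glue1: "c \<in> pverts F1 \<Longrightarrow> (c, w) \<in> (parcs (glue F1 F2))\<^sup>* \<longleftrightarrow> (c, w) \<in> (parcs F1)\<^sup>*"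
  using rtrancl_disjoint_Un[OF _ _ pair_graph_arcs[OF pg1] pair_graph_arcs[OF pg2] disj, of c w]
    rtrancl_mono_rev[of "parcs F1" "parcs F1 \<union> parcs F2" "(c, w)"] by auto

lemma reach_glue2: "c \<in> pverts F2 \<Longrightarrow> (c, w) \<in> (parcs (glue F1 F2))\<^sup>* \<longleftrightarrow> (c, w) \<in> (parcs F2)\<^sup>*"
  using rtrancl_disjoint_Un[OF _ _ pair_graph_arcs[OF pg2] pair_graph_arcs[OF pg1], of c w] disj
    rtrancl_mono_rev[of "parcs F2" "parcs F1 \<union> parcs F2" "(c, w)"] by (auto simp: Un_commute)

lemma rooted_parts_glue: "rooted_parts (glue F1 F2) (K1 \<union> K2)"
proof -
  have "\<exists>!c. c \<in> K1 \<union> K2 \<and> (c, w) \<in> (parcs (glue F1 F2))\<^sup>*" if w: "w \<in> pverts F1 \<union> pverts F2" for w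
  proof -
    have 1: "c \<in> K1 \<Longrightarrow> (c, w) \<in> (parcs (glue F1 F2))\<^sup>* \<longleftrightarrow> (c, w) \<in> (parcs F1)\<^sup>*" for c
      using reach_glue1 KV1 by auto
    have 2: "c \<in> K2 \<Longrightarrow> (c, w) \<in> (parcs (glue F1 F2))\<^sup>* \<longleftrightarrow> (c, w) \<in> (parcs F2)\<^sup>*" for c
      using reach_glue2 KV2 by auto
    have 3: "c \<in> K1 \<Longrightarrow> (c, w) \<in> (parcs F1)\<^sup>* \<Longrightarrow> w \<in> pverts F1" for c
      using rtrancl_verts[OF pg1] KV1 by auto
    have 4: "c \<in> K2 \<Longrightarrow> (c, w) \<in> (parcs F2)\<^sup>* \<Longrightarrow> w \<in> pverts F2" for c
      using rtrancl_verts[OF pg2] KV2 by auto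
    from w show ?thesis
    proof
      assume w: "w \<in> pverts F1"
      then obtain d where d: "d \<in> K1" "(d, w) \<in> (parcs F1)\<^sup>*" using rooted_parts_root[OF parts1] by blast
      have "e = d" if "e \<in> K1" "(e, w) \<in> (parcs F1)\<^sup>*" for e
        using rooted_parts_unique[OF parts1 that(1) d(1) that(2) d(2)] .
      moreover have "w \<notin> pverts F2" using w disj by auto
      ultimately show ?thesis using 1 2 4 d by (intro ex1I[of _ d]) blast+
    next
      assume w: "w \<in> pverts F2"
      then obtain d where d: "d \<in> K2" "(d, w) \<in> (parcs F2)\<^sup>*" using rooted_parts_root[OF parts2] by blast
      have "e = d" if "e \<in> K2" "(e, w) \<in> (parcs F2)\<^sup>*" for e
        using rooted_parts_unique[OF parts2 that(1) d(1) that(2) d(2)] .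
      moreover have "w \<notin> pverts F1" using w disj by auto
      ultimately show ?thesis using 1 2 3 d by (intro ex1I[of _ d]) blast+
    qed
  qed
  then show ?thesis using pair_graph_glue[OF pg1 pg2] KV1 KV2 by (auto simp: rooted_parts_def)
qed

text \<open>
The other part has no effect on domination by \<open>u\<close>: it is reached from its own roots, and \<open>u\<close> is not in it.
\<close>

lemma dominated_disjoint1:
  assumes u: "u \<in> pverts F1"
  shows "dominated (glue F1 F2) (K1 \<union> K2) u = dominated F1 K1 u"
proof -
  have u2: "u \<notin> pverts F2" using u disj by auto
  have a1: "(c, w) \<in> (avoid (glue F1 F2) u)\<^sup>* \<longleftrightarrow> (c, w) \<in> (avoid F1 u)\<^sup>*" if "c \<in> K1" for c w
    using rtrancl_disjoint_Un[OF _ _ avoid_arcs[OF pg1] avoid_arcs[OF pg2] disj, of c w u u] that KV1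
      rtrancl_mono_rev[of "avoid F1 u" "avoid F1 u \<union> avoid F2 u" "(c, w)"] by (auto simp: avoid_glue)
  have a2: "w \<in> pverts F2" if "(c, w) \<in> (avoid (glue F1 F2) u)\<^sup>*" "c \<in> K2" for c w
    using rtrancl_disjoint_Un[OF _ _ avoid_arcs[OF pg2] avoid_arcs[OF pg1], of c w u u] that KV2 disj
    by (auto simp: avoid_glue Un_commute)
  have a3: "w \<in> reach_avoiding (glue F1 F2) (K1 \<union> K2) u" if w: "w \<in> pverts F2" for w
  proof -
    obtain c where c: "c \<in> K2" "(c, w) \<in> (parcs F2)\<^sup>*" using rooted_parts_root[OF parts2 w] .
    have "(c, w) \<in> (avoid (glue F1 F2) u)\<^sup>*"
      by (rule rtrancl_mono_rev[OF _ c(2)]) (simp add: avoid_glue avoid_outside[OF pg2 u2])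
    then show ?thesis using c u2 KV2 by (auto simp: reach_avoiding_def)
  qed
  have "w \<in> reach_avoiding (glue F1 F2) (K1 \<union> K2) u \<longleftrightarrow> w \<in> reach_avoiding F1 K1 u" if w: "w \<in> pverts F1" for w
  proof
    assume "w \<in> reach_avoiding F1 K1 u"
    then show "w \<in> reach_avoiding (glue F1 F2) (K1 \<union> K2) u" using a1 by (auto simp: reach_avoiding_def)
  next
    assume "w \<in> reach_avoiding (glue F1 F2) (K1 \<union> K2) u"
    then show "w \<in> reach_avoiding F1 K1 u" using a1 a2 w disj by (fastforce simp: reach_avoiding_def)
  qed
  then show ?thesis using a3 by (auto simp: dominated_def)
qed

lemma induced_glue1: "induced (glue F1 F2) (pverts F1) = F1"
  using pair_graph_arcs[OF pg1] pair_graph_arcs[OF pg2] disj by (intro graph_eqI) auto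

lemma induced_glue2: "induced (glue F1 F2) (pverts F2) = F2"
  using pair_graph_arcs[OF pg1] pair_graph_arcs[OF pg2] disj by (intro graph_eqI) auto

lemma induced_glue_subset1: "S \<subseteq> pverts F1 \<Longrightarrow> induced (glue F1 F2) S = induced F1 S"
  using induced_induced[of S "pverts F1" "glue F1 F2"] induced_glue1 by simp

end

lemma disjoint_parts_commute: "disjoint_parts F1 F2 K1 K2 \<Longrightarrow> disjoint_parts F2 F1 K2 K1"
  by (auto simp: disjoint_parts_def)

text \<open>
Splitting off the component of one root; iterating this reduces sums over forests to sums over
connected graphs.
\<close>

lemma peel:
  fixes c F defines "A \<equiv> {w. (c, w) \<in> (parcs F)\<^sup>*}"
  assumes r: "rooted_parts F (insert c K)" and c: "c \<notin> K"
  shows "rooted_parts (induced F A) {c}" "rooted_parts (induced F (pverts F - A)) K"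
    "glue (induced F A) (induced F (pverts F - A)) = F" "A \<subseteq> pverts F" "K \<subseteq> pverts F - A" "c \<in> A"
proof -
  have pg: "pair_graph F" and KV: "insert c K \<subseteq> pverts F" using r by (auto simp: rooted_parts_def)
  show AV: "A \<subseteq> pverts F" using rtrancl_verts[OF pg] KV by (auto simp: A_def)
  show cA: "c \<in> A" by (auto simp: A_def)
  show KA: "K \<subseteq> pverts F - A" using KV c rooted_parts_unique[OF r] unfolding A_def by blast
  have cross: "a \<in> A \<longleftrightarrow> b \<in> A" if "(a, b) \<in> parcs F" for a b
    using that pair_graphD(8)[OF pg that] unfolding A_def by (auto intro: rtrancl_into_rtrancl)
  show gl: "glue (induced F A) (induced F (pverts F - A)) = F"
    using cross pair_graph_arcs[OF pg] AV by (intro graph_eqI) auto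
  have in1: "(a, w) \<in> (parcs (induced F A))\<^sup>*" if "(a, w) \<in> (parcs F)\<^sup>*" "a \<in> A" for a w
    using rtrancl_disjoint_Un[of a w "parcs (induced F A)" "parcs (induced F (pverts F - A))" A "pverts F - A"] that gl
    by (metis Diff_disjoint glue_simps(2) induced_simps(2) inf_sup_ord(2))
  have in2: "(a, w) \<in> (parcs (induced F (pverts F - A)))\<^sup>*" if "(a, w) \<in> (parcs F)\<^sup>*" "a \<in> pverts F - A" for a w
    using rtrancl_disjoint_Un[of a w "parcs (induced F (pverts F - A))" "parcs (induced F A)" "pverts F - A" A] that gl
    by (metis Diff_disjoint Int_commute Un_commute glue_simps(2) induced_simps(2) inf_sup_ord(2))
  have mono: "(a, w) \<in> (parcs (induced F S))\<^sup>* \<Longrightarrow> (a, w) \<in> (parcs F)\<^sup>*" for a w S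
    by (rule rtrancl_mono_rev[rotated]) auto
  show "rooted_parts (induced F A) {c}"
    using pair_graph_induced[OF pg AV] cA in1 unfolding rooted_parts_def by (auto simp: A_def)
  show "rooted_parts (induced F (pverts F - A)) K"
    unfolding rooted_parts_def
  proof (intro conjI ballI)
    show "pair_graph (induced F (pverts F - A))" using pair_graph_induced[OF pg] by auto
    show "K \<subseteq> pverts (induced F (pverts F - A))" using KA by auto
    fix w assume "w \<in> pverts (induced F (pverts F - A))"
    then have w: "w \<in> pverts F" "(c, w) \<notin> (parcs F)\<^sup>*" by (auto simp: A_def)
    obtain d where d: "d \<in> insert c K" "(d, w) \<in> (parcs F)\<^sup>*" using rooted_parts_root[OF r w(1)] .
    then have dK: "d \<in> K" using w by auto
    show "\<exists>!c. c \<in> K \<and> (c, w) \<in> (parcs (induced F (pverts F - A)))\<^sup>*"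
    proof (rule ex1I[of _ d])
      show "d \<in> K \<and> (d, w) \<in> (parcs (induced F (pverts F - A)))\<^sup>*" using in2[OF d(2)] dK KA by auto
      fix e assume "e \<in> K \<and> (e, w) \<in> (parcs (induced F (pverts F - A)))\<^sup>*"
      then show "e = d" using rooted_parts_unique[OF r _ d(1) _ d(2), of e] mono by blast
    qed
  qed
qed

section \<open>Additive statistics\<close>

text \<open>
The depth in the tree of domination, where the strict dominators are the ancestors.
\<close>

definition depth :: "'a pair_pre_digraph \<Rightarrow> 'a set \<Rightarrow> 'a \<Rightarrow> nat" where
  "depth G K w = card {v \<in> pverts G. v \<noteq> w \<and> w \<in> dominated G K v}"

definition level :: "nat \<Rightarrow> 'a pair_pre_digraph \<Rightarrow> 'a set \<Rightarrow> nat" where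
  "level r G K = card {w \<in> pverts G. depth G K w = r}"

text \<open>
The functional \<open>N\<close> of the introduction, for a forest with roots \<open>K\<close>.
\<close>

definition fringe_sum :: "('a pair_pre_digraph \<Rightarrow> 'a \<Rightarrow> nat) \<Rightarrow> 'a pair_pre_digraph \<Rightarrow> 'a set \<Rightarrow> nat" where
  "fringe_sum h G K = (\<Sum>u\<in>pverts G. h (induced G (dominated G K u)) u)"

lemma dominated_verts: "dominated G K u \<subseteq> pverts G"
  by (auto simp: dominated_def)

lemma dominated_vertsD: "w \<in> dominated G K u \<Longrightarrow> w \<in> pverts G"
  by (auto simp: dominated_def)

context disjoint_parts begin

lemma dominated_disjoint2: "u \<in> pverts F2 \<Longrightarrow> dominated (glue F1 F2) (K1 \<union> K2) u = dominated F2 K2 u"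
  using disjoint_parts.dominated_disjoint1[OF disjoint_parts_commute[OF disjoint_parts_axioms]]
  by (simp add: glue_comm Un_commute)

lemma induced_glue_subset2: "S \<subseteq> pverts F2 \<Longrightarrow> induced (glue F1 F2) S = induced F2 S"
  using induced_induced[of S "pverts F2" "glue F1 F2"] induced_glue2 by simp

lemma depth_disjoint1:
  assumes w: "w \<in> pverts F1"
  shows "depth (glue F1 F2) (K1 \<union> K2) w = depth F1 K1 w"
proof -
  have "w \<notin> dominated F2 K2 v" for v using w disj dominated_vertsD by fastforce
  then show ?thesis unfolding depth_def using dominated_disjoint1 dominated_disjoint2
    by (intro arg_cong[of _ _ card]) auto
qed

lemma depth_disjoint2:
  assumes w: "w \<in> pverts F2"
  shows "depth (glue F1 F2) (K1 \<union> K2) w = depth F2 K2 w"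
proof -
  have "w \<notin> dominated F1 K1 v" for v using w disj dominated_vertsD by fastforce
  then show ?thesis unfolding depth_def using dominated_disjoint1 dominated_disjoint2
    by (intro arg_cong[of _ _ card]) auto
qed

lemma level_disjoint: "level r (glue F1 F2) (K1 \<union> K2) = level r F1 K1 + level r F2 K2"
proof -
  have "{w \<in> pverts (glue F1 F2). depth (glue F1 F2) (K1 \<union> K2) w = r} =
      {w \<in> pverts F1. depth F1 K1 w = r} \<union> {w \<in> pverts F2. depth F2 K2 w = r}"
    using depth_disjoint1 depth_disjoint2 by auto
  then show ?thesis unfolding level_def using pair_graphD(1)[OF pg1] pair_graphD(1)[OF pg2] disj
    by (simp add: card_Un_disjoint disjoint_iff)
qed

lemma fringe_sum_disjoint: "fringe_sum h (glue F1 F2) (K1 \<union> K2) = fringe_sum h F1 K1 + fringe_sum h F2 K2"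
  unfolding fringe_sum_def glue_simps using pair_graphD(1)[OF pg1] pair_graphD(1)[OF pg2] disj
  by (subst sum.union_disjoint)
    (auto simp: dominated_disjoint1 dominated_disjoint2 induced_glue_subset1[OF dominated_verts] induced_glue_subset2[OF dominated_verts])

end

context root_glue begin

lemma induced_dominated_glue:
  assumes u: "u \<in> pverts F"
  shows "induced (glue H F) (dominated F K u) = induced F (dominated F K u)"
proof -
  have "c = u" if "c \<in> K" "c \<in> dominated F K u" for c
    using that by (auto simp: dominated_def reach_avoiding_def)
  moreover have "dominated F K u \<subseteq> pverts F" by (rule dominated_verts)
  ultimately have "(a, b) \<notin> parcs H" if "a \<in> dominated F K u" "b \<in> dominated F K u" for a b
    using that H_arcs[of a b] xF pair_graphD(7)[OF pgH] by (metis insertE subsetD)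
  then show ?thesis by (intro graph_eqI) auto
qed

lemma depth_root: "depth (glue H F) {x} x = 0"
proof -
  have "x \<notin> dominated (glue H F) {x} v" if "v \<noteq> x" for v
    using that by (simp add: dominated_single)
  then have "{v \<in> pverts (glue H F). v \<noteq> x \<and> x \<in> dominated (glue H F) {x} v} = {}" by blast
  then show ?thesis unfolding depth_def by (metis card.empty)
qed

lemma depth_glue:
  assumes w: "w \<in> pverts F"
  shows "depth (glue H F) {x} w = Suc (depth F K w)"
proof -
  have "{v \<in> pverts (glue H F). v \<noteq> w \<and> w \<in> dominated (glue H F) {x} v} =
      insert x {v \<in> pverts F. v \<noteq> w \<and> w \<in> dominated F K v}"
    unfolding verts_glue using w xF dominated_glue dominated_root[of "glue H F" x] verts_glue by auto
  then show ?thesis unfolding depth_def using pair_graphD(1)[OF pgF] xF by simp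
qed

lemma level_0: "level 0 (glue H F) {x} = 1"
proof -
  have "{w \<in> pverts (glue H F). depth (glue H F) {x} w = 0} = {x}"
    unfolding verts_glue using depth_root depth_glue by auto
  then show ?thesis by (simp add: level_def)
qed

lemma level_Suc: "level (Suc r) (glue H F) {x} = level r F K"
  unfolding level_def verts_glue
  by (intro arg_cong[of _ _ card]) (auto simp: depth_glue depth_root)

lemma fringe_sum_glue: "fringe_sum h (glue H F) {x} = h (glue H F) x + fringe_sum h F K"
  unfolding fringe_sum_def verts_glue using pair_graphD(1)[OF pgF] xF
  by (subst sum.insert)
    (auto simp del: glue_simps simp: dominated_root induced_self[OF pg_glue] dominated_glue induced_dominated_glue intro!: sum.cong)

end

section \<open>Fringe subgraphs and balls\<close>

context rooted_graph begin

lemma rooted_graph_fringe: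
  assumes u: "u \<in> pverts G" shows "rooted_graph (induced G (fringe u)) u"
proof -
  have p: "pair_graph (induced G (fringe u))" using pair_graph_induced[OF pg fringe_verts] .
  have "(u, w) \<in> (parcs (induced G (fringe u)))\<^sup>*" if "w \<in> fringe u" for w
  proof (cases "u = x")
    case True
    then show ?thesis using that reach_x induced_self[OF pg] by (simp add: dominated_root)
  next
    case False
    then show ?thesis using reach_in_fringe[OF that] by simp
  qed
  then have "rooted_parts (induced G (fringe u)) {u}" using p fringe_self[OF u] by (auto simp: rooted_parts_def)
  then show ?thesis unfolding rooted_parts_single rooted_graph_def by auto
qed

text \<open>
A walk from \<open>x\<close> into the fringe of \<open>u\<close> enters it at \<open>u\<close>, so inside the fringe domination is the same
whether it is taken from \<open>x\<close> or from \<open>u\<close>.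
\<close>

lemma dominated_fringe:
  assumes u: "u \<in> pverts G" and v: "v \<in> fringe u"
  shows "dominated (induced G (fringe u)) {u} v = fringe v"
proof (cases "v = u \<or> u = x")
  case True
  then show ?thesis using induced_self[OF pg] by (auto simp: dominated_root)
next
  case False
  then have n: "v \<noteq> u" "u \<noteq> x" by auto
  have vx: "v \<noteq> x" using v root_notin_fringe n by auto
  have sub: "fringe v \<subseteq> fringe u" using fringe_trans[OF v] .
  have uv: "u \<notin> fringe v" using fringe_antisym v n by auto
  show ?thesis
  proof (intro set_eqI iffI)
    fix w assume w: "w \<in> dominated (induced G (fringe u)) {u} v"
    then have wu: "w \<in> fringe u" using dominated_verts by fastforce
    show "w \<in> fringe v"
    proof (rule ccontr)
      assume "w \<notin> fringe v"
      then have "(x, w) \<in> (avoid G v)\<^sup>*" using fringe_iff[OF vx] wu fringe_verts by auto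
      then have "w \<in> fringe u \<longrightarrow> (u, w) \<in> (avoid (induced G (fringe u)) v)\<^sup>*"
      proof (induct rule: rtrancl_induct)
        case base then show ?case using root_notin_fringe n by auto
      next
        case (step y z)
        show ?case
        proof
          assume z: "z \<in> fringe u"
          show "(u, z) \<in> (avoid (induced G (fringe u)) v)\<^sup>*"
          proof (cases "y \<in> fringe u")
            case True
            then have "(y, z) \<in> avoid (induced G (fringe u)) v" using z step by (auto simp: avoid_def)
            then show ?thesis using step True by (blast intro: rtrancl_into_rtrancl)
          next
            case False
            then have "z = u" using exit_fringe[of z y u] z step pair_graphD(8)[OF pg] by (auto simp: avoid_def)
            then show ?thesis by auto
          qed
        qed
      qed
      then show False using w wu n by (simp add: dominated_single)
    qed
  next
    fix w assume w: "w \<in> fringe v"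
    have "(x, u) \<in> (avoid G v)\<^sup>*" using uv u fringe_iff[OF vx] by auto
    moreover have "(x, w) \<notin> (avoid G v)\<^sup>*" using w fringe_iff[OF vx] by auto
    ultimately have "(u, w) \<notin> (avoid G v)\<^sup>*" by (meson rtrancl_trans)
    then have "(u, w) \<notin> (avoid (induced G (fringe u)) v)\<^sup>*"
      using rtrancl_mono_rev[of "avoid (induced G (fringe u)) v" "avoid G v" "(u, w)"] by (auto simp: avoid_def)
    then show "w \<in> dominated (induced G (fringe u)) {u} v" using sub w n by (auto simp: dominated_single)
  qed
qed

lemma depth_fringe:
  assumes "u \<in> pverts G" "w \<in> fringe u"
  shows "depth (induced G (fringe u)) {u} w = card {v \<in> fringe u. v \<noteq> w \<and> w \<in> fringe v}"
  unfolding depth_def using dominated_fringe[OF assms(1)] by (intro arg_cong[of _ _ card]) auto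

lemma fringe_chain:
  assumes "w \<in> fringe u" "w \<in> fringe v" "u \<in> pverts G" "v \<in> pverts G"
  shows "u \<in> fringe v \<or> v \<in> fringe u"
proof (rule ccontr)
  assume n: "\<not> ?thesis"
  then have nx: "u \<noteq> x" "v \<noteq> x" using assms by (auto simp: dominated_root)
  have "(u, w) \<in> (avoid G v)\<^sup>*"
    by (rule rtrancl_mono_rev[OF _ reach_in_fringe[OF assms(1) nx(1)]]) (use n in \<open>auto simp: avoid_def\<close>)
  moreover have "(x, u) \<in> (avoid G v)\<^sup>*" using n nx assms fringe_iff by auto
  ultimately have "(x, w) \<in> (avoid G v)\<^sup>*" by (meson rtrancl_trans)
  then show False using assms(2) nx fringe_iff by auto
qed

lemma fringe_depth_less:
  assumes "u \<in> fringe v" "u \<noteq> v" "w \<in> fringe u" "v \<in> pverts G"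
  shows "depth (induced G (fringe u)) {u} w < depth (induced G (fringe v)) {v} w"
proof -
  have u: "u \<in> pverts G" using assms fringe_verts by auto
  have wv: "w \<in> fringe v" using fringe_trans[OF assms(1)] assms(3) by auto
  have vu: "v \<notin> fringe u" using fringe_antisym assms by auto
  have "{y \<in> fringe u. y \<noteq> w \<and> w \<in> fringe y} \<subset> {y \<in> fringe v. y \<noteq> w \<and> w \<in> fringe y}"
  proof -
    have "v \<in> {y \<in> fringe v. y \<noteq> w \<and> w \<in> fringe y}" using fringe_self assms wv vu by auto
    then show ?thesis using fringe_trans[OF assms(1)] vu by blast
  qed
  moreover have "finite (fringe v)" using pair_graphD(1)[OF pg] fringe_verts finite_subset by blast
  ultimately show ?thesis unfolding depth_fringe[OF u assms(3)] depth_fringe[OF assms(4) wv]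
    by (intro psubset_card_mono) auto
qed

text \<open>
The dominators of \<open>w\<close> form a chain, along which the depth of \<open>w\<close> strictly decreases: each vertex has
at most one ancestor \<open>r\<close> levels above it.
\<close>

lemma fringe_at_depth_unique:
  assumes "u \<in> pverts G" "v \<in> pverts G" "w \<in> fringe u" "w \<in> fringe v"
    "depth (induced G (fringe u)) {u} w = r" "depth (induced G (fringe v)) {v} w = r"
  shows "u = v"
proof (rule ccontr)
  assume "u \<noteq> v"
  with fringe_chain[OF assms(3,4,1,2)] show False
    using fringe_depth_less[of u v w] fringe_depth_less[of v u w] assms by auto
qed

text \<open>
A strict dominator of \<open>y\<close> other than \<open>z\<close> dominates \<open>z\<close>, by \<open>exit_fringe\<close>.
\<close>

lemma depth_step:
  assumes "(y, z) \<in> parcs G" shows "depth G {x} y \<le> Suc (depth G {x} z)"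
proof -
  have "{v \<in> pverts G. v \<noteq> y \<and> y \<in> fringe v} \<subseteq> insert z {v \<in> pverts G. v \<noteq> z \<and> z \<in> fringe v}"
    using exit_fringe[OF assms] by blast
  then have "depth G {x} y \<le> card (insert z {v \<in> pverts G. v \<noteq> z \<and> z \<in> fringe v})"
    unfolding depth_def using pair_graphD(1)[OF pg] by (intro card_mono) auto
  also have "\<dots> \<le> Suc (depth G {x} z)" unfolding depth_def by (rule card_insert_le_m1) auto
  finally show ?thesis .
qed

lemma depth_fringe_root: "depth G {x} x = 0"
proof -
  have "{v \<in> pverts G. v \<noteq> x \<and> x \<in> fringe v} = {}" using root_notin_fringe by blast
  then show ?thesis unfolding depth_def by (metis card.empty)
qed

end

lemma ball_verts_relpow:
  assumes pg: "pair_graph G" and w: "w \<in> pverts G"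
  shows "ball_verts G w r = {y. \<exists>k\<le>r. (w, y) \<in> parcs G ^^ k}"
proof -
  interpret pair_graph G by fact
  have 1: "\<exists>p. awalk w p y \<and> length p = k" if "(w, y) \<in> parcs G ^^ k" for y k
    using that
  proof (induct k arbitrary: y)
    case 0
    then have "awalk w [] y \<and> length ([] :: ('a \<times> 'a) list) = 0" using w by (auto simp: awalk_Nil_iff)
    then show ?case by blast
  next
    case (Suc k)
    then obtain z where z: "(w, z) \<in> parcs G ^^ k" "(z, y) \<in> parcs G" by auto
    obtain p where p: "awalk w p z" "length p = k" using Suc(1)[OF z(1)] by auto
    have "awalk z [(z, y)] y" using z by (simp add: awalk_Cons_iff awalk_Nil_iff in_arcsD2)
    then have "awalk w (p @ [(z, y)]) y" using p by auto
    then show ?case using p by (intro exI[of _ "p @ [(z, y)]"]) auto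
  qed
  have 2: "(a, y) \<in> parcs G ^^ length p" if "awalk a p y" for a p y
    using that
  proof (induct p arbitrary: a)
    case (Cons e p)
    then have "e \<in> parcs G" "fst e = a" "(snd e, y) \<in> parcs G ^^ length p" by (auto simp: awalk_Cons_iff)
    then have "(a, snd e) \<in> parcs G" by auto
    then show ?case using \<open>(snd e, y) \<in> _\<close> relpow_Suc_I2[of a "snd e" "parcs G" y "length p"] by simp
  qed (auto simp: awalk_Nil_iff)
  show ?thesis unfolding ball_verts_def using 1 2 by blast
qed

lemma ball_verts_subset:
  assumes "pair_graph G" "w \<in> pverts G" shows "ball_verts G w r \<subseteq> pverts G"
  using rtrancl_verts[OF assms(1) _ assms(2)] relpow_imp_rtrancl
  unfolding ball_verts_relpow[OF assms] by blast

text \<open>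
A walk from \<open>w\<close> leaves the fringe of \<open>u\<close> only after visiting \<open>u\<close>, which takes \<open>r\<close> steps already. The
induction keeps track of the depth that remains after \<open>k\<close> steps.
\<close>

lemma (in rooted_graph) ball_fringe:
  assumes u: "u \<in> pverts G" and w: "w \<in> fringe u" and d: "depth (induced G (fringe u)) {u} w = r"
  shows "ball_verts G w r = ball_verts (induced G (fringe u)) w r"
proof -
  let ?G = "induced G (fringe u)"
  interpret T: rooted_graph ?G u by (rule rooted_graph_fringe[OF u])
  have *: "y \<in> fringe u \<and> (w, y) \<in> parcs ?G ^^ k \<and> r \<le> depth ?G {u} y + k"
    if "(w, y) \<in> parcs G ^^ k" "k \<le> r" for y k
    using that
  proof (induct k arbitrary: y)
    case 0 then show ?case using w d by auto
  next
    case (Suc k)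
    then obtain z where z: "(w, z) \<in> parcs G ^^ k" "(z, y) \<in> parcs G" by auto
    have IH: "z \<in> fringe u" "(w, z) \<in> parcs ?G ^^ k" "r \<le> depth ?G {u} z + k" using Suc(1)[OF z(1)] Suc(3) by auto
    have "z \<noteq> u" using IH(3) Suc(3) T.depth_fringe_root by auto
    then have y: "y \<in> fringe u" using exit_fringe[OF z(2) IH(1)] by auto
    then have a: "(z, y) \<in> parcs ?G" using z IH by auto
    have "depth ?G {u} z \<le> Suc (depth ?G {u} y)" using T.depth_step[OF a] .
    then show ?case using y IH a by auto
  qed
  have mono: "(w, y) \<in> parcs ?G ^^ k \<Longrightarrow> (w, y) \<in> parcs G ^^ k" for y k
  proof (induct k arbitrary: y)
    case (Suc k)
    then obtain z where "(w, z) \<in> parcs ?G ^^ k" "(z, y) \<in> parcs ?G" by auto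
    with Suc(1) show ?case by (auto intro: relpow_Suc_I)
  qed simp
  have wv: "w \<in> pverts G" using w fringe_verts by auto
  show ?thesis unfolding ball_verts_relpow[OF pg wv] ball_verts_relpow[OF T.pg, simplified, OF w]
    using * mono by (auto 4 3)
qed

lemma ball_class_induced:
  assumes "pair_graph G" "w \<in> S" "S \<subseteq> pverts G" "ball_verts G w r = ball_verts (induced G S) w r"
  shows "ball_class r (G, w) = ball_class r (induced G S, w)"
proof -
  have "ball_verts (induced G S) w r \<subseteq> S"
    using ball_verts_subset[OF pair_graph_induced[OF assms(1,3)]] assms(2) by simp
  then have "with_proj G \<restriction> ball_verts G w r = with_proj (induced G S) \<restriction> ball_verts (induced G S) w r"
    unfolding assms(4) induce_subgraph_def by auto
  then show ?thesis unfolding ball_class_def by simp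
qed

definition class_count :: "nat \<Rightarrow> (ngraph \<times> nat) set \<Rightarrow> ngraph \<Rightarrow> nat \<Rightarrow> nat" where
  "class_count r c T u = card {w \<in> pverts T. depth T {u} w = r \<and> ball_class r (T, w) = c}"

text \<open>
Each vertex is counted in at most one fringe, by \<open>fringe_at_depth_unique\<close>, and its ball in the fringe is its
ball in \<open>G\<close>.
\<close>

lemma fringe_class_count_le:
  assumes "rooted_graph G x"
  shows "fringe_sum (\<lambda>T u. class_count r c T u) G {x} \<le> card {w \<in> pverts G. ball_class r (G, w) = c}"
proof -
  interpret rooted_graph G x by fact
  let ?S = "\<lambda>u. {w \<in> fringe u. depth (induced G (fringe u)) {u} w = r \<and> ball_class r (induced G (fringe u), w) = c}"
  have fin: "finite (pverts G)" using pair_graphD(1)[OF pg] .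
  have "fringe_sum (\<lambda>T u. class_count r c T u) G {x} = (\<Sum>u\<in>pverts G. card (?S u))"
    unfolding fringe_sum_def class_count_def by simp
  also have "\<dots> = card (\<Union>u\<in>pverts G. ?S u)"
  proof (rule card_UN_disjoint[symmetric])
    show "\<forall>u\<in>pverts G. finite (?S u)" using fin finite_subset[OF fringe_verts] by auto
    show "\<forall>u\<in>pverts G. \<forall>v\<in>pverts G. u \<noteq> v \<longrightarrow> ?S u \<inter> ?S v = {}"
      using fringe_at_depth_unique by blast
  qed (rule fin)
  also have "\<dots> \<le> card {w \<in> pverts G. ball_class r (G, w) = c}"
  proof (rule card_mono)
    show "(\<Union>u\<in>pverts G. ?S u) \<subseteq> {w \<in> pverts G. ball_class r (G, w) = c}"
    proof
      fix w assume "w \<in> (\<Union>u\<in>pverts G. ?S u)"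
      then obtain u where u: "u \<in> pverts G" "w \<in> fringe u" "depth (induced G (fringe u)) {u} w = r"
        and c: "ball_class r (induced G (fringe u), w) = c" by auto
      have "ball_class r (G, w) = c" using ball_class_induced[OF pg u(2) fringe_verts ball_fringe[OF u]] c by simp
      then show "w \<in> {w \<in> pverts G. ball_class r (G, w) = c}" using fringe_verts u(2) by auto
    qed
  qed (use fin in auto)
  finally show ?thesis .
qed

section \<open>Relabelling\<close>

definition relabel :: "('a \<Rightarrow> 'b) \<Rightarrow> 'a pair_pre_digraph \<Rightarrow> 'b pair_pre_digraph" where
  "relabel f G = \<lparr>pverts = f ` pverts G, parcs = map_prod f f ` parcs G\<rparr>"

lemma relabel_simps[simp]:
  "pverts (relabel f G) = f ` pverts G" "parcs (relabel f G) = map_prod f f ` parcs G"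
  by (auto simp: relabel_def)

lemma image_minus_single: "inj f \<Longrightarrow> f ` (K - {u}) = f ` K - {f u}"
  by (auto dest: injD)

lemma card_inj: "inj f \<Longrightarrow> card (f ` A) = card A"
  by (simp add: card_image inj_on_subset)

lemma map_prod_inj: "inj f \<Longrightarrow> inj (map_prod f f)"
  by (auto intro!: injI dest: injD)

lemma relabel_inv: "inj f \<Longrightarrow> relabel (inv f) (relabel f G) = G"
  by (intro graph_eqI) (auto simp: image_image map_prod_def case_prod_beta)

lemma relabel_inv': "surj f \<Longrightarrow> relabel f (relabel (inv f) G) = G"
  by (intro graph_eqI) (auto simp: image_image map_prod_def case_prod_beta surj_f_inv_f)

lemma rtrancl_relabel:
  assumes f: "inj f"
  shows "(f a, f b) \<in> (map_prod f f ` R)\<^sup>* \<longleftrightarrow> (a, b) \<in> R\<^sup>*"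
proof
  have "(a, inv f z) \<in> R\<^sup>*" if "(f a, z) \<in> (map_prod f f ` R)\<^sup>*" for z
    using that
  proof (induct rule: rtrancl_induct)
    case (step y z)
    then have "(inv f y, inv f z) \<in> R" using f by auto
    with step(3) show ?case by (rule rtrancl_into_rtrancl)
  qed (use f in auto)
  then show "(f a, f b) \<in> (map_prod f f ` R)\<^sup>* \<Longrightarrow> (a, b) \<in> R\<^sup>*" using f by fastforce
  show "(a, b) \<in> R\<^sup>* \<Longrightarrow> (f a, f b) \<in> (map_prod f f ` R)\<^sup>*"
  proof (induct rule: rtrancl_induct)
    case (step y z)
    then have "(f y, f z) \<in> map_prod f f ` R" by auto
    with step(3) show ?case by (rule rtrancl_into_rtrancl)
  qed auto
qed

lemma relpow_relabel:
  assumes f: "inj f"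
  shows "(f a, z) \<in> (map_prod f f ` R) ^^ k \<longleftrightarrow> (\<exists>b. z = f b \<and> (a, b) \<in> R ^^ k)"
proof (induct k arbitrary: z)
  case (Suc k)
  show ?case
  proof
    assume "(f a, z) \<in> (map_prod f f ` R) ^^ Suc k"
    then obtain y where "(f a, y) \<in> (map_prod f f ` R) ^^ k" "(y, z) \<in> map_prod f f ` R"
      by (auto simp del: image_iff)
    moreover from this obtain b where b: "y = f b" "(a, b) \<in> R ^^ k" using Suc by blast
    ultimately obtain b' where "z = f b'" "(b, b') \<in> R" using f by (auto dest: injD)
    then show "\<exists>b. z = f b \<and> (a, b) \<in> R ^^ Suc k" using b by auto
  next
    assume "\<exists>b. z = f b \<and> (a, b) \<in> R ^^ Suc k"
    then obtain b y where b: "z = f b" "(a, y) \<in> R ^^ k" "(y, b) \<in> R" by auto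
    then have "(f a, f y) \<in> (map_prod f f ` R) ^^ k" using Suc by auto
    moreover have "(f y, z) \<in> map_prod f f ` R" using b by auto
    ultimately show "(f a, z) \<in> (map_prod f f ` R) ^^ Suc k" by auto
  qed
qed auto

lemma avoid_relabel: "inj f \<Longrightarrow> avoid (relabel f G) (f u) = map_prod f f ` avoid G u"
  by (auto simp: avoid_def dest: injD)

lemma induced_relabel: "inj f \<Longrightarrow> induced (relabel f G) (f ` S) = relabel f (induced G S)"
  by (intro graph_eqI) (auto dest: injD)

lemma pair_graph_relabel: "inj f \<Longrightarrow> pair_graph G \<Longrightarrow> pair_graph (relabel f G)"
  unfolding pair_graph_iff by (auto simp: sym_def dest: injD) (auto simp: image_iff map_prod_def)?

lemma dominated_relabel:
  assumes f: "bij f"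
  shows "dominated (relabel f G) (f ` K) (f u) = f ` dominated G K u"
proof -
  have i: "inj f" and s: "\<And>y. \<exists>x. y = f x" using f by (auto simp: bij_def surj_def)
  have "f w \<in> reach_avoiding (relabel f G) (f ` K) (f u) \<longleftrightarrow> w \<in> reach_avoiding G K u" for w
    unfolding reach_avoiding_def avoid_relabel[OF i] image_minus_single[OF i, symmetric] by (simp add: rtrancl_relabel[OF i])
  then have "f w \<in> dominated (relabel f G) (f ` K) (f u) \<longleftrightarrow> f w \<in> f ` dominated G K u" for w
    unfolding dominated_def using i by (auto simp: inj_image_mem_iff)
  then show ?thesis using s by (metis set_eqI)
qed

lemma rooted_parts_relabel:
  assumes f: "bij f" and r: "rooted_parts G K"
  shows "rooted_parts (relabel f G) (f ` K)"
proof -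
  have i: "inj f" using f by (auto simp: bij_def)
  have ex1: "\<exists>!c. c \<in> f ` K \<and> (c, f w) \<in> (map_prod f f ` parcs G)\<^sup>*" if "w \<in> pverts G" for w
  proof -
    obtain c where c: "c \<in> K" "(c, w) \<in> (parcs G)\<^sup>*" using rooted_parts_root[OF r \<open>w \<in> pverts G\<close>] .
    show ?thesis
    proof (rule ex1I[of _ "f c"])
      show "f c \<in> f ` K \<and> (f c, f w) \<in> (map_prod f f ` parcs G)\<^sup>*" using c by (simp add: rtrancl_relabel[OF i])
      fix d assume d: "d \<in> f ` K \<and> (d, f w) \<in> (map_prod f f ` parcs G)\<^sup>*"
      then obtain e where e: "e \<in> K" "d = f e" by auto
      with d have "(e, w) \<in> (parcs G)\<^sup>*" by (simp add: rtrancl_relabel[OF i])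
      then show "d = f c" using rooted_parts_unique[OF r e(1) c(1) _ c(2)] e by auto
    qed
  qed
  have "\<forall>w\<in>f ` pverts G. \<exists>!c. c \<in> f ` K \<and> (c, w) \<in> (map_prod f f ` parcs G)\<^sup>*"
  proof
    fix w assume "w \<in> f ` pverts G"
    then obtain v where v: "v \<in> pverts G" "w = f v" by auto
    show "\<exists>!c. c \<in> f ` K \<and> (c, w) \<in> (map_prod f f ` parcs G)\<^sup>*" unfolding v(2) by (rule ex1[OF v(1)])
  qed
  moreover have "pair_graph (relabel f G)" "f ` K \<subseteq> f ` pverts G"
    using r pair_graph_relabel[OF i, of G] by (auto simp: rooted_parts_def)
  ultimately show ?thesis unfolding rooted_parts_def relabel_simps by (intro conjI)
qed

lemma core_relabel:
  assumes f: "bij f" and r: "core H x"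
  shows "core (relabel f H) (f x)"
proof -
  have i: "inj f" using f by (auto simp: bij_def)
  show ?thesis using r pair_graph_relabel[OF i] unfolding core_def pconnected_def relabel_simps
    by (simp add: avoid_relabel[OF i] rtrancl_relabel[OF i] image_minus_single[OF i, symmetric])
qed

lemma biconnected_relabel:
  assumes f: "bij f" and r: "biconnected H"
  shows "biconnected (relabel f H)"
proof -
  have i: "inj f" using f by (auto simp: bij_def)
  have "card (f ` pverts H) = card (pverts H)" by (rule card_inj[OF i])
  then show ?thesis using r pair_graph_relabel[OF i] unfolding biconnected_def pconnected_def relabel_simps
    by (simp add: avoid_relabel[OF i] rtrancl_relabel[OF i] image_minus_single[OF i, symmetric])
qed

lemma depth_relabel:
  assumes f: "bij f"
  shows "depth (relabel f G) (f ` K) (f w) = depth G K w"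
proof -
  have i: "inj f" using f by (auto simp: bij_def)
  have "{v \<in> pverts (relabel f G). v \<noteq> f w \<and> f w \<in> dominated (relabel f G) (f ` K) v} =
      f ` {v \<in> pverts G. v \<noteq> w \<and> w \<in> dominated G K v}"
    using i by (auto simp: dominated_relabel[OF f] inj_image_mem_iff inj_eq)
  then show ?thesis unfolding depth_def by (simp add: card_inj[OF i] del: relabel_simps)
qed

lemma level_relabel:
  assumes f: "bij f"
  shows "level r (relabel f G) (f ` K) = level r G K"
proof -
  have i: "inj f" using f by (auto simp: bij_def)
  have "{w \<in> pverts (relabel f G). depth (relabel f G) (f ` K) w = r} = f ` {w \<in> pverts G. depth G K w = r}"
    by (auto simp: depth_relabel[OF f])
  then show ?thesis unfolding level_def by (simp add: card_inj[OF i] del: relabel_simps)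
qed

lemma fringe_sum_relabel:
  assumes f: "bij f" and g: "pair_graph G"
    and h: "\<And>T u. pair_graph T \<Longrightarrow> u \<in> pverts T \<Longrightarrow> h (relabel f T) (f u) = h T u"
    and K: "\<And>u. u \<in> pverts G \<Longrightarrow> u \<in> dominated G K u"
  shows "fringe_sum h (relabel f G) (f ` K) = fringe_sum h G K"
proof -
  have i: "inj f" using f by (auto simp: bij_def)
  have "h (induced (relabel f G) (dominated (relabel f G) (f ` K) (f u))) (f u) = h (induced G (dominated G K u)) u"
    if "u \<in> pverts G" for u
    using h[OF pair_graph_induced[OF g dominated_verts], of u] K[OF that]
    by (simp add: dominated_relabel[OF f] induced_relabel[OF i])
  then show ?thesis unfolding fringe_sum_def relabel_simps using i
    by (subst sum.reindex) (auto intro: inj_on_subset)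
qed

lemma self_dominated: "u \<in> pverts G \<Longrightarrow> u \<in> dominated G K u"
proof -
  have "w \<noteq> u" if "(c, w) \<in> (avoid G u)\<^sup>*" "c \<noteq> u" for c w
    using that by (induct rule: rtrancl_induct) (auto simp: avoid_def)
  then show "u \<in> pverts G \<Longrightarrow> u \<in> dominated G K u" by (auto simp: dominated_def reach_avoiding_def)
qed

definition relabel_iso :: "('a \<Rightarrow> 'b) \<Rightarrow> ('a, 'a \<times> 'a, 'b, 'b \<times> 'b) digraph_isomorphism" where
  "relabel_iso f = \<lparr>iso_verts = f, iso_arcs = map_prod f f, iso_head = snd, iso_tail = fst\<rparr>"

lemma app_relabel_iso: "app_iso (relabel_iso f) (with_proj G) = with_proj (relabel f G)"
  by (simp add: app_iso_def relabel_iso_def with_proj_def)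

lemma pair_graph_wf: "pair_graph G \<Longrightarrow> wf_digraph (with_proj G)"
  by (simp add: wf_digraph_wp_iff pair_graph_def pair_digraph_def pair_fin_digraph_def)

lemma relabel_iso:
  assumes "inj f" "pair_graph G"
  shows "pre_digraph.digraph_isomorphism (with_proj G) (relabel_iso f)"
  unfolding pre_digraph.digraph_isomorphism_def relabel_iso_def
  using assms pair_graph_wf inj_on_subset[OF assms(1)] inj_on_subset[OF map_prod_inj[OF assms(1)]] by auto

lemma iso_closed_relabel:
  assumes "iso_closed \<G>" "inj f" "pair_graph G" "G \<in> \<G>"
  shows "relabel f G \<in> \<G>"
proof -
  have "digraph_iso (with_proj G) (with_proj (relabel f G))"
    unfolding digraph_iso_def using relabel_iso[OF assms(2,3)] app_relabel_iso by metis
  then show ?thesis using assms pair_graph_relabel[OF assms(2,3)] unfolding iso_closed_def by blast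
qed

lemma rooted_iso_relabel:
  assumes "inj f" "pair_graph G" "rooted_iso (with_proj (relabel f G)) (f v) E w"
  shows "rooted_iso (with_proj G) v E w"
proof -
  obtain g where g: "pre_digraph.digraph_isomorphism (with_proj (relabel f G)) g"
    "E = app_iso g (with_proj (relabel f G))" "iso_verts g (f v) = w"
    using assms(3) by (auto simp: rooted_iso_def)
  let ?k = "\<lparr>iso_verts = iso_verts g \<circ> f, iso_arcs = iso_arcs g \<circ> map_prod f f, iso_head = iso_head g, iso_tail = iso_tail g\<rparr>"
  have "pre_digraph.digraph_isomorphism (with_proj G) ?k"
    using g(1) pair_graph_wf[OF assms(2)] assms(1) unfolding pre_digraph.digraph_isomorphism_def
    by (auto intro!: comp_inj_on inj_on_subset[OF assms(1)] inj_on_subset[OF map_prod_inj[OF assms(1)]])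
  moreover have "E = app_iso ?k (with_proj G)"
    unfolding g(2) by (simp add: app_iso_def image_comp)
  ultimately show ?thesis using g(3) unfolding rooted_iso_def by (intro exI[of _ ?k]) auto
qed

lemma ball_class_conv:
  "ball_class r (G, v) = {(H, w). rooted_iso (with_proj (induced G (ball_verts G v r))) v (with_proj H) w}"
proof -
  have "with_proj G \<restriction> S = with_proj (induced G S)" for S :: "nat set"
    by (auto simp: induce_subgraph_def with_proj_def)
  then show ?thesis by (simp add: ball_class_def)
qed

lemma ball_class_relabel_sub:
  assumes f: "inj f" and g: "pair_graph G" and v: "v \<in> pverts G"
  shows "ball_class r (relabel f G, f v) \<subseteq> ball_class r (G, v)"
proof -
  have "ball_verts (relabel f G) (f v) r = f ` ball_verts G v r"
    using ball_verts_relpow[OF g v] ball_verts_relpow[OF pair_graph_relabel[OF f g], of "f v"] v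
    by (auto simp: relpow_relabel[OF f])
  then show ?thesis
    unfolding ball_class_conv using rooted_iso_relabel[OF f pair_graph_induced[OF g ball_verts_subset[OF g v]]]
    by (auto simp: induced_relabel[OF f] simp del: relabel_simps)
qed

lemma ball_class_relabel:
  assumes f: "bij f" and g: "pair_graph G" and v: "v \<in> pverts G"
  shows "ball_class r (relabel f G, f v) = ball_class r (G, v)"
proof
  have i: "inj f" "inj (inv f)" using f by (auto simp: bij_def inj_imp_surj_inv surj_imp_inj_inv)
  show "ball_class r (relabel f G, f v) \<subseteq> ball_class r (G, v)" by (rule ball_class_relabel_sub[OF i(1) g v])
  show "ball_class r (G, v) \<subseteq> ball_class r (relabel f G, f v)"
    using ball_class_relabel_sub[OF i(2) pair_graph_relabel[OF i(1) g], of "f v"] v i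
    by (simp add: relabel_inv)
qed

lemma class_count_relabel:
  assumes f: "bij f" and g: "pair_graph T"
  shows "class_count r c (relabel f T) (f u) = class_count r c T u"
proof -
  have i: "inj f" using f by (auto simp: bij_def)
  have "{w \<in> pverts (relabel f T). depth (relabel f T) {f u} w = r \<and> ball_class r (relabel f T, w) = c} =
      f ` {w \<in> pverts T. depth T {u} w = r \<and> ball_class r (T, w) = c}"
    using depth_relabel[OF f, of T "{u}"] ball_class_relabel[OF f g] by auto
  then show ?thesis unfolding class_count_def by (simp add: card_inj[OF i] del: relabel_simps)
qed

text \<open>
Relabellings are taken to be bijections of the whole label set, which spares all side conditions about
injectivity on vertex sets; between finite sets of equal size they always exist.
\<close>

lemma ex_bij_image:
  assumes "finite V" "finite V'" "card V = card V'"
  obtains f :: "'a \<Rightarrow> 'a" where "bij f" "f ` V = V'"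
proof -
  obtain g where g: "bij_betw g V V'" using finite_same_card_bij assms by blast
  have "card (V' - V) = card (V - V')"
    using assms by (simp add: card_Diff_subset_Int Int_commute)
  then obtain h where h: "bij_betw h (V' - V) (V - V')" using finite_same_card_bij assms by (metis finite_Diff)
  define f where "f x = (if x \<in> V then g x else if x \<in> V' then h x else x)" for x
  have "bij_betw f V V'" using g by (rule bij_betw_cong[THEN iffD1, rotated]) (simp add: f_def)
  moreover have "bij_betw f (V' - V) (V - V')"
    using h by (rule bij_betw_cong[THEN iffD1, rotated]) (simp add: f_def)
  ultimately have 1: "bij_betw f (V \<union> (V' - V)) (V' \<union> (V - V'))" by (rule bij_betw_combine) auto
  have 2: "bij_betw f (- (V \<union> V')) (- (V \<union> V'))"
    by (rule bij_betw_cong[THEN iffD1, of _ id]) (auto simp: f_def)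
  have "V \<union> (V' - V) = V \<union> V'" "V' \<union> (V - V') = V \<union> V'" by auto
  with 1 have "bij_betw f (V \<union> V') (V \<union> V')" by simp
  from bij_betw_combine[OF this 2] have "bij f" by (simp only: Compl_partition Compl_disjoint simp_thms)
  moreover have "f ` V = V'" using \<open>bij_betw f V V'\<close> by (auto simp: bij_betw_def)
  ultimately show ?thesis using that by blast
qed

lemma ex_bij_image_root:
  assumes "finite V" "finite V'" "card V = card V'" "x \<in> V" "x' \<in> V'"
  obtains f :: "'a \<Rightarrow> 'a" where "bij f" "f ` V = V'" "f x = x'"
proof -
  obtain f where f: "bij f" "f ` V = V'" using ex_bij_image[OF assms(1-3)] .
  define g where "g = Fun.swap (f x) x' id \<circ> f"
  have m: "f x \<in> V'" using f assms by auto
  have "bij g" using f unfolding g_def by (intro bij_comp) auto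
  moreover have "g ` V = V'" using f(2) m assms(5)
    unfolding g_def image_comp[symmetric] f(2) by (auto simp: Fun.swap_def image_iff)
  moreover have "g x = x'" by (simp add: g_def)
  ultimately show ?thesis using that by blast
qed

section \<open>Counting by generating functions\<close>

definition rooted_in :: "ngraph set \<Rightarrow> nat set \<Rightarrow> nat set \<Rightarrow> ngraph set" where
  "rooted_in \<G> U K = {F \<in> \<G>. pverts F = U \<and> rooted_parts F K}"

definition cores_in :: "ngraph set \<Rightarrow> nat set \<Rightarrow> nat \<Rightarrow> ngraph set" where
  "cores_in \<G> V x = {H \<in> \<G>. pverts H = V \<and> core H x}"

definition blocks_in :: "ngraph set \<Rightarrow> nat set \<Rightarrow> ngraph set" where
  "blocks_in \<G> V = {B \<in> \<G>. pverts B = V \<and> biconnected B}"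

text \<open>
The roots carry no label of their own in this generating function: its coefficients count cores with
\<open>k\<close> non-root vertices. It is the series \<open>\<Phi>\<close>, in closed form the exponential of \<open>B'\<close>.
\<close>

definition core_fps :: "ngraph set \<Rightarrow> real fps" where
  "core_fps \<G> = Abs_fps (\<lambda>k. real (card (cores_in \<G> {1..Suc k} 1)) / fact k)"

text \<open>
The total weight of the graphs on \<open>n\<close> labels, over all \<open>n\<close> choices of the root, divided by \<open>n!\<close>. By symmetry
this is the weight of the graphs rooted at 1 divided by \<open>(n - 1)!\<close>.
\<close>

definition weight_fps :: "ngraph set \<Rightarrow> (ngraph \<Rightarrow> nat set \<Rightarrow> real) \<Rightarrow> real fps" where
  "weight_fps \<G> Q = Abs_fps (\<lambda>n. if n = 0 then 0 else (\<Sum>G\<in>rooted_in \<G> {1..n} {1}. Q G {1}) / fact (n - 1))"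

lemma finite_pair_graphs: "finite U \<Longrightarrow> finite {G. pair_graph G \<and> pverts G = U}"
proof -
  assume U: "finite U"
  have "{G. pair_graph G \<and> pverts G = U} \<subseteq> (\<lambda>E. \<lparr>pverts = U, parcs = E\<rparr>) ` Pow (U \<times> U)"
  proof
    fix G assume G: "G \<in> {G. pair_graph G \<and> pverts G = U}"
    then show "G \<in> (\<lambda>E. \<lparr>pverts = U, parcs = E\<rparr>) ` Pow (U \<times> U)"
      using pair_graph_arcs[of G] by (intro image_eqI[of _ _ "parcs G"]) auto
  qed
  moreover have "finite ((\<lambda>E. \<lparr>pverts = U, parcs = E\<rparr>) ` Pow (U \<times> U))" using U by auto
  ultimately show ?thesis by (rule finite_subset)
qed

lemma sum_Pow_card:
  assumes "finite M"
  shows "(\<Sum>B\<in>Pow M. g (card B)) = (\<Sum>i\<le>card M. real (card M choose i) * g i)"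
proof -
  have "(\<Sum>B\<in>Pow M. g (card B)) = (\<Sum>i\<le>card M. \<Sum>B\<in>{B \<in> Pow M. card B = i}. g (card B))"
    using assms by (intro sum.group[symmetric]) (auto intro: card_mono)
  also have "\<dots> = (\<Sum>i\<le>card M. real (card M choose i) * g i)"
  proof (rule sum.cong[OF refl])
    fix i
    have "(\<Sum>B\<in>{B \<in> Pow M. card B = i}. g (card B)) = real (card {B \<in> Pow M. card B = i}) * g i" by simp
    then show "(\<Sum>B\<in>{B \<in> Pow M. card B = i}. g (card B)) = real (card M choose i) * g i"
      using n_subsets[OF assms, of i] by simp
  qed
  finally show ?thesis .
qed

locale block_class =
  fixes \<G> :: "ngraph set"
  assumes graphs: "G \<in> \<G> \<Longrightarrow> pair_graph G" and iso: "iso_closed \<G>" and bs: "block_stable \<G>"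
begin

lemma finite_rooted_in: "finite U \<Longrightarrow> finite (rooted_in \<G> U K)"
  by (rule finite_subset[OF _ finite_pair_graphs[of U]]) (auto simp: rooted_in_def dest: graphs)

lemma finite_cores_in: "finite U \<Longrightarrow> finite (cores_in \<G> U x)"
  by (rule finite_subset[OF _ finite_pair_graphs[of U]]) (auto simp: cores_in_def dest: graphs)

lemma finite_blocks_in: "finite U \<Longrightarrow> finite (blocks_in \<G> U)"
  by (rule finite_subset[OF _ finite_pair_graphs[of U]]) (auto simp: blocks_in_def dest: graphs)

text \<open>
Without arcs there are no blocks. This covers the empty forest and the core that consists of
its root only.
\<close>

lemma no_arcs_in:
  assumes "pair_graph G" "parcs G = {}" shows "G \<in> \<G>"
proof -
  have "\<not> is_block H G" for H
    using biconnected_has_arc[of H] assms unfolding is_block_iff[OF assms(1)] by (auto simp: psubgraph_def)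
  then show ?thesis using bs assms(1) unfolding block_stable_def by blast
qed

lemma disjoint_in: "disjoint_parts F1 F2 K1 K2 \<Longrightarrow> glue F1 F2 \<in> \<G> \<longleftrightarrow> F1 \<in> \<G> \<and> F2 \<in> \<G>"
  using block_stable_glue[OF bs, of F1 F2] disjoint_parts.pg1[of F1 F2 K1 K2] disjoint_parts.pg2[of F1 F2 K1 K2]
  by (simp add: disjoint_parts.disj)

lemma root_in: "root_glue H F x K \<Longrightarrow> glue H F \<in> \<G> \<longleftrightarrow> H \<in> \<G> \<and> F \<in> \<G>"
  using block_stable_glue[OF bs, of H F] root_glue.pgH root_glue.pgF root_glue.one_common by metis

lemma relabel_bij_betw:
  assumes f: "bij f" and P: "\<And>G. P G \<Longrightarrow> P' (relabel f G)" "\<And>G. P' G \<Longrightarrow> P (relabel (inv f) G)"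
  shows "bij_betw (relabel f) {G \<in> \<G>. pverts G = V \<and> P G} {G \<in> \<G>. pverts G = f ` V \<and> P' G}"
proof (rule bij_betw_byWitness[of _ "relabel (inv f)"])
  have i: "inj f" "inj (inv f)" "surj f"
    using f by (auto simp: bij_def inj_imp_surj_inv surj_imp_inj_inv)
  show "\<forall>G\<in>{G \<in> \<G>. pverts G = V \<and> P G}. relabel (inv f) (relabel f G) = G"
    "\<forall>G\<in>{G \<in> \<G>. pverts G = f ` V \<and> P' G}. relabel f (relabel (inv f) G) = G"
    using relabel_inv[OF i(1)] relabel_inv'[OF i(3)] by auto
  show "relabel f ` {G \<in> \<G>. pverts G = V \<and> P G} \<subseteq> {G \<in> \<G>. pverts G = f ` V \<and> P' G}"
    "relabel (inv f) ` {G \<in> \<G>. pverts G = f ` V \<and> P' G} \<subseteq> {G \<in> \<G>. pverts G = V \<and> P G}"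
    using P iso_closed_relabel[OF iso i(1)] iso_closed_relabel[OF iso i(2)] graphs image_inv_f_f[OF i(1)] by auto
qed

lemma standard_labelling:
  assumes "finite V" "x \<in> V"
  obtains f :: "nat \<Rightarrow> nat" where "bij f" "f ` V = {1..card V}" "f x = 1" "bij (inv f)" "inv f 1 = x"
proof -
  have "0 < card V" using assms by (auto simp: card_gt_0_iff)
  then have "1 \<le> card V" by simp
  then obtain f where f: "bij f" "f ` V = {1..card V}" "f x = 1"
    using ex_bij_image_root[of V "{1..card V}" x 1] assms by auto
  then show ?thesis using that[of f] bij_imp_bij_inv inv_f_eq[OF bij_is_inj[OF f(1)] f(3)] by blast
qed

lemma cores_relabel_card:
  assumes "finite V" "x \<in> V"
  shows "card (cores_in \<G> V x) = card (cores_in \<G> {1..card V} 1)"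
proof -
  obtain f where f: "bij f" "f ` V = {1..card V}" "f x = 1" "bij (inv f)" "inv f 1 = x"
    using standard_labelling[OF assms] .
  show ?thesis unfolding cores_in_def f(2)[symmetric] using core_relabel[OF f(1)] core_relabel[OF f(4)] f(3,5)
    by (intro bij_betw_same_card[OF relabel_bij_betw[OF f(1)]]) metis+
qed

lemma blocks_relabel_card:
  assumes "finite V"
  shows "card (blocks_in \<G> V) = card (blocks_in \<G> {1..card V})"
proof -
  obtain f where f: "bij f" "f ` V = {1..card V}" using ex_bij_image[of V "{1..card V}"] assms by auto
  show ?thesis unfolding blocks_in_def f(2)[symmetric]
    using biconnected_relabel[OF f(1)] biconnected_relabel[OF bij_imp_bij_inv[OF f(1)]]
    by (intro bij_betw_same_card[OF relabel_bij_betw[OF f(1)]]) auto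
qed

end

text \<open>
A weight of forests that is multiplicative over components. The second argument is the set of roots.
\<close>

locale block_class_weight = block_class +
  fixes Q :: "ngraph \<Rightarrow> nat set \<Rightarrow> real"
  assumes Q_empty: "Q \<lparr>pverts = {}, parcs = {}\<rparr> {} = 1"
    and Q_disjoint: "\<And>F1 F2 K1 K2. disjoint_parts F1 F2 K1 K2 \<Longrightarrow> Q (glue F1 F2) (K1 \<union> K2) = Q F1 K1 * Q F2 K2"
    and Q_relabel: "\<And>f F K. bij f \<Longrightarrow> rooted_parts F K \<Longrightarrow> Q (relabel f F) (f ` K) = Q F K"
begin

lemma sum_relabel:
  assumes "finite V" "x \<in> V"
  shows "(\<Sum>G\<in>rooted_in \<G> V {x}. Q G {x}) = (\<Sum>G\<in>rooted_in \<G> {1..card V} {1}. Q G {1})"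
proof -
  obtain f where f: "bij f" "f ` V = {1..card V}" "f x = 1" "bij (inv f)" "inv f 1 = x"
    using standard_labelling[OF assms] .
  have b: "bij_betw (relabel f) (rooted_in \<G> V {x}) (rooted_in \<G> {1..card V} {1})"
    unfolding rooted_in_def f(2)[symmetric]
    using rooted_parts_relabel[OF f(1), of _ "{x}"] rooted_parts_relabel[OF f(4), of _ "{1}"] f(3,5)
    by (intro relabel_bij_betw[OF f(1)]) auto
  have "(\<Sum>G\<in>rooted_in \<G> V {x}. Q G {x}) = (\<Sum>G\<in>rooted_in \<G> V {x}. Q (relabel f G) {1})"
    using Q_relabel[OF f(1), of _ "{x}"] f(3) by (intro sum.cong) (auto simp: rooted_in_def)
  then show ?thesis using sum.reindex_bij_betw[OF b, of "\<lambda>G. Q G {1}"] by simp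
qed

text \<open>
\<open>What\<close> is the weighted series of rooted graphs divided by its variable: the root of a component is an
already placed child of the core, so only the other labels are distributed.
\<close>

abbreviation "wt n \<equiv> (\<Sum>G\<in>rooted_in \<G> {1..n} {1}. Q G {1})"
abbreviation "What \<equiv> Abs_fps (\<lambda>i. wt (Suc i) / fact i)"

lemma weight_fps_shift: "weight_fps \<G> Q = fps_X * What"
  by (rule fps_ext) (auto simp: weight_fps_def)

lemma peel_sum:
  assumes U: "finite U" and c: "c \<notin> K"
  shows "(\<Sum>F\<in>rooted_in \<G> U (insert c K). Q F (insert c K)) =
    (\<Sum>A\<in>{A. c \<in> A \<and> A \<subseteq> U - K}. (\<Sum>G\<in>rooted_in \<G> A {c}. Q G {c}) * (\<Sum>F\<in>rooted_in \<G> (U - A) K. Q F K))"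
proof -
  let ?S = "{A. c \<in> A \<and> A \<subseteq> U - K}"
  let ?T = "SIGMA A:?S. rooted_in \<G> A {c} \<times> rooted_in \<G> (U - A) K"
  let ?A = "\<lambda>F. {w. (c, w) \<in> (parcs F)\<^sup>*}"
  have fS: "finite ?S" by (rule finite_subset[of _ "Pow U"]) (use U in auto)
  have fT: "\<forall>A\<in>?S. finite (rooted_in \<G> A {c} \<times> rooted_in \<G> (U - A) K)"
    using U by (auto intro!: finite_cartesian_product finite_rooted_in intro: finite_subset)
  have "(\<Sum>F\<in>rooted_in \<G> U (insert c K). Q F (insert c K)) = (\<Sum>(A, G, F)\<in>?T. Q G {c} * Q F K)"
  proof (rule sum.reindex_bij_witness[of _ "\<lambda>(A, G, F). glue G F" "\<lambda>F. (?A F, induced F (?A F), induced F (U - ?A F))"])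
    fix F assume F: "F \<in> rooted_in \<G> U (insert c K)"
    then have r: "rooted_parts F (insert c K)" and v: "pverts F = U" and FG: "F \<in> \<G>" by (auto simp: rooted_in_def)
    note p = peel[OF r c, unfolded v]
    interpret disjoint_parts "induced F (?A F)" "induced F (U - ?A F)" "{c}" K
      using p by unfold_locales auto
    show "(case (?A F, induced F (?A F), induced F (U - ?A F)) of (A, G, F) \<Rightarrow> glue G F) = F" using p by simp
    have "induced F (?A F) \<in> \<G>" "induced F (U - ?A F) \<in> \<G>" using disjoint_in[OF disjoint_parts_axioms] p(3) FG by auto
    then show "(?A F, induced F (?A F), induced F (U - ?A F)) \<in> ?T" using p by (auto simp: rooted_in_def)
    show "(case (?A F, induced F (?A F), induced F (U - ?A F)) of (A, G, F) \<Rightarrow> Q G {c} * Q F K) = Q F (insert c K)"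
      using Q_disjoint[OF disjoint_parts_axioms] p(3) by simp
  next
    fix b assume "b \<in> ?T"
    then obtain A G F where b: "b = (A, G, F)" "c \<in> A" "A \<subseteq> U - K"
      "G \<in> \<G>" "pverts G = A" "rooted_parts G {c}" "F \<in> \<G>" "pverts F = U - A" "rooted_parts F K"
      by (auto simp: rooted_in_def)
    interpret disjoint_parts G F "{c}" K using b by unfold_locales auto
    have "(c, w) \<in> (parcs (glue G F))\<^sup>* \<longleftrightarrow> w \<in> A" for w
    proof -
      have "(c, w) \<in> (parcs (glue G F))\<^sup>* \<longleftrightarrow> (c, w) \<in> (parcs G)\<^sup>*" using reach_glue1 b by blast
      also have "\<dots> \<longleftrightarrow> w \<in> A"
        using rtrancl_verts[OF pg1, of c w] b by (auto simp: rooted_parts_def)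
      finally show ?thesis .
    qed
    then have A: "?A (glue G F) = A" by auto
    show "(\<lambda>F. (?A F, induced F (?A F), induced F (U - ?A F))) (case b of (A, G, F) \<Rightarrow> glue G F) = b"
      using induced_glue1 induced_glue2 b A by simp
    show "(case b of (A, G, F) \<Rightarrow> glue G F) \<in> rooted_in \<G> U (insert c K)"
      using rooted_parts_glue b disjoint_in[OF disjoint_parts_axioms] by (auto simp: rooted_in_def)
  qed
  also have "\<dots> = (\<Sum>A\<in>?S. \<Sum>(G, F)\<in>rooted_in \<G> A {c} \<times> rooted_in \<G> (U - A) K. Q G {c} * Q F K)"
    using sum.Sigma[OF fS fT, of "\<lambda>A (G, F). Q G {c} * Q F K"] by simp
  also have "\<dots> = (\<Sum>A\<in>?S. (\<Sum>G\<in>rooted_in \<G> A {c}. Q G {c}) * (\<Sum>F\<in>rooted_in \<G> (U - A) K. Q F K))"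
    by (simp add: sum_product sum.cartesian_product)
  finally show ?thesis .
qed

text \<open>
Peeling off the component of one root distributes the non-root labels binomially, so every root
contributes one factor \<open>What\<close>.
\<close>

lemma forest_sum:
  assumes "finite K" "finite U" "K \<subseteq> U"
  shows "(\<Sum>F\<in>rooted_in \<G> U K. Q F K) = fact (card (U - K)) * fps_nth (What ^ card K) (card (U - K))"
  using assms
proof (induct K arbitrary: U rule: finite_induct)
  case empty
  show ?case
  proof (cases "U = {}")
    case True
    have e: "pair_graph \<lparr>pverts = {}, parcs = {}\<rparr>" by (simp add: pair_graph_iff sym_def)
    have "rooted_in \<G> U {} = {\<lparr>pverts = {}, parcs = {}\<rparr>}"
      using no_arcs_in[OF e] e True by (auto simp: rooted_in_def rooted_parts_def pair_graph_iff intro!: graph_eqI)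
    then show ?thesis using True Q_empty by simp
  next
    case False
    then have "rooted_in \<G> U {} = {}" by (auto simp: rooted_in_def rooted_parts_def)
    then show ?thesis using False empty by (simp add: card_gt_0_iff)
  qed
next
  case (insert c K)
  define M where "M = U - insert c K"
  have fM: "finite M" using insert by (auto simp: M_def)
  let ?S = "{A. c \<in> A \<and> A \<subseteq> U - K}"
  let ?g = "\<lambda>i. wt (Suc i) * (fact (card M - i) * fps_nth (What ^ card K) (card M - i))"
  have "(\<Sum>F\<in>rooted_in \<G> U (insert c K). Q F (insert c K)) =
      (\<Sum>A\<in>?S. (\<Sum>G\<in>rooted_in \<G> A {c}. Q G {c}) * (\<Sum>F\<in>rooted_in \<G> (U - A) K. Q F K))"
    using insert by (intro peel_sum) auto
  also have "\<dots> = (\<Sum>B\<in>Pow M. ?g (card B))"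
  proof (rule sum.reindex_bij_witness[of _ "insert c" "\<lambda>A. A - {c}"])
    fix A assume A: "A \<in> ?S"
    show "insert c (A - {c}) = A" using A by auto
    show "A - {c} \<in> Pow M" using A by (auto simp: M_def)
    have fA: "finite A" using A insert by (auto intro: finite_subset)
    have "(\<Sum>F\<in>rooted_in \<G> (U - A) K. Q F K) = fact (card (U - A - K)) * fps_nth (What ^ card K) (card (U - A - K))"
      using A insert by (intro insert(3)) auto
    moreover have "U - A - K = M - (A - {c})" using A by (auto simp: M_def)
    moreover have "card (M - (A - {c})) = card M - card (A - {c})"
      using A fA by (intro card_Diff_subset) (auto simp: M_def)
    moreover have "(\<Sum>G\<in>rooted_in \<G> A {c}. Q G {c}) = wt (Suc (card (A - {c})))"
      using sum_relabel[OF fA, of c] A fA card_Suc_Diff1[OF fA, of c] by simp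
    ultimately show "?g (card (A - {c})) = (\<Sum>G\<in>rooted_in \<G> A {c}. Q G {c}) * (\<Sum>F\<in>rooted_in \<G> (U - A) K. Q F K)"
      by simp
  next
    fix B assume B: "B \<in> Pow M"
    then show "insert c B - {c} = B" "insert c B \<in> ?S" using insert by (auto simp: M_def)
  qed
  also have "\<dots> = (\<Sum>i\<le>card M. real (card M choose i) * ?g i)" by (rule sum_Pow_card[OF fM])
  also have "\<dots> = (\<Sum>i=0..card M. fact (card M) * (fps_nth What i * fps_nth (What ^ card K) (card M - i)))"
    unfolding atMost_atLeast0
  proof (rule sum.cong[OF refl])
    fix i assume "i \<in> {0..card M}"
    then have "real (card M choose i) * fact (card M - i) = fact (card M) / fact i"
      using binomial_fact[of i "card M", where ?'a = real] by (simp add: field_simps)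
    then show "real (card M choose i) * ?g i = fact (card M) * (fps_nth What i * fps_nth (What ^ card K) (card M - i))"
      by (simp add: field_simps)
  qed
  also have "\<dots> = fact (card M) * fps_nth (What ^ Suc (card K)) (card M)"
    by (simp add: fps_mult_nth sum_distrib_left)
  finally show ?case using insert by (simp add: M_def)
qed

lemma root_sum:
  assumes V: "finite V" and x: "x \<in> V"
  shows "(\<Sum>G\<in>rooted_in \<G> V {x}. Q (below_root G x) (root_children G x)) =
    (\<Sum>K\<in>Pow (V - {x}). real (card (cores_in \<G> (insert x K) x)) * (\<Sum>F\<in>rooted_in \<G> (V - {x}) K. Q F K))"
proof -
  let ?S = "Pow (V - {x})"
  let ?T = "SIGMA K:?S. cores_in \<G> (insert x K) x \<times> rooted_in \<G> (V - {x}) K"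
  let ?K = "\<lambda>G. root_children G x"
  have fT: "\<forall>K\<in>?S. finite (cores_in \<G> (insert x K) x \<times> rooted_in \<G> (V - {x}) K)"
    using V by (auto intro!: finite_cartesian_product finite_rooted_in finite_cores_in intro: finite_subset)
  have "(\<Sum>G\<in>rooted_in \<G> V {x}. Q (below_root G x) (root_children G x)) = (\<Sum>(K, H, F)\<in>?T. Q F K)"
  proof (rule sum.reindex_bij_witness[of _ "\<lambda>(K, H, F). glue H F" "\<lambda>G. (?K G, induced G (insert x (?K G)), below_root G x)"])
    fix G assume G: "G \<in> rooted_in \<G> V {x}"
    then have v: "pverts G = V" and GG: "G \<in> \<G>" and rg: "rooted_graph G x"
      by (auto simp: rooted_in_def rooted_parts_single rooted_graph_def)
    interpret rooted_graph G x by (rule rg)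
    have "induced G (insert x children) \<in> \<G>" "below_root G x \<in> \<G>"
      using root_in[OF root_glue_axioms] glue_decomposition GG by auto
    then show "(?K G, induced G (insert x (?K G)), below_root G x) \<in> ?T"
      using core_induced parts_below children_verts v by (auto simp: cores_in_def rooted_in_def below_root_def)
    show "(case (?K G, induced G (insert x (?K G)), below_root G x) of (K, H, F) \<Rightarrow> glue H F) = G"
      using glue_decomposition by simp
    show "(case (?K G, induced G (insert x (?K G)), below_root G x) of (K, H, F) \<Rightarrow> Q F K) = Q (below_root G x) (?K G)"
      by simp
  next
    fix b assume "b \<in> ?T"
    then obtain K H F where b: "b = (K, H, F)" "K \<subseteq> V - {x}" "H \<in> \<G>" "pverts H = insert x K" "core H x"
      "F \<in> \<G>" "pverts F = V - {x}" "rooted_parts F K"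
      by (auto simp: cores_in_def rooted_in_def)
    interpret root_glue H F x K using b by unfold_locales auto
    show "(\<lambda>G. (?K G, induced G (insert x (?K G)), below_root G x)) (case b of (K, H, F) \<Rightarrow> glue H F) = b"
      using root_children_glue induced_glue below_root_glue b by simp
    show "(case b of (K, H, F) \<Rightarrow> glue H F) \<in> rooted_in \<G> V {x}"
      using root_in[OF root_glue_axioms] b pconnected_glue pg_glue verts_glue x
      by (auto simp: rooted_in_def rooted_parts_single)
  qed
  also have "\<dots> = (\<Sum>K\<in>?S. \<Sum>(H, F)\<in>cores_in \<G> (insert x K) x \<times> rooted_in \<G> (V - {x}) K. Q F K)"
    using sum.Sigma[OF _ fT, of "\<lambda>K (H, F). Q F K"] V by simp
  also have "\<dots> = (\<Sum>K\<in>?S. real (card (cores_in \<G> (insert x K) x)) * (\<Sum>F\<in>rooted_in \<G> (V - {x}) K. Q F K))"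
    by (simp add: sum.cartesian_product[symmetric])
  finally show ?thesis .
qed

text \<open>
The equation \<open>C(z) = z \<Phi>(C(z))\<close> with weights: on the left each graph has the product of the weights of the
fringe subgraphs below its root.
\<close>

theorem root_sum_fps:
  "(\<Sum>G\<in>rooted_in \<G> {1..Suc m} {1}. Q (below_root G 1) (root_children G 1)) / fact m =
    fps_nth (core_fps \<G> oo weight_fps \<G> Q) m"
proof -
  define M where "M = {1..Suc m} - {1::nat}"
  have M: "finite M" "card M = m" by (auto simp: M_def)
  let ?g = "\<lambda>i. real (card (cores_in \<G> {1..Suc i} 1)) * (fact (m - i) * fps_nth (What ^ i) (m - i))"
  have "(\<Sum>G\<in>rooted_in \<G> {1..Suc m} {1}. Q (below_root G 1) (root_children G 1)) =
      (\<Sum>K\<in>Pow M. real (card (cores_in \<G> (insert 1 K) 1)) * (\<Sum>F\<in>rooted_in \<G> M K. Q F K))"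
    unfolding M_def by (rule root_sum) auto
  also have "\<dots> = (\<Sum>K\<in>Pow M. ?g (card K))"
  proof (rule sum.cong[OF refl])
    fix K assume K: "K \<in> Pow M"
    then have fK: "finite K" using M by (auto intro: finite_subset)
    have "1 \<notin> K" using K by (auto simp: M_def)
    then have "card (insert 1 K) = Suc (card K)" using fK by simp
    then have "card (cores_in \<G> (insert 1 K) 1) = card (cores_in \<G> {1..Suc (card K)} 1)"
      using cores_relabel_card[of "insert 1 K" 1] fK by simp
    moreover have "card (M - K) = m - card K" using K fK M by (simp add: card_Diff_subset)
    ultimately show "real (card (cores_in \<G> (insert 1 K) 1)) * (\<Sum>F\<in>rooted_in \<G> M K. Q F K) = ?g (card K)"
      using forest_sum[OF fK M(1)] K by simp
  qed
  also have "\<dots> = (\<Sum>i\<le>m. real (m choose i) * ?g i)" using sum_Pow_card[OF M(1), of ?g] M by simp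
  also have "\<dots> = (\<Sum>i=0..m. fact m * (fps_nth (core_fps \<G>) i * fps_nth (weight_fps \<G> Q ^ i) m))"
    unfolding atMost_atLeast0
  proof (rule sum.cong[OF refl])
    fix i assume i: "i \<in> {0..m}"
    then have "real (m choose i) * fact (m - i) = fact m / fact i"
      using binomial_fact[of i m, where ?'a = real] by (simp add: field_simps)
    moreover have "fps_nth (weight_fps \<G> Q ^ i) m = fps_nth (What ^ i) (m - i)"
      unfolding weight_fps_shift power_mult_distrib using i by (simp add: fps_X_power_mult_nth)
    ultimately show "real (m choose i) * ?g i = fact m * (fps_nth (core_fps \<G>) i * fps_nth (weight_fps \<G> Q ^ i) m)"
      by (simp add: core_fps_def field_simps)
  qed
  also have "\<dots> = fact m * fps_nth (core_fps \<G> oo weight_fps \<G> Q) m"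
    by (simp add: fps_compose_nth sum_distrib_left)
  finally show ?thesis by simp
qed

end

section \<open>The blocks of a core\<close>

text \<open>
The set \<open>A\<close> is a union of components of the core without its root. Collapsing all other vertices to the
root projects walks of the core to walks of the part.
\<close>

lemma core_part:
  assumes core: "core H x" and A: "A \<subseteq> pverts H - {x}"
    and closed: "\<And>a b. (a, b) \<in> avoid H x \<Longrightarrow> a \<in> A \<longleftrightarrow> b \<in> A"
  shows "core (induced H (insert x A)) x"
proof -
  let ?B = "induced H (insert x A)"
  have pgH: "pair_graph H" and xH: "x \<in> pverts H" using core by (auto simp: core_def)
  have pgB: "pair_graph ?B" using pair_graph_induced[OF pgH, of "insert x A"] A xH by auto
  define pj where "pj w = (if w \<in> A then w else x)" for w
  have st: "pj y = pj z \<or> (pj y, pj z) \<in> parcs ?B \<and> pj y \<in> {y, x} \<and> pj z \<in> {z, x}" if "(y, z) \<in> parcs H" for y z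
  proof (cases "y = x \<or> z = x")
    case True
    then show ?thesis using that A by (auto simp: pj_def)
  next
    case False
    then have "y \<in> A \<longleftrightarrow> z \<in> A" using closed[of y z] that by (auto simp: avoid_def)
    then show ?thesis using that by (auto simp: pj_def)
  qed
  have a: "(x, pj w) \<in> (parcs ?B)\<^sup>*" if "(x, w) \<in> (parcs H)\<^sup>*" for w
    using that
  proof (induct rule: rtrancl_induct)
    case base then show ?case using A by (auto simp: pj_def)
  next
    case (step y z)
    show ?case using st[OF step(2)] step(3) by (metis rtrancl.rtrancl_into_rtrancl)
  qed
  have b: "(x, pj w) \<in> (avoid ?B c)\<^sup>*" if "(x, w) \<in> (avoid H c)\<^sup>*" "c \<noteq> x" for w c
    using that(1)
  proof (induct rule: rtrancl_induct)
    case base then show ?case using A by (auto simp: pj_def)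
  next
    case (step y z)
    then have "(y, z) \<in> parcs H" "y \<noteq> c" "z \<noteq> c" by (auto simp: avoid_def)
    then have "pj y = pj z \<or> (pj y, pj z) \<in> avoid ?B c" using st[of y z] that(2) by (auto simp: avoid_def)
    then show ?case using step(3) by (metis rtrancl.rtrancl_into_rtrancl)
  qed
  have pj: "pj w = w" if "w \<in> insert x A" for w using that by (auto simp: pj_def)
  have "(x, w) \<in> (parcs ?B)\<^sup>*" if "w \<in> insert x A" for w
    using a[of w] pj[OF that] that A xH core by (auto simp: core_def pconnected_def)
  then have "rooted_parts ?B {x}" using pgB by (auto simp: rooted_parts_def)
  then have "pconnected ?B" by (simp add: rooted_parts_single)
  moreover have "(x, w) \<in> (avoid ?B c)\<^sup>*" if "c \<in> A" "w \<in> insert x A - {c}" for c w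
    using b[of w c] pj[of w] that A xH core unfolding core_def by fastforce
  moreover have "x \<notin> A" using A by auto
  ultimately show ?thesis using pgB unfolding core_def by auto
qed

lemma core_component_biconnected:
  assumes core: "core H x" and p: "p \<in> pverts H - {x}"
  defines "A \<equiv> {w. (p, w) \<in> (avoid H x)\<^sup>*}"
  shows "A \<subseteq> pverts H - {x}" "\<And>a b. (a, b) \<in> avoid H x \<Longrightarrow> a \<in> A \<longleftrightarrow> b \<in> A" "biconnected (induced H (insert x A))"
proof -
  let ?B = "induced H (insert x A)"
  have pgH: "pair_graph H" and xH: "x \<in> pverts H" using core by (auto simp: core_def)
  have "w \<in> pverts H - {x}" if "(p, w) \<in> (avoid H x)\<^sup>*" for w
    using that p by (induct rule: rtrancl_induct) (auto simp: avoid_def dest: pair_graphD(6)[OF pgH])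
  then show A: "A \<subseteq> pverts H - {x}" by (auto simp: A_def)
  show closed: "a \<in> A \<longleftrightarrow> b \<in> A" if "(a, b) \<in> avoid H x" for a b
  proof -
    have "(b, a) \<in> avoid H x" using that sym_avoid[OF pair_graphD(2)[OF pgH]] by (auto dest: symD)
    then show ?thesis using that by (auto simp: A_def intro: rtrancl_into_rtrancl)
  qed
  have coreB: "core ?B x" by (rule core_part[OF core A closed])
  then have pgB: "pair_graph ?B" by (auto simp: core_def)
  have pA: "p \<in> A" by (auto simp: A_def)
  have fin: "finite (insert x A)" using A pair_graphD(1)[OF pgH] finite_subset by auto
  have "card {x, p} \<le> card (insert x A)" using fin pA by (intro card_mono) auto
  moreover have "card {x, p} = 2" using p by auto
  ultimately have c2: "2 \<le> card (insert x A)" by simp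
  have inx: "(p, w) \<in> (avoid ?B x)\<^sup>*" if "(p, w) \<in> (avoid H x)\<^sup>*" for w
    using that
  proof (induct rule: rtrancl_induct)
    case (step y z)
    have "y \<in> A" "z \<in> A" using step by (auto simp: A_def intro: rtrancl_into_rtrancl)
    then have "(y, z) \<in> avoid ?B x" using step by (auto simp: avoid_def)
    with step(3) show ?case by (rule rtrancl_into_rtrancl)
  qed auto
  have root: "\<exists>d. \<forall>w\<in>insert x A - {v}. (d, w) \<in> (avoid ?B v)\<^sup>*" if v: "v \<in> insert x A" for v
  proof (cases "v = x")
    case True
    then show ?thesis using inx by (intro exI[of _ p]) (auto simp: A_def)
  next
    case False
    then show ?thesis using coreB v unfolding core_def by (intro exI[of _ x]) auto
  qed
  have "(a, b) \<in> (avoid ?B v)\<^sup>*" if v: "v \<in> insert x A" "a \<in> insert x A - {v}" "b \<in> insert x A - {v}" for v a b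
  proof -
    obtain d where d: "\<forall>w\<in>insert x A - {v}. (d, w) \<in> (avoid ?B v)\<^sup>*" using root[OF v(1)] by auto
    then have "(a, d) \<in> (avoid ?B v)\<^sup>*" using v pair_graphD(4)[OF pgB] by (auto dest: symD)
    then show ?thesis using d v by (meson rtrancl_trans)
  qed
  then show "biconnected ?B" using coreB pgB c2 unfolding biconnected_def core_def by auto
qed

context block_class begin

text \<open>
The block of a fixed vertex \<open>p\<close> is split off: it consists of the root and of the component of \<open>p\<close>
in the core without its root.
\<close>

lemma core_recursion:
  assumes S: "finite S" and p: "p \<in> S" and x: "x \<notin> S"
  shows "card (cores_in \<G> (insert x S) x) \<le>
    (\<Sum>A\<in>{A. p \<in> A \<and> A \<subseteq> S}. card (blocks_in \<G> (insert x A)) * card (cores_in \<G> (insert x (S - A)) x))"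
proof -
  let ?I = "{A. p \<in> A \<and> A \<subseteq> S}"
  let ?T = "SIGMA A:?I. blocks_in \<G> (insert x A) \<times> cores_in \<G> (insert x (S - A)) x"
  let ?A = "\<lambda>H. {w. (p, w) \<in> (avoid H x)\<^sup>*}"
  let ?f = "\<lambda>H. (?A H, induced H (insert x (?A H)), induced H (insert x (S - ?A H)))"
  have fI: "finite ?I" by (rule finite_subset[of _ "Pow S"]) (use S in auto)
  have fT: "\<forall>A\<in>?I. finite (blocks_in \<G> (insert x A) \<times> cores_in \<G> (insert x (S - A)) x)"
    using S by (auto intro!: finite_cartesian_product finite_blocks_in finite_cores_in intro: finite_subset)
  have main: "?f H \<in> ?T \<and> glue (induced H (insert x (?A H))) (induced H (insert x (S - ?A H))) = H"
    if "H \<in> cores_in \<G> (insert x S) x" for H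
  proof -
    have H: "H \<in> \<G>" "pverts H = insert x S" "core H x" using that by (auto simp: cores_in_def)
    have vS: "pverts H - {x} = S" using H x by auto
    then have pp: "p \<in> pverts H - {x}" using p by auto
    note t = core_component_biconnected[OF H(3) pp]
    have pgH: "pair_graph H" using H by (auto simp: core_def)
    have closed: "a \<in> S - ?A H \<longleftrightarrow> b \<in> S - ?A H" if "(a, b) \<in> avoid H x" for a b
      using t(2)[OF that] that pair_graphD(5,6)[OF pgH] vS by (auto simp: avoid_def)
    have c2: "core (induced H (insert x (S - ?A H))) x"
      by (rule core_part[OF H(3) _ closed]) (use vS in auto)
    have gl: "glue (induced H (insert x (?A H))) (induced H (insert x (S - ?A H))) = H"
    proof (rule graph_eqI)
      show "pverts (glue (induced H (insert x (?A H))) (induced H (insert x (S - ?A H)))) = pverts H"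
        using t(1) vS H by auto
      have "(a, b) \<in> parcs (glue (induced H (insert x (?A H))) (induced H (insert x (S - ?A H))))"
        if ab: "(a, b) \<in> parcs H" for a b
      proof -
        have "a \<in> insert x S" "b \<in> insert x S" using pair_graphD(5,6)[OF pgH ab] H by auto
        moreover have "a \<noteq> x \<Longrightarrow> b \<noteq> x \<Longrightarrow> a \<in> ?A H \<longleftrightarrow> b \<in> ?A H" using t(2)[of a b] ab by (auto simp: avoid_def)
        ultimately show ?thesis using ab by auto
      qed
      then show "parcs (glue (induced H (insert x (?A H))) (induced H (insert x (S - ?A H)))) = parcs H" by auto
    qed
    have "induced H (insert x (?A H)) \<in> \<G> \<and> induced H (insert x (S - ?A H)) \<in> \<G>"
    proof (rule iffD1[OF block_stable_glue[OF bs]])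
      show "pair_graph (induced H (insert x (?A H)))" using t(3) by (auto simp: biconnected_def)
      show "pair_graph (induced H (insert x (S - ?A H)))" using c2 by (auto simp: core_def)
      show "glue (induced H (insert x (?A H))) (induced H (insert x (S - ?A H))) \<in> \<G>" using gl H by simp
      fix a b assume "a \<in> pverts (induced H (insert x (?A H))) \<inter> pverts (induced H (insert x (S - ?A H)))"
        "b \<in> pverts (induced H (insert x (?A H))) \<inter> pverts (induced H (insert x (S - ?A H)))"
      then show "a = b" by auto
    qed
    then show ?thesis using gl t c2 vS by (auto simp: blocks_in_def cores_in_def)
  qed
  have "inj_on ?f (cores_in \<G> (insert x S) x)"
  proof (rule inj_onI)
    fix H1 H2 assume H: "H1 \<in> cores_in \<G> (insert x S) x" "H2 \<in> cores_in \<G> (insert x S) x" and e: "?f H1 = ?f H2"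
    have "H1 = glue (fst (snd (?f H1))) (snd (snd (?f H1)))" using main[OF H(1)] by simp
    also have "\<dots> = H2" unfolding e using main[OF H(2)] by simp
    finally show "H1 = H2" .
  qed
  then have "card (cores_in \<G> (insert x S) x) = card (?f ` cores_in \<G> (insert x S) x)" by (simp add: card_image)
  also have "\<dots> \<le> card ?T"
  proof (rule card_mono)
    show "finite ?T" by (rule finite_SigmaI[OF fI bspec[OF fT]])
    show "?f ` cores_in \<G> (insert x S) x \<subseteq> ?T" by (rule image_subsetI) (rule main[THEN conjunct1])
  qed
  also have "\<dots> = (\<Sum>A\<in>?I. card (blocks_in \<G> (insert x A)) * card (cores_in \<G> (insert x (S - A)) x))"
    using fI fT by (simp add: card_cartesian_product)
  finally show ?thesis .
qed

text \<open>
In terms of the series this is \<open>\<Phi>' \<le> B'' \<Phi>\<close> coefficientwise, the differential form of \<open>\<Phi> \<le> exp B'\<close>.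
\<close>

lemma core_fps_recursion:
  "real (Suc k) * fps_nth (core_fps \<G>) (Suc k) \<le>
    (\<Sum>i\<le>k. real (card (blocks_in \<G> {1..i + 2})) / fact i * fps_nth (core_fps \<G>) (k - i))"
proof -
  define S where "S = {2..Suc (Suc k)}"
  define M where "M = S - {2::nat}"
  have S: "finite S" "card S = Suc k" "2 \<in> S" "1 \<notin> S" "insert 1 S = {1..Suc (Suc k)}" by (auto simp: S_def)
  have M: "finite M" "card M = k" using S by (auto simp: M_def)
  let ?b = "\<lambda>n. real (card (blocks_in \<G> {1..n}))"
  let ?d = "\<lambda>n. real (card (cores_in \<G> {1..Suc n} 1))"
  have "?d (Suc k) \<le> real (\<Sum>A\<in>{A. 2 \<in> A \<and> A \<subseteq> S}. card (blocks_in \<G> (insert 1 A)) * card (cores_in \<G> (insert 1 (S - A)) 1))"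
    unfolding S(5)[symmetric] by (rule of_nat_mono[OF core_recursion[OF S(1,3,4)]])
  also have "\<dots> = (\<Sum>A\<in>{A. 2 \<in> A \<and> A \<subseteq> S}. real (card (blocks_in \<G> (insert 1 A))) * real (card (cores_in \<G> (insert 1 (S - A)) 1)))"
    by simp
  also have "\<dots> = (\<Sum>B\<in>Pow M. ?b (card B + 2) * ?d (k - card B))"
  proof (rule sum.reindex_bij_witness[of _ "insert 2" "\<lambda>A. A - {2}"])
    fix A assume A: "A \<in> {A. 2 \<in> A \<and> A \<subseteq> S}"
    show "insert 2 (A - {2}) = A" "A - {2} \<in> Pow M" using A by (auto simp: M_def)
    have fA: "finite A" using A S by (auto intro: finite_subset)
    have "1 \<notin> A" using A S by auto
    then have "card (insert 1 A) = card (A - {2}) + 2" using fA A card_Suc_Diff1[OF fA, of 2] by simp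
    then have 1: "card (blocks_in \<G> (insert 1 A)) = card (blocks_in \<G> {1..card (A - {2}) + 2})"
      using blocks_relabel_card[of "insert 1 A"] fA by simp
    have "card (S - A) = Suc k - card A" using A fA S by (simp add: card_Diff_subset)
    then have "card (insert 1 (S - A)) = Suc (k - card (A - {2}))"
      using S fA A card_Suc_Diff1[OF fA, of 2] by simp
    then have 2: "card (cores_in \<G> (insert 1 (S - A)) 1) = card (cores_in \<G> {1..Suc (k - card (A - {2}))} 1)"
      using cores_relabel_card[of "insert 1 (S - A)" 1] S by simp
    show "?b (card (A - {2}) + 2) * ?d (k - card (A - {2})) =
        real (card (blocks_in \<G> (insert 1 A))) * real (card (cores_in \<G> (insert 1 (S - A)) 1))"
      unfolding 1 2 by simp
  next
    fix B assume "B \<in> Pow M"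
    then show "insert 2 B - {2} = B" "insert 2 B \<in> {A. 2 \<in> A \<and> A \<subseteq> S}" using S by (auto simp: M_def)
  qed
  also have "\<dots> = (\<Sum>i\<le>k. real (k choose i) * (?b (i + 2) * ?d (k - i)))"
    using sum_Pow_card[OF M(1), of "\<lambda>i. ?b (i + 2) * ?d (k - i)"] M by simp
  also have "\<dots> = fact k * (\<Sum>i\<le>k. ?b (i + 2) / fact i * fps_nth (core_fps \<G>) (k - i))"
    unfolding sum_distrib_left
  proof (rule sum.cong[OF refl])
    fix i assume i: "i \<in> {..k}"
    then have "real (k choose i) = fact k / (fact i * fact (k - i))"
      using binomial_fact[of i k, where ?'a = real] by simp
    then show "real (k choose i) * (?b (i + 2) * ?d (k - i)) = fact k * (?b (i + 2) / fact i * fps_nth (core_fps \<G>) (k - i))"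
      by (simp add: core_fps_def)
  qed
  finally have "?d (Suc k) / fact k \<le> (\<Sum>i\<le>k. ?b (i + 2) / fact i * fps_nth (core_fps \<G>) (k - i))"
    by (simp add: field_simps)
  moreover have "real (Suc k) * fps_nth (core_fps \<G>) (Suc k) = ?d (Suc k) / fact k"
    by (simp add: core_fps_def)
  ultimately show ?thesis by simp
qed

end

section \<open>Partial sums of power series\<close>

text \<open>
Partial sums of series with nonnegative coefficients are submultiplicative. So an equation between series
becomes an inequality between partial sums at every point, also beyond the radius of convergence.
\<close>

definition partial_eval :: "real fps \<Rightarrow> nat \<Rightarrow> real \<Rightarrow> real" where
  "partial_eval F m x = (\<Sum>n\<le>m. fps_nth F n * x ^ n)"

abbreviation nonneg :: "real fps \<Rightarrow> bool" where
  "nonneg F \<equiv> (\<forall>n. 0 \<le> fps_nth F n)"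

lemma partial_eval_nonneg: "nonneg F \<Longrightarrow> 0 \<le> x \<Longrightarrow> 0 \<le> partial_eval F m x"
  unfolding partial_eval_def by (intro sum_nonneg) auto

lemma nonneg_mult: "nonneg F \<Longrightarrow> nonneg G \<Longrightarrow> nonneg (F * G)"
  by (auto simp: fps_mult_nth intro!: sum_nonneg)

lemma nonneg_power: "nonneg F \<Longrightarrow> nonneg (F ^ k)"
  by (induct k) (auto simp: fps_one_nth nonneg_mult)

lemma partial_eval_mult_le:
  assumes F: "nonneg F" and G: "nonneg G" and x: "0 \<le> x"
  shows "partial_eval (F * G) m x \<le> partial_eval F m x * partial_eval G m x"
proof -
  let ?t = "\<lambda>i j. (fps_nth F i * x ^ i) * (fps_nth G j * x ^ j)"
  have "partial_eval (F * G) m x = (\<Sum>n\<le>m. \<Sum>i\<le>n. ?t i (n - i))"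
    unfolding partial_eval_def fps_mult_nth sum_distrib_right atMost_atLeast0
    by (intro sum.cong refl) (simp add: power_add[symmetric] mult_ac)
  also have "\<dots> = (\<Sum>(i, j)\<in>{(i, j). i + j \<le> m}. ?t i j)" by (rule sum.triangle_reindex_eq[symmetric])
  also have "\<dots> \<le> (\<Sum>(i, j)\<in>{..m} \<times> {..m}. ?t i j)"
    by (intro sum_mono2) (auto intro!: mult_nonneg_nonneg simp: F G x)
  also have "\<dots> = partial_eval F m x * partial_eval G m x"
    unfolding partial_eval_def by (simp add: sum_product sum.cartesian_product)
  finally show ?thesis .
qed

lemma partial_eval_power_le:
  assumes F: "nonneg F" and x: "0 \<le> x"
  shows "partial_eval (F ^ k) m x \<le> partial_eval F m x ^ k"
proof (induct k)
  case 0
  have "partial_eval 1 m x = (\<Sum>n\<in>{0}. fps_nth (1 :: real fps) n * x ^ n)"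
    unfolding partial_eval_def by (rule sum.mono_neutral_right) auto
  then show ?case by simp
next
  case (Suc k)
  have "partial_eval (F ^ Suc k) m x \<le> partial_eval F m x * partial_eval (F ^ k) m x"
    using partial_eval_mult_le[OF F nonneg_power[OF F] x] by simp
  also have "\<dots> \<le> partial_eval F m x * partial_eval F m x ^ k"
    using Suc partial_eval_nonneg[OF F x] by (intro mult_left_mono) auto
  finally show ?case by simp
qed

lemma partial_eval_compose_le:
  assumes p: "nonneg p" and F: "nonneg F" and x: "0 \<le> x"
  shows "partial_eval (p oo F) m x \<le> (\<Sum>k\<le>m. fps_nth p k * partial_eval F m x ^ k)"
proof -
  have "partial_eval (p oo F) m x \<le> (\<Sum>n\<le>m. (\<Sum>k\<le>m. fps_nth p k * fps_nth (F ^ k) n) * x ^ n)"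
    unfolding partial_eval_def fps_compose_nth
  proof (intro sum_mono mult_right_mono)
    fix n assume "n \<in> {..m}"
    then show "(\<Sum>i = 0..n. fps_nth p i * fps_nth (F ^ i) n) \<le> (\<Sum>k\<le>m. fps_nth p k * fps_nth (F ^ k) n)"
      using p nonneg_power[OF F] by (intro sum_mono2) auto
  qed (use x in auto)
  also have "\<dots> = (\<Sum>k\<le>m. fps_nth p k * partial_eval (F ^ k) m x)"
    unfolding partial_eval_def sum_distrib_left sum_distrib_right by (subst sum.swap) (simp add: mult_ac)
  also have "\<dots> \<le> (\<Sum>k\<le>m. fps_nth p k * partial_eval F m x ^ k)"
    using p partial_eval_power_le[OF F x] by (intro sum_mono mult_left_mono) auto
  finally show ?thesis .
qed

lemma partial_sum_le_eval:
  assumes p: "nonneg p" and s: "summable (\<lambda>k. fps_nth p k * y ^ k)" and v: "0 \<le> v" "v \<le> y"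
  shows "(\<Sum>k\<le>m. fps_nth p k * v ^ k) \<le> eval_fps p y"
proof -
  have "(\<Sum>k\<le>m. fps_nth p k * v ^ k) \<le> (\<Sum>k\<le>m. fps_nth p k * y ^ k)"
    using p v by (intro sum_mono mult_left_mono power_mono) auto
  also have "\<dots> \<le> eval_fps p y" unfolding eval_fps_def using s p v by (intro sum_le_suminf) auto
  finally show ?thesis .
qed

lemma partial_eval_compose_le_eval:
  assumes p: "nonneg p" and F: "nonneg F" and x: "0 \<le> x"
    and s: "summable (\<lambda>k. fps_nth p k * y ^ k)" and y: "partial_eval F m x \<le> y"
  shows "partial_eval (p oo F) m x \<le> eval_fps p y"
  using partial_eval_compose_le[OF p F x, of m] partial_sum_le_eval[OF p s partial_eval_nonneg[OF F x] y, of m] by linarith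

lemma partial_eval_Suc_shift:
  assumes "fps_nth F 0 = 0" "\<And>n. fps_nth F (Suc n) \<le> fps_nth G n" "0 \<le> x"
  shows "partial_eval F (Suc m) x \<le> x * partial_eval G m x"
proof -
  have "partial_eval F (Suc m) x = (\<Sum>n\<le>m. fps_nth F (Suc n) * x ^ Suc n)"
    unfolding partial_eval_def by (subst sum.atMost_Suc_shift) (simp add: assms)
  also have "\<dots> \<le> (\<Sum>n\<le>m. fps_nth G n * x ^ Suc n)"
    using assms by (intro sum_mono mult_right_mono) auto
  also have "\<dots> = x * partial_eval G m x" unfolding partial_eval_def sum_distrib_left by (simp add: mult_ac)
  finally show ?thesis .
qed

text \<open>
Induction on the number of terms: the bound \<open>y\<close> on a partial sum is reproduced by the equation.
\<close>

lemma partial_eval_bounded_by_fixpoint: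
  assumes p: "nonneg p" and a: "nonneg a" "fps_nth a 0 = 0" "\<And>m. fps_nth a (Suc m) \<le> fps_nth (p oo a) m"
    and x: "0 \<le> x" and y: "0 \<le> y" and s: "summable (\<lambda>k. fps_nth p k * y ^ k)" and fp: "x * eval_fps p y \<le> y"
  shows "partial_eval a m x \<le> y"
proof (induct m)
  case 0 then show ?case using a y by (simp add: partial_eval_def)
next
  case (Suc m)
  have "partial_eval a (Suc m) x \<le> x * partial_eval (p oo a) m x" using a x by (intro partial_eval_Suc_shift) auto
  also have "\<dots> \<le> x * eval_fps p y" using partial_eval_compose_le_eval[OF p a(1) x s Suc] x by (rule mult_left_mono)
  finally show ?case using fp by simp
qed

lemma summable_of_partial_eval_bounded:
  assumes "nonneg a" "0 \<le> x" "\<And>m. partial_eval a m x \<le> y"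
  shows "summable (\<lambda>n. fps_nth a n * x ^ n)"
proof (rule summableI_nonneg_bounded[where x = y])
  fix n
  show "0 \<le> fps_nth a n * x ^ n" using assms by auto
  have "(\<Sum>i<n. fps_nth a i * x ^ i) \<le> partial_eval a n x"
    unfolding partial_eval_def using assms by (intro sum_mono2) auto
  then show "(\<Sum>i<n. fps_nth a i * x ^ i) \<le> y" using assms(3)[of n] by linarith
qed

lemma power_sums:
  assumes F: "nonneg F" and x: "0 \<le> x" and s: "(\<lambda>n. fps_nth F n * x ^ n) sums t"
  shows "(\<lambda>n. fps_nth (F ^ k) n * x ^ n) sums (t ^ k)"
proof (induct k)
  case 0
  have "(\<lambda>n. fps_nth (1 :: real fps) n * x ^ n) sums (\<Sum>n\<in>{0}. fps_nth (1 :: real fps) n * x ^ n)"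
    by (rule sums_finite) auto
  then show ?case by simp
next
  case (Suc k)
  have n: "summable (\<lambda>n. norm (fps_nth F n * x ^ n))" "summable (\<lambda>n. norm (fps_nth (F ^ k) n * x ^ n))"
    using sums_summable[OF s] sums_summable[OF Suc] F nonneg_power[OF F, of k] x
    by (simp_all add: abs_mult)
  have "(\<lambda>n. \<Sum>i\<le>n. (fps_nth F i * x ^ i) * (fps_nth (F ^ k) (n - i) * x ^ (n - i))) sums (t * t ^ k)"
    using Cauchy_product_sums[OF n] sums_unique[OF s] sums_unique[OF Suc] by simp
  moreover have "(\<Sum>i\<le>n. (fps_nth F i * x ^ i) * (fps_nth (F ^ k) (n - i) * x ^ (n - i))) = fps_nth (F ^ Suc k) n * x ^ n" for n
    unfolding power_Suc fps_mult_nth sum_distrib_right atMost_atLeast0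
    by (intro sum.cong refl) (simp add: power_add[symmetric] mult_ac)
  ultimately show ?case by simp
qed

text \<open>
The recursion is the one of an exponential. Multiplied by powers of \<open>y\<close> it says that the \<open>k\<close>-th term is at
most \<open>M/k\<close> times the maximum of the earlier ones, so the maximum no longer grows once \<open>k \<ge> M\<close>.
\<close>
lemma exp_type_recursion_bounded:
  fixes \<phi> \<beta> :: "nat \<Rightarrow> real"
  assumes \<phi>: "\<And>k. 0 \<le> \<phi> k" and \<beta>: "\<And>i. 0 \<le> \<beta> i" and y: "0 < y"
    and rec: "\<And>k. real (Suc k) * \<phi> (Suc k) \<le> (\<Sum>i\<le>k. \<beta> i * \<phi> (k - i))"
    and s: "summable (\<lambda>i. \<beta> i * y ^ i)"
  shows "\<exists>C. \<forall>k. \<phi> k * y ^ k \<le> C"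
proof -
  define M where "M = y * (\<Sum>i. \<beta> i * y ^ i)"
  obtain N :: nat where N: "M \<le> real N" using real_arch_simple by blast
  define C where "C = Max ((\<lambda>k. \<phi> k * y ^ k) ` {..N})"
  have base: "\<phi> k * y ^ k \<le> C" if "k \<le> N" for k unfolding C_def using that by (intro Max_ge) auto
  have C0: "0 \<le> C" using base[of 0] \<phi>[of 0] by simp
  have "\<phi> k * y ^ k \<le> C" for k
  proof (induct k rule: less_induct)
    case (less k)
    show ?case
    proof (cases "k \<le> N")
      case False
      then obtain l where l: "k = Suc l" "N \<le> l" by (cases k) auto
      have "real (Suc l) * (\<phi> (Suc l) * y ^ Suc l) = (real (Suc l) * \<phi> (Suc l)) * y ^ Suc l" by simp
      also have "\<dots> \<le> (\<Sum>i\<le>l. \<beta> i * \<phi> (l - i)) * y ^ Suc l" using rec[of l] y by (intro mult_right_mono) auto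
      also have "\<dots> = y * (\<Sum>i\<le>l. (\<beta> i * y ^ i) * (\<phi> (l - i) * y ^ (l - i)))"
        unfolding sum_distrib_left sum_distrib_right
      proof (rule sum.cong[OF refl])
        fix i assume "i \<in> {..l}"
        then have "y ^ l = y ^ i * y ^ (l - i)" by (simp add: power_add[symmetric])
        then show "\<beta> i * \<phi> (l - i) * y ^ Suc l = y * (\<beta> i * y ^ i * (\<phi> (l - i) * y ^ (l - i)))" by simp
      qed
      also have "\<dots> \<le> y * (\<Sum>i\<le>l. (\<beta> i * y ^ i) * C)"
        using y \<beta> less l by (intro mult_left_mono sum_mono) auto
      also have "\<dots> = y * C * (\<Sum>i\<le>l. \<beta> i * y ^ i)" by (simp add: sum_distrib_left mult_ac)
      also have "\<dots> \<le> y * C * (\<Sum>i. \<beta> i * y ^ i)"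
        using s \<beta> y C0 by (intro mult_left_mono sum_le_suminf) auto
      also have "\<dots> = M * C" by (simp add: M_def)
      also have "\<dots> \<le> real (Suc l) * C" using N l C0 by (intro mult_right_mono) auto
      finally show ?thesis using l by simp
    qed (rule base)
  qed
  then show ?thesis by blast
qed

lemma bounded_coeffs_summable:
  fixes \<phi> :: "nat \<Rightarrow> real"
  assumes \<phi>: "\<And>k. 0 \<le> \<phi> k" and b: "\<forall>k. \<phi> k * y ^ k \<le> C" and z: "0 \<le> z" "z < y"
  shows "summable (\<lambda>k. \<phi> k * z ^ k)"
proof (rule summable_comparison_test')
  show "summable (\<lambda>k. C * (z / y) ^ k)" using z by (intro summable_mult summable_geometric) auto
  fix k
  have "\<phi> k * z ^ k = \<phi> k * y ^ k * (z / y) ^ k" using z by (simp add: power_divide)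
  also have "\<dots> \<le> C * (z / y) ^ k" using b z by (intro mult_right_mono) auto
  finally show "norm (\<phi> k * z ^ k) \<le> C * (z / y) ^ k" using \<phi>[of k] z by simp
qed

section \<open>The subcritical fixed point\<close>

text \<open>
Here \<open>p\<close> stands for \<open>\<Phi>\<close> and \<open>a\<close> for \<open>C\<close>. The bounds on the first coefficients of \<open>p\<close> come from
the single vertex and the stars with one and two leaves; they make \<open>a\<close>
nondecreasing and, up to a shift of the index and a constant factor, supermultiplicative.
\<close>

locale subcritical_gf =
  fixes p a :: "real fps" and \<rho> \<tau> y1 :: real
  assumes p: "nonneg p" and a: "nonneg a" and a0: "fps_nth a 0 = 0"
    and a_Suc: "\<And>m. fps_nth a (Suc m) = fps_nth (p oo a) m"
    and p0: "fps_nth p 0 = 1" and p1: "fps_nth p 1 \<ge> 1" and p2: "fps_nth p 2 \<ge> 1 / 2"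
    and rho: "0 < \<rho>" and a_sums: "(\<lambda>n. fps_nth a n * \<rho> ^ n) sums \<tau>"
    and radius: "\<And>x. \<rho> < x \<Longrightarrow> \<not> summable (\<lambda>n. fps_nth a n * x ^ n)"
    and tau_less: "\<tau> < y1" and p_summable: "summable (\<lambda>k. fps_nth p k * y1 ^ k)"
begin

lemma a_ge:
  assumes "k \<le> m" shows "fps_nth a (Suc m) \<ge> fps_nth p k * fps_nth (a ^ k) m"
proof -
  have "fps_nth p k * fps_nth (a ^ k) m = (\<Sum>i\<in>{k}. fps_nth p i * fps_nth (a ^ i) m)" by simp
  also have "\<dots> \<le> fps_nth (p oo a) m"
    unfolding fps_compose_nth using assms p nonneg_power[OF a] by (intro sum_mono2) auto
  finally show ?thesis by (simp add: a_Suc)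
qed

lemma a1: "fps_nth a 1 = 1"
  using a_Suc[of 0] p0 by simp

lemma a_mono: "fps_nth a n \<le> fps_nth a (Suc n)"
proof (cases n)
  case (Suc m)
  have "1 * fps_nth a n \<le> fps_nth p 1 * fps_nth a n" using p1 a by (intro mult_right_mono) auto
  then show ?thesis using a_ge[of 1 n] Suc by simp
qed (use a a0 in simp)

lemma a_mono_le: "n \<le> m \<Longrightarrow> fps_nth a n \<le> fps_nth a m"
  by (rule lift_Suc_mono_le[of "fps_nth a"]) (rule a_mono)

lemma a_ge1: "1 \<le> n \<Longrightarrow> 1 \<le> fps_nth a n"
  using a_mono_le[of 1 n] a1 by simp

lemma a_pos: "1 \<le> n \<Longrightarrow> 0 < fps_nth a n"
  using a_ge1[of n] by simp

lemma a_supermult: "fps_nth a i * fps_nth a j / 2 \<le> fps_nth a (Suc (i + j))"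
proof (cases "i = 0 \<or> j = 0")
  case True
  then show ?thesis using a a0 by auto
next
  case False
  have "fps_nth a i * fps_nth a j \<le> (\<Sum>l=0..i + j. fps_nth a l * fps_nth a (i + j - l))"
    using member_le_sum[of i "{0..i + j}" "\<lambda>l. fps_nth a l * fps_nth a (i + j - l)"] a by simp
  also have "\<dots> = fps_nth (a ^ 2) (i + j)" by (simp add: power2_eq_square fps_mult_nth)
  finally have 1: "fps_nth a i * fps_nth a j \<le> fps_nth (a ^ 2) (i + j)" .
  have "fps_nth a i * fps_nth a j / 2 \<le> fps_nth p 2 * (fps_nth a i * fps_nth a j)"
    using mult_right_mono[OF p2, of "fps_nth a i * fps_nth a j"] a by simp
  also have "\<dots> \<le> fps_nth p 2 * fps_nth (a ^ 2) (i + j)" using 1 p by (intro mult_left_mono) auto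
  also have "\<dots> \<le> fps_nth a (Suc (i + j))" using False by (intro a_ge) auto
  finally show ?thesis .
qed

text \<open>
The radius of convergence only yields infinitely many large coefficients. One of them, at an index
\<open>q\<close>, propagates to all multiples of \<open>q\<close> by supermultiplicativity and to the indices in between by monotonicity.
\<close>
lemma a_lower:
  assumes \<sigma>: "0 < \<sigma>" "\<sigma> < 1 / \<rho>"
  shows "\<exists>\<kappa>>0. \<forall>n\<ge>1. \<kappa> * \<sigma> ^ n \<le> fps_nth a n"
proof -
  \<comment> \<open>With the shift by one and the factor \<open>1/2\<close> the sequence is supermultiplicative without a constant.\<close>
  define f where "f n = fps_nth a (n - 1) / 2" for n
  have "\<exists>q\<ge>1. \<sigma> ^ q \<le> f q"
  proof (rule ccontr)
    assume "\<not> ?thesis"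
    then have lt: "f q < \<sigma> ^ q" if "1 \<le> q" for q using that by force
    obtain x where x: "\<rho> < x" "x < 1 / \<sigma>" using dense[of \<rho> "1 / \<sigma>"] \<sigma> rho by (auto simp: field_simps)
    have "\<forall>n. fps_nth a n * (1 / \<sigma>) ^ n \<le> 2 * \<sigma>"
    proof
      fix n
      have "fps_nth a n \<le> 2 * \<sigma> * \<sigma> ^ n" using lt[of "Suc n"] by (simp add: f_def)
      then show "fps_nth a n * (1 / \<sigma>) ^ n \<le> 2 * \<sigma>" using \<sigma> by (simp add: power_divide divide_le_eq)
    qed
    then have "summable (\<lambda>n. fps_nth a n * x ^ n)"
      by (rule bounded_coeffs_summable[rotated]) (use a x rho in auto)
    then show False using radius[OF x(1)] by simp
  qed
  then obtain q where q: "1 \<le> q" "\<sigma> ^ q \<le> f q" by auto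
  have supf: "f n * f m \<le> f (n + m)" if "1 \<le> n" "1 \<le> m" for n m
  proof -
    obtain n' m' where nm: "n = Suc n'" "m = Suc m'" using \<open>1 \<le> n\<close> \<open>1 \<le> m\<close> by (cases n; cases m) auto
    show ?thesis using a_supermult[of n' m'] unfolding f_def nm by (simp add: mult_ac)
  qed
  have fj: "\<sigma> ^ (Suc j * q) \<le> f (Suc j * q)" for j
  proof (induct j)
    case (Suc j)
    have "\<sigma> ^ (Suc (Suc j) * q) = \<sigma> ^ (Suc j * q) * \<sigma> ^ q" by (simp add: power_add[symmetric] add_ac)
    also have "\<dots> \<le> f (Suc j * q) * f q" using Suc q \<sigma> by (intro mult_mono) (auto simp: f_def intro: a[rule_format])
    also have "\<dots> \<le> f (Suc j * q + q)" using q by (intro supf) auto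
    finally show ?case by (simp add: add_ac)
  qed (use q in simp)
  \<comment> \<open>The constant \<open>1/s^q\<close> makes up for fewer than \<open>q\<close> missing factors \<open>\<sigma>\<close>, whether \<open>\<sigma>\<close> is above or below 1.\<close>
  define s where "s = max 1 \<sigma>"
  have s: "1 \<le> s" "\<sigma> \<le> s" by (auto simp: s_def)
  have si: "\<sigma> ^ i \<le> s ^ q" if "i \<le> q" for i
  proof -
    have "\<sigma> ^ i \<le> s ^ i" using s \<sigma> by (intro power_mono) auto
    also have "\<dots> \<le> s ^ q" using s that by (intro power_increasing) auto
    finally show ?thesis .
  qed
  show ?thesis
  proof (intro exI[of _ "1 / s ^ q"] conjI allI impI)
    show "0 < 1 / s ^ q" using s by simp
    fix n :: nat assume n: "1 \<le> n"
    show "1 / s ^ q * \<sigma> ^ n \<le> fps_nth a n"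
    proof (cases "n < q")
      case True
      then have "\<sigma> ^ n / s ^ q \<le> 1" using si[of n] s by (simp add: divide_le_eq)
      then show ?thesis using a_ge1[OF n] by simp
    next
      case False
      define j where "j = n div q - 1"
      have dq: "n div q \<ge> 1" using False q by (simp add: div_greater_zero_iff Suc_leI)
      then have nj: "n = Suc j * q + n mod q" by (simp add: j_def)
      have "\<sigma> ^ n = \<sigma> ^ (Suc j * q) * \<sigma> ^ (n mod q)" using nj by (metis power_add)
      also have "\<dots> \<le> f (Suc j * q) * s ^ q"
        using fj[of j] si[of "n mod q"] q \<sigma> by (intro mult_mono) (auto simp: f_def intro: a[rule_format])
      also have "\<dots> \<le> fps_nth a n * s ^ q"
      proof (rule mult_right_mono)
        have "Suc j * q - 1 \<le> n" using nj by linarith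
        then have "fps_nth a (Suc j * q - 1) \<le> fps_nth a n" by (rule a_mono_le)
        then show "f (Suc j * q) \<le> fps_nth a n" using a[rule_format, of "Suc j * q - 1"] unfolding f_def by linarith
      qed (use s in simp)
      finally show ?thesis using s by (simp add: divide_le_eq)
    qed
  qed
qed

lemma tau_ge: "partial_eval a m \<rho> \<le> \<tau>"
  unfolding partial_eval_def using sum_le_suminf[OF sums_summable[OF a_sums], of "{..m}"] a rho sums_unique[OF a_sums] by auto

lemma partial_eval_tendsto: "(\<lambda>m. partial_eval a m \<rho>) \<longlonglongrightarrow> \<tau>"
  using a_sums unfolding sums_def_le partial_eval_def .

lemma partial_eval_less: "partial_eval a m \<rho> < \<tau>"
proof -
  have "partial_eval a m \<rho> < partial_eval a (Suc m) \<rho>" unfolding partial_eval_def using a_pos[of "Suc m"] rho by simp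
  then show ?thesis using tau_ge[of "Suc m"] by linarith
qed

lemma tau_pos: "0 < \<tau>"
  using partial_eval_less[of 0] a0 by (simp add: partial_eval_def)

lemma summable_p:
  assumes "0 \<le> v" "v \<le> y1" shows "summable (\<lambda>k. fps_nth p k * v ^ k)"
proof (rule summable_comparison_test'[OF p_summable])
  fix k
  show "norm (fps_nth p k * v ^ k) \<le> fps_nth p k * y1 ^ k"
    using p assms by (auto intro!: mult_left_mono power_mono)
qed

lemma eval_ge_1: "0 \<le> v \<Longrightarrow> v \<le> y1 \<Longrightarrow> 1 \<le> eval_fps p v"
  using partial_sum_le_eval[OF p summable_p, of v v 0] p0 by simp

text \<open>
At the boundary of convergence evaluation does not commute with composition for free. One inequality comes from
finitely many powers of \<open>a\<close>, the other one from the partial sums of \<open>a\<close>.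
\<close>

lemma fixpoint: "\<rho> * eval_fps p \<tau> = \<tau>"
proof (rule antisym)
  have "\<rho> * (\<Sum>k<J. fps_nth p k * \<tau> ^ k) \<le> \<tau>" for J
  proof -
    have "(\<lambda>n. \<rho> * (\<Sum>k<J. fps_nth p k * (fps_nth (a ^ k) n * \<rho> ^ n))) sums (\<rho> * (\<Sum>k<J. fps_nth p k * \<tau> ^ k))"
      using power_sums[OF a less_imp_le[OF rho] a_sums] by (intro sums_mult sums_sum) auto
    moreover have "(\<lambda>n. fps_nth a (Suc n) * \<rho> ^ Suc n) sums \<tau>"
      using a_sums a0 by (subst sums_Suc_iff) simp
    moreover have "\<rho> * (\<Sum>k<J. fps_nth p k * (fps_nth (a ^ k) n * \<rho> ^ n)) \<le> fps_nth a (Suc n) * \<rho> ^ Suc n" for n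
    proof -
      have z: "fps_nth (a ^ k) n = 0" if "n < k" for k using that a0 by (simp add: startsby_zero_power_prefix)
      have "(\<Sum>k<J. fps_nth p k * fps_nth (a ^ k) n) = (\<Sum>k\<in>{..<J} \<inter> {0..n}. fps_nth p k * fps_nth (a ^ k) n)"
        using z by (intro sum.mono_neutral_right) (auto simp: not_le)
      also have "\<dots> \<le> (\<Sum>k=0..n. fps_nth p k * fps_nth (a ^ k) n)"
        using p nonneg_power[OF a] by (intro sum_mono2) auto
      also have "\<dots> = fps_nth a (Suc n)" by (simp add: a_Suc fps_compose_nth)
      finally have "(\<Sum>k<J. fps_nth p k * fps_nth (a ^ k) n) * \<rho> ^ Suc n \<le> fps_nth a (Suc n) * \<rho> ^ Suc n"
        using rho by (intro mult_right_mono) auto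
      moreover have "\<rho> * (\<Sum>k<J. fps_nth p k * (fps_nth (a ^ k) n * \<rho> ^ n)) = (\<Sum>k<J. fps_nth p k * fps_nth (a ^ k) n) * \<rho> ^ Suc n"
        unfolding sum_distrib_left sum_distrib_right by (intro sum.cong) auto
      ultimately show ?thesis by (simp only:)
    qed
    ultimately show ?thesis by (metis (no_types, lifting) sums_le)
  qed
  then have "(\<Sum>k<J. fps_nth p k * \<tau> ^ k) \<le> \<tau> / \<rho>" for J using rho by (simp add: field_simps)
  then have "eval_fps p \<tau> \<le> \<tau> / \<rho>" unfolding eval_fps_def
    using summable_p[of \<tau>] tau_pos tau_less by (intro suminf_le_const) auto
  then show "\<rho> * eval_fps p \<tau> \<le> \<tau>" using rho by (simp add: field_simps)
next
  have "partial_eval a m \<rho> \<le> \<rho> * eval_fps p \<tau>" for m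
  proof (cases m)
    case 0
    then show ?thesis using a0 rho eval_ge_1[of \<tau>] tau_pos tau_less by (simp add: partial_eval_def)
  next
    case (Suc l)
    have "partial_eval a (Suc l) \<rho> \<le> \<rho> * partial_eval (p oo a) l \<rho>"
      using a0 a_Suc rho by (intro partial_eval_Suc_shift) auto
    also have "\<dots> \<le> \<rho> * eval_fps p \<tau>"
      using rho tau_ge tau_pos tau_less by (intro mult_left_mono partial_eval_compose_le_eval[OF p a] summable_p) auto
    finally show ?thesis using Suc by simp
  qed
  then show "\<tau> \<le> \<rho> * eval_fps p \<tau>" by (intro LIMSEQ_le_const2[OF partial_eval_tendsto]) auto
qed

definition deriv_at_tau where "deriv_at_tau = (\<Sum>n. diffs (fps_nth p) n * \<tau> ^ n)"

lemma deriv_eval: "(eval_fps p has_real_derivative deriv_at_tau) (at \<tau>)"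
  unfolding eval_fps_def[abs_def] deriv_at_tau_def using tau_pos tau_less by (intro termdiffs_strong[OF p_summable]) auto

text \<open>
Otherwise \<open>y/\<Phi>(y)\<close> would increase at \<open>\<tau>\<close>, where its value is \<open>\<rho>\<close>. A slightly larger \<open>y\<close> would then bound
the partial sums of \<open>a\<close> at a point beyond its radius of convergence.
\<close>
lemma critical: "1 \<le> \<rho> * deriv_at_tau"
proof (rule ccontr)
  assume "\<not> 1 \<le> \<rho> * deriv_at_tau"
  then have pos: "0 < 1 - \<rho> * deriv_at_tau" by simp
  have "((\<lambda>y. y - \<rho> * eval_fps p y) has_real_derivative (1 - \<rho> * deriv_at_tau)) (at \<tau>)"
    using DERIV_diff[OF DERIV_ident DERIV_cmult[OF deriv_eval, of \<rho>]] .
  from DERIV_pos_inc_right[OF this pos]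
  obtain d where d: "0 < d" "\<And>h. 0 < h \<Longrightarrow> h < d \<Longrightarrow> \<tau> - \<rho> * eval_fps p \<tau> < (\<tau> + h) - \<rho> * eval_fps p (\<tau> + h)" by auto
  define h where "h = min (d / 2) (y1 - \<tau>)"
  have h: "0 < h" "h < d" "\<tau> + h \<le> y1" using d(1) tau_less by (auto simp: h_def)
  define y where "y = \<tau> + h"
  have y: "\<rho> * eval_fps p y < y" "\<tau> < y" "y \<le> y1" using d(2)[OF h(1,2)] fixpoint h by (auto simp: y_def)
  have e1: "1 \<le> eval_fps p y" using y tau_pos by (intro eval_ge_1) auto
  define x where "x = y / eval_fps p y"
  have x: "\<rho> < x" using y e1 by (simp add: x_def less_divide_eq)
  have "partial_eval a m x \<le> y" for m
    using x rho y tau_pos e1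
    by (intro partial_eval_bounded_by_fixpoint[OF p a a0] summable_p) (auto simp: a_Suc x_def)
  then have "summable (\<lambda>n. fps_nth a n * x ^ n)"
    using x rho by (intro summable_of_partial_eval_bounded[OF a]) auto
  then show False using radius[OF x] by simp
qed

text \<open>
The derivative of \<open>y \<mapsto> \<rho> \<Phi>(y)\<close> at its fixed point \<open>\<tau>\<close> is at least 1, so a relative loss of order \<open>t\<close>
below \<open>\<tau>\<close> is preserved to first order. The slack between \<open>\<epsilon>/2\<close> and \<open>\<epsilon>\<close> absorbs the error term.
\<close>
lemma level_step:
  assumes \<epsilon>: "0 < \<epsilon>" "\<epsilon> < 1"
  shows "eventually (\<lambda>t. \<rho> * eval_fps p (\<tau> * (1 - (1 - \<epsilon> / 2) * t)) \<le> \<tau> * (1 - (1 - \<epsilon>) * t)) (at_right 0)"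
proof -
  define c where "c = 1 - \<epsilon> / 2"
  have c: "0 < c" "c < 1" "1 - \<epsilon> < c" using \<epsilon> by (auto simp: c_def)
  let ?f = "\<lambda>t. \<tau> * (1 - (1 - \<epsilon>) * t) - \<rho> * eval_fps p (\<tau> * (1 - c * t))"
  have e: "(eval_fps p has_real_derivative deriv_at_tau) (at (\<tau> * (1 - c * 0)))" using deriv_eval by simp
  have "((\<lambda>t. eval_fps p (\<tau> * (1 - c * t))) has_real_derivative deriv_at_tau * (\<tau> * (- c))) (at 0)"
    by (rule DERIV_chain2[where f = "eval_fps p" and g = "\<lambda>t. \<tau> * (1 - c * t)", OF e]) (auto intro!: derivative_eq_intros)
  then have "(?f has_real_derivative (\<tau> * (- (1 - \<epsilon>)) - \<rho> * (deriv_at_tau * (\<tau> * (- c))))) (at 0)"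
    by (auto intro!: derivative_eq_intros)
  moreover have "0 < \<tau> * (- (1 - \<epsilon>)) - \<rho> * (deriv_at_tau * (\<tau> * (- c)))"
  proof -
    have "1 * c \<le> \<rho> * deriv_at_tau * c" using critical c by (intro mult_right_mono) auto
    then have "0 < \<rho> * deriv_at_tau * c - (1 - \<epsilon>)" using c by linarith
    then have "0 < \<tau> * (\<rho> * deriv_at_tau * c - (1 - \<epsilon>))" using tau_pos by simp
    then show ?thesis by (simp add: algebra_simps)
  qed
  ultimately obtain d where d: "0 < d" "\<And>h. 0 < h \<Longrightarrow> h < d \<Longrightarrow> ?f 0 < ?f (0 + h)"
    using DERIV_pos_inc_right by blast
  have "?f 0 = 0" using fixpoint by simp
  then have "\<rho> * eval_fps p (\<tau> * (1 - c * h)) \<le> \<tau> * (1 - (1 - \<epsilon>) * h)" if "0 < h" "h < d" for h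
    using d(2)[OF that] by simp
  then show ?thesis unfolding eventually_at_right_field c_def[symmetric] using d(1) by (intro exI[of _ d]) auto
qed

text \<open>
\<open>W r t\<close> is the series with weight \<open>(1 - t)^Z\<close>, where \<open>Z\<close> is the size of level \<open>r\<close>. Passing from a level
to the next one is one application of the equation.
\<close>

lemma level_bound:
  fixes W :: "nat \<Rightarrow> real \<Rightarrow> real fps"
  assumes W: "\<And>r t. 0 < t \<Longrightarrow> t < 1 \<Longrightarrow> nonneg (W r t)" and W0: "\<And>r t. fps_nth (W r t) 0 = 0"
    and base: "\<And>t n. 0 < t \<Longrightarrow> t < 1 \<Longrightarrow> fps_nth (W 0 t) n = (1 - t) * fps_nth a n"
    and step: "\<And>r t m. 0 < t \<Longrightarrow> t < 1 \<Longrightarrow> fps_nth (W (Suc r) t) (Suc m) = fps_nth (p oo W r t) m"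
    and \<epsilon>: "0 < \<epsilon>" "\<epsilon> < 1"
  shows "eventually (\<lambda>t. \<forall>m. partial_eval (W r t) m \<rho> \<le> \<tau> * (1 - (1 - \<epsilon>) * t)) (at_right 0)"
  using \<epsilon>
proof (induct r arbitrary: \<epsilon>)
  case 0
  have "eventually (\<lambda>t::real. 0 < t \<and> t < 1) (at_right 0)" unfolding eventually_at_right_field by (intro exI[of _ 1]) auto
  then show ?case
  proof eventually_elim
    case (elim t)
    show ?case
    proof
      fix m
      have "partial_eval (W 0 t) m \<rho> = (1 - t) * partial_eval a m \<rho>"
        unfolding partial_eval_def sum_distrib_left using base elim by (simp add: mult_ac)
      also have "\<dots> \<le> (1 - t) * \<tau>" using tau_ge elim by (intro mult_left_mono) auto
      also have "\<dots> \<le> \<tau> * (1 - (1 - \<epsilon>) * t)" using 0 tau_pos elim by (simp add: algebra_simps)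
      finally show "partial_eval (W 0 t) m \<rho> \<le> \<tau> * (1 - (1 - \<epsilon>) * t)" .
    qed
  qed
next
  case (Suc r)
  have "eventually (\<lambda>t. \<forall>m. partial_eval (W r t) m \<rho> \<le> \<tau> * (1 - (1 - \<epsilon> / 2) * t)) (at_right 0)"
    using Suc(2,3) by (intro Suc(1)) auto
  moreover have "eventually (\<lambda>t::real. 0 < t \<and> t < 1) (at_right 0)" unfolding eventually_at_right_field by (intro exI[of _ 1]) auto
  ultimately show ?case using level_step[OF Suc(2,3)]
  proof eventually_elim
    case (elim t)
    define v where "v = \<tau> * (1 - (1 - \<epsilon> / 2) * t)"
    have "(1 - \<epsilon> / 2) * t \<le> 1 * 1" using elim Suc(2,3) by (intro mult_mono) auto
    moreover have "0 \<le> (1 - \<epsilon> / 2) * t" using elim Suc(2,3) by auto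
    ultimately have v: "0 \<le> v" "v \<le> \<tau>" using tau_pos by (auto simp: v_def mult_le_cancel_left1)
    have g0: "0 \<le> \<tau> * (1 - (1 - \<epsilon>) * t)"
    proof -
      have "(1 - \<epsilon>) * t \<le> 1 * 1" using elim Suc(2,3) by (intro mult_mono) auto
      then show ?thesis using tau_pos by simp
    qed
    show ?case
    proof
      fix m
      show "partial_eval (W (Suc r) t) m \<rho> \<le> \<tau> * (1 - (1 - \<epsilon>) * t)"
      proof (cases m)
        case 0 then show ?thesis using W0 g0 by (simp add: partial_eval_def)
      next
        case (Suc l)
        have "partial_eval (W (Suc r) t) (Suc l) \<rho> \<le> \<rho> * partial_eval (p oo W r t) l \<rho>"
          using W0 step elim rho by (intro partial_eval_Suc_shift) auto
        also have "\<dots> \<le> \<rho> * eval_fps p v"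
          using elim rho v tau_less W
          by (intro mult_left_mono partial_eval_compose_le_eval[OF p] summable_p) (auto simp: v_def)
        finally show ?thesis using elim Suc by (simp add: v_def)
      qed
    qed
  qed
qed

text \<open>
The bound \<open>\<tau>\<close> is reproduced by the equation although \<open>x\<close> exceeds \<open>\<rho>\<close>: the excess
\<open>\<tau> (x/\<rho> - 1)\<close> is paid for by the terms of \<open>H\<close>. These are only available from the index \<open>K\<close> on; up to there the
unperturbed series serves as a bound.
\<close>
lemma perturbed_bound:
  fixes W H :: "real fps"
  assumes W: "nonneg W" and W0: "fps_nth W 0 = 0" and H: "nonneg H" "fps_nth H 0 = 0"
    and Wa: "\<And>n. fps_nth W n \<le> fps_nth a n"
    and rec: "\<And>m. fps_nth W (Suc m) + fps_nth H (Suc m) = fps_nth (p oo W) m"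
    and x: "\<rho> \<le> x" and base: "partial_eval a K x \<le> \<tau>"
    and gain: "\<tau> * (x / \<rho> - 1) \<le> partial_eval H K x"
  shows "partial_eval W m x \<le> \<tau>"
proof -
  have x0: "0 \<le> x" using x rho by simp
  have le: "partial_eval W m x \<le> \<tau>" if "m \<le> K" for m
  proof -
    have "partial_eval W m x \<le> partial_eval a m x" unfolding partial_eval_def using Wa x0 by (intro sum_mono mult_right_mono) auto
    also have "\<dots> \<le> partial_eval a K x" unfolding partial_eval_def using that a x0 by (intro sum_mono2) auto
    finally show ?thesis using base by simp
  qed
  show ?thesis
  proof (cases "m \<le> K")
    case False
    then have "K \<le> m" by simp
    then show ?thesis
    proof (induct m rule: dec_induct)
      case base then show ?case using le by simp
    next
      case (step m)
      have "partial_eval W (Suc m) x + partial_eval H (Suc m) x = partial_eval (W + H) (Suc m) x"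
        unfolding partial_eval_def by (simp add: sum.distrib algebra_simps)
      also have "\<dots> \<le> x * partial_eval (p oo W) m x" using W0 H rec x0 by (intro partial_eval_Suc_shift) auto
      also have "\<dots> \<le> x * eval_fps p \<tau>"
        using x0 step(3) tau_pos tau_less by (intro mult_left_mono partial_eval_compose_le_eval[OF p W] summable_p) auto
      also have "\<dots> = \<tau> * (x / \<rho>)" using fixpoint rho by (simp add: field_simps)
      finally have "partial_eval W (Suc m) x \<le> \<tau> * (x / \<rho>) - partial_eval H (Suc m) x" by simp
      moreover have "partial_eval H K x \<le> partial_eval H (Suc m) x"
        unfolding partial_eval_def using step(1) H x0 by (intro sum_mono2) auto
      ultimately show ?case using gain by (simp add: algebra_simps)
    qed
  qed (rule le)
qed

end

section \<open>Small cores and multiplicative weights\<close>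

context block_class begin

lemma single_arc_in:
  assumes "a \<noteq> b" shows "\<lparr>pverts = {a, b}, parcs = {(a, b), (b, a)}\<rparr> \<in> \<G>" (is "?K \<in> \<G>")
proof -
  have pg: "pair_graph ?K" using assms by (auto simp: pair_graph_iff sym_def)
  have "complete_digraph 2 (with_proj ?K)"
    using assms pair_graph.pair_graphD_graph[OF pg] by (auto simp: complete_digraph_def)
  then show ?thesis using bs by (auto simp: block_stable_def)
qed

lemma core_fps_0: "fps_nth (core_fps \<G>) 0 = 1"
proof -
  let ?K = "\<lparr>pverts = {1::nat}, parcs = {}\<rparr>"
  have pg: "pair_graph ?K" by (auto simp: pair_graph_iff sym_def)
  have "cores_in \<G> {1..1} 1 = {?K}"
  proof (intro equalityI subsetI)
    fix H assume "H \<in> cores_in \<G> {1..1} 1"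
    then have "pverts H = {1}" "pair_graph H" by (auto simp: cores_in_def core_def)
    then have "H = ?K" using pair_graph_arcs[of H] pair_graphD(7)[of H 1] by (intro graph_eqI) auto
    then show "H \<in> {?K}" by simp
  next
    fix H assume "H \<in> {?K}"
    then show "H \<in> cores_in \<G> {1..1} 1"
      using pg no_arcs_in[OF pg] by (auto simp: cores_in_def core_def pconnected_def)
  qed
  then show ?thesis by (simp add: core_fps_def)
qed

lemma core_fps_1: "fps_nth (core_fps \<G>) 1 \<ge> 1"
proof -
  let ?K = "\<lparr>pverts = {1, 2::nat}, parcs = {(1, 2), (2, 1)}\<rparr>"
  have "pair_graph ?K" by (auto simp: pair_graph_iff sym_def)
  moreover have "?K \<in> \<G>" using single_arc_in[of 1 2] by simp
  ultimately have "?K \<in> cores_in \<G> {1..2} 1" by (auto simp: cores_in_def core_def pconnected_def)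
  then have "card (cores_in \<G> {1..2} 1) > 0" using finite_cores_in by (auto simp: card_gt_0_iff)
  then show ?thesis by (simp add: core_fps_def numeral_2_eq_2)
qed

lemma core_fps_2: "fps_nth (core_fps \<G>) 2 \<ge> 1 / 2"
proof -
  let ?K = "\<lparr>pverts = {1, 2::nat}, parcs = {(1, 2), (2, 1)}\<rparr>"
  let ?L = "\<lparr>pverts = {1, 3::nat}, parcs = {(1, 3), (3, 1)}\<rparr>"
  let ?G = "glue ?K ?L"
  have pg: "pair_graph ?K" "pair_graph ?L" by (auto simp: pair_graph_iff sym_def)
  have "?G \<in> \<G>" using block_stable_glue[OF bs pg] single_arc_in[of 1 2] single_arc_in[of 1 3] by simp
  moreover have pgG: "pair_graph ?G" by (rule pair_graph_glue[OF pg])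
  moreover have arcs: "(1, 2) \<in> parcs ?G" "(1, 3) \<in> parcs ?G" by auto
  moreover have "rooted_parts ?G {1}" using pgG arcs by (auto simp: rooted_parts_def)
  then have "pconnected ?G" by (simp add: rooted_parts_single)
  moreover have "(1, 3) \<in> avoid ?G 2" "(1, 2) \<in> avoid ?G 3" by (auto simp: avoid_def)
  ultimately have "?G \<in> cores_in \<G> {1..3} 1" by (auto simp: cores_in_def core_def)
  then have "card (cores_in \<G> {1..3} 1) > 0" using finite_cores_in by (auto simp: card_gt_0_iff)
  then show ?thesis by (simp add: core_fps_def numeral_3_eq_3)
qed

lemma nonneg_core_fps: "nonneg (core_fps \<G>)"
  by (simp add: core_fps_def)

lemma nonneg_weight_fps: "(\<And>F K. 0 \<le> Q F K) \<Longrightarrow> nonneg (weight_fps \<G> Q)"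
  by (auto simp: weight_fps_def intro!: divide_nonneg_nonneg sum_nonneg)

abbreviation "connected_fps \<equiv> weight_fps \<G> (\<lambda>_ _. 1)"

lemma connected_fps_nth: "1 \<le> n \<Longrightarrow> fps_nth connected_fps n = real (card (rooted_in \<G> {1..n} {1})) / fact (n - 1)"
  by (simp add: weight_fps_def)

lemma connected_fps_Suc: "fps_nth connected_fps (Suc m) = fps_nth (core_fps \<G> oo connected_fps) m"
proof -
  interpret block_class_weight \<G> "\<lambda>_ _. 1" by unfold_locales auto
  show ?thesis using root_sum_fps[of m] by (simp add: weight_fps_def)
qed

lemma level_weight: "block_class_weight \<G> (\<lambda>F K. (u :: real) ^ level r F K)"
  by unfold_locales
    (auto simp: disjoint_parts.level_disjoint power_add level_relabel level_def[of _ "\<lparr>pverts = {}, parcs = {}\<rparr>"])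

lemma fringe_weight:
  assumes h: "\<And>f T u. bij f \<Longrightarrow> pair_graph T \<Longrightarrow> h (relabel f T) (f u) = h T u"
  shows "block_class_weight \<G> (\<lambda>F K. (u :: real) ^ fringe_sum h F K)"
proof unfold_locales
  show "u ^ fringe_sum h \<lparr>pverts = {}, parcs = {}\<rparr> {} = 1" by (simp add: fringe_sum_def)
  fix f :: "nat \<Rightarrow> nat" and F :: ngraph and K assume f: "bij f" and "rooted_parts F K"
  then have "fringe_sum h (relabel f F) (f ` K) = fringe_sum h F K"
    using h self_dominated by (intro fringe_sum_relabel[OF f]) (auto simp: rooted_parts_def)
  then show "u ^ fringe_sum h (relabel f F) (f ` K) = u ^ fringe_sum h F K" by simp
qed (auto simp: disjoint_parts.fringe_sum_disjoint power_add)

text \<open>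
The decomposition at the root, as seen by the two statistics: the levels shift by one, and the
fringe sum gains the term of the whole graph.
\<close>

lemma decompose:
  assumes "G \<in> rooted_in \<G> {1..n} {1}"
  shows "rooted_graph G 1" "level 0 G {1} = 1"
    "level (Suc r) G {1} = level r (below_root G 1) (root_children G 1)"
    "fringe_sum h G {1} = h G 1 + fringe_sum h (below_root G 1) (root_children G 1)"
proof -
  show rg: "rooted_graph G 1" using assms by (auto simp: rooted_in_def rooted_parts_single rooted_graph_def)
  interpret rooted_graph G 1 by (rule rg)
  interpret root_glue "induced G (insert 1 children)" "below_root G 1" 1 children by (rule root_glue_axioms)
  show "level 0 G {1} = 1" "level (Suc r) G {1} = level r (below_root G 1) (root_children G 1)"
    "fringe_sum h G {1} = h G 1 + fringe_sum h (below_root G 1) (root_children G 1)"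
    using level_0 level_Suc[of r] fringe_sum_glue[of h] unfolding glue_decomposition by auto
qed

end

section \<open>Concentration of fringe statistics\<close>

locale subcritical_class = block_class \<G> + subcritical_gf "core_fps \<G>" "weight_fps \<G> (\<lambda>_ _. 1)" \<rho> \<tau> y1
  for \<G> \<rho> \<tau> y1
begin

abbreviation "conn_graphs n \<equiv> rooted_in \<G> {1..n} {1::nat}"

text \<open>
The mean of \<open>h\<close> in the Boltzmann model with parameter \<open>\<rho>\<close>, restricted to rooted graphs with at most \<open>K\<close>
vertices. The normalisation \<open>\<tau>\<close> is the total weight.
\<close>
definition mean :: "(ngraph \<Rightarrow> nat \<Rightarrow> nat) \<Rightarrow> nat \<Rightarrow> real" where
  "mean h K = (\<Sum>n=1..K. \<rho> ^ n / fact (n - 1) * (\<Sum>G\<in>conn_graphs n. real (h G 1))) / \<tau>"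

lemma tau_mean: "\<tau> * mean h K = (\<Sum>n=1..K. \<rho> ^ n / fact (n - 1) * (\<Sum>G\<in>conn_graphs n. real (h G 1)))"
  using tau_pos by (simp add: mean_def)

lemma finite_conn_graphs: "finite (conn_graphs n)"
  by (rule finite_rooted_in) simp

lemma partial_eval_shift1: "fps_nth F 0 = 0 \<Longrightarrow> partial_eval F K x = (\<Sum>n=1..K. fps_nth F n * x ^ n)"
proof -
  have "{..K} = insert 0 {1..K}" by auto
  then show "fps_nth F 0 = 0 \<Longrightarrow> ?thesis" by (simp add: partial_eval_def)
qed

text \<open>
By Bernoulli's inequality \<open>1 - (1 - t)^Z \<le> t Z\<close>, so the mean of \<open>Z\<close> is at least the relative loss of the
weighted series divided by \<open>t\<close>, and \<open>level_bound\<close> bounds this loss from below.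
\<close>

lemma mean_level:
  assumes \<delta>: "0 < \<delta>" "\<delta> < 1"
  shows "\<exists>K. 1 - \<delta> \<le> mean (\<lambda>G x. level r G {x}) K"
proof -
  define \<epsilon> where "\<epsilon> = \<delta> / 2"
  have \<epsilon>: "0 < \<epsilon>" "\<epsilon> < 1" using \<delta> by (auto simp: \<epsilon>_def)
  define W where "W r t = weight_fps \<G> (\<lambda>F K. (1 - t) ^ level r F K)" for r and t :: real
  have "eventually (\<lambda>t. \<forall>m. partial_eval (W r t) m \<rho> \<le> \<tau> * (1 - (1 - \<epsilon>) * t)) (at_right 0)"
  proof (rule level_bound[OF _ _ _ _ \<epsilon>])
    fix r and t :: real assume t: "0 < t" "t < 1"
    show "nonneg (W r t)" unfolding W_def using t by (intro nonneg_weight_fps) auto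
    show "fps_nth (W 0 t) n = (1 - t) * fps_nth connected_fps n" for n
    proof (cases "n = 0")
      case False
      have "(\<Sum>G\<in>conn_graphs n. (1 - t) ^ level 0 G {1}) = (\<Sum>G\<in>conn_graphs n. (1 - t))"
        using decompose(2) by (intro sum.cong) auto
      then show ?thesis using False by (simp add: W_def weight_fps_def)
    qed (simp add: W_def weight_fps_def)
    show "fps_nth (W (Suc r) t) (Suc m) = fps_nth (core_fps \<G> oo W r t) m" for m
    proof -
      interpret block_class_weight \<G> "\<lambda>F K. (1 - t) ^ level r F K" by (rule level_weight)
      have "(\<Sum>G\<in>conn_graphs (Suc m). (1 - t) ^ level (Suc r) G {1}) =
          (\<Sum>G\<in>conn_graphs (Suc m). (1 - t) ^ level r (below_root G 1) (root_children G 1))"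
        using decompose(3) by (intro sum.cong) auto
      then show ?thesis using root_sum_fps[of m] by (simp add: W_def weight_fps_def)
    qed
  qed (simp add: W_def weight_fps_def)
  moreover have "eventually (\<lambda>t::real. 0 < t \<and> t < 1) (at_right 0)" unfolding eventually_at_right_field by (intro exI[of _ 1]) auto
  ultimately have "eventually (\<lambda>t. (\<forall>m. partial_eval (W r t) m \<rho> \<le> \<tau> * (1 - (1 - \<epsilon>) * t)) \<and> 0 < t \<and> t < 1) (at_right 0)"
    by eventually_elim auto
  then obtain t where t: "\<And>m. partial_eval (W r t) m \<rho> \<le> \<tau> * (1 - (1 - \<epsilon>) * t)" "0 < t" "t < 1"
    using eventually_happens'[OF trivial_limit_at_right_real] by blast
  have "eventually (\<lambda>m. \<tau> * (1 - \<epsilon> * t) < partial_eval connected_fps m \<rho>) sequentially"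
    by (rule order_tendstoD(1)[OF partial_eval_tendsto]) (use \<epsilon> t tau_pos in auto)
  then obtain K where K: "\<tau> * (1 - \<epsilon> * t) < partial_eval connected_fps K \<rho>" by (auto simp: eventually_sequentially)
  have "\<tau> * (1 - \<delta>) * t = \<tau> * (1 - \<epsilon> * t) - \<tau> * (1 - (1 - \<epsilon>) * t)"
    by (simp add: \<epsilon>_def field_simps)
  also have "\<dots> \<le> partial_eval connected_fps K \<rho> - partial_eval (W r t) K \<rho>" using K t(1)[of K] by simp
  also have "\<dots> = (\<Sum>n=1..K. (fps_nth connected_fps n - fps_nth (W r t) n) * \<rho> ^ n)"
    using a0 by (simp add: partial_eval_shift1 W_def weight_fps_def sum_subtractf left_diff_distrib)
  also have "\<dots> \<le> (\<Sum>n=1..K. t * (\<rho> ^ n / fact (n - 1) * (\<Sum>G\<in>conn_graphs n. real (level r G {1}))))"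
  proof (rule sum_mono)
    fix n assume n: "n \<in> {1..K}"
    have "fps_nth connected_fps n - fps_nth (W r t) n = (\<Sum>G\<in>conn_graphs n. 1 - (1 - t) ^ level r G {1}) / fact (n - 1)"
      using n by (simp add: W_def weight_fps_def sum_subtractf diff_divide_distrib)
    also have "\<dots> \<le> (\<Sum>G\<in>conn_graphs n. t * real (level r G {1})) / fact (n - 1)"
    proof (intro divide_right_mono sum_mono)
      fix G
      show "1 - (1 - t) ^ level r G {1} \<le> t * real (level r G {1})"
        using Bernoulli_inequality[of "- t" "level r G {1}"] t by (simp add: mult.commute)
    qed simp
    finally have "(fps_nth connected_fps n - fps_nth (W r t) n) * \<rho> ^ n \<le> (\<Sum>G\<in>conn_graphs n. t * real (level r G {1})) / fact (n - 1) * \<rho> ^ n"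
      using rho by (intro mult_right_mono) auto
    then show "(fps_nth connected_fps n - fps_nth (W r t) n) * \<rho> ^ n \<le> t * (\<rho> ^ n / fact (n - 1) * (\<Sum>G\<in>conn_graphs n. real (level r G {1})))"
      by (simp add: sum_distrib_left[symmetric] mult_ac)
  qed
  also have "\<dots> = t * (\<tau> * mean (\<lambda>G x. level r G {x}) K)"
    unfolding tau_mean by (rule sum_distrib_left[symmetric])
  finally have "(t * \<tau>) * (1 - \<delta>) \<le> (t * \<tau>) * mean (\<lambda>G x. level r G {x}) K" by (simp add: mult_ac)
  then show ?thesis using t tau_pos by (intro exI[of _ K]) (simp add: mult_le_cancel_left)
qed

text \<open>
With \<open>u = 1 - t\<close> and \<open>x = \<rho> (1 + \<beta> t)\<close> for some \<open>\<beta>\<close> between \<open>\<alpha>\<close> and the mean, each requirement holds for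
small \<open>t\<close>: \<open>u^\<alpha> x > \<rho>\<close> since \<open>\<alpha> < \<beta>\<close>, and the gain of the perturbed equation exceeds \<open>\<tau> \<beta> t\<close> since the
derivative of the gain at \<open>t = 0\<close> is \<open>\<tau>\<close> times the mean.
\<close>
lemma choose_perturbation:
  assumes h: "\<And>f T u. bij f \<Longrightarrow> pair_graph T \<Longrightarrow> h (relabel f T) (f u) = h T u"
    and \<alpha>: "0 \<le> \<alpha>" "\<alpha> < mean h K"
  shows "\<exists>u x. 0 < u \<and> u < 1 \<and> \<rho> \<le> x \<and> \<rho> < u powr \<alpha> * x \<and>
    (\<forall>m. partial_eval (weight_fps \<G> (\<lambda>F K. u ^ fringe_sum h F K)) m x \<le> \<tau>)"
proof -
  define \<beta> where "\<beta> = (\<alpha> + mean h K) / 2"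
  have \<beta>: "\<alpha> < \<beta>" "\<beta> < mean h K" "0 < \<beta>" using \<alpha> by (auto simp: \<beta>_def)
  let ?M = "\<lambda>G. fringe_sum h (below_root G 1) (root_children G 1)"
  \<comment> \<open>The weight that the whole graph, as the fringe of its root, costs in excess of its children.\<close>
  define H where "H t = Abs_fps (\<lambda>n. if n = 0 then 0 else
      (\<Sum>G\<in>conn_graphs n. (1 - (1 - t) ^ h G 1) * (1 - t) ^ ?M G) / fact (n - 1))" for t :: real
  have Hn: "partial_eval (H t) K \<rho> = (\<Sum>n=1..K. (\<Sum>G\<in>conn_graphs n. (1 - (1 - t) ^ h G 1) * (1 - t) ^ ?M G) / fact (n - 1) * \<rho> ^ n)" for t
    by (subst partial_eval_shift1) (auto simp: H_def intro!: sum.cong)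
  have "((\<lambda>t. (1 - (1 - t) ^ h G 1) * (1 - t) ^ ?M G) has_real_derivative real (h G 1)) (at 0)" for G
    by (auto intro!: derivative_eq_intros)
  then have "((\<lambda>t. partial_eval (H t) K \<rho>) has_real_derivative
      (\<Sum>n=1..K. (\<Sum>G\<in>conn_graphs n. real (h G 1)) / fact (n - 1) * \<rho> ^ n)) (at 0)"
    unfolding Hn by (intro DERIV_sum DERIV_cmult_right DERIV_cdivide) auto
  also have "(\<Sum>n=1..K. (\<Sum>G\<in>conn_graphs n. real (h G 1)) / fact (n - 1) * \<rho> ^ n) = \<tau> * mean h K"
    using tau_pos by (simp add: mean_def mult_ac)
  finally have "((\<lambda>t. partial_eval (H t) K \<rho> - \<tau> * \<beta> * t) has_real_derivative (\<tau> * mean h K - \<tau> * \<beta>)) (at 0)"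
    by (auto intro!: derivative_eq_intros)
  moreover have "0 < \<tau> * mean h K - \<tau> * \<beta>" using \<beta> tau_pos by simp
  ultimately obtain d1 where d1: "0 < d1" "\<And>t. 0 < t \<Longrightarrow> t < d1 \<Longrightarrow> \<tau> * \<beta> * t < partial_eval (H t) K \<rho>"
  proof -
    assume a: "((\<lambda>t. partial_eval (H t) K \<rho> - \<tau> * \<beta> * t) has_real_derivative (\<tau> * mean h K - \<tau> * \<beta>)) (at 0)"
      "0 < \<tau> * mean h K - \<tau> * \<beta>"
    from DERIV_pos_inc_right[OF a] obtain d where d: "0 < d"
      "\<And>t. 0 < t \<Longrightarrow> t < d \<Longrightarrow> partial_eval (H 0) K \<rho> - \<tau> * \<beta> * 0 < partial_eval (H (0 + t)) K \<rho> - \<tau> * \<beta> * (0 + t)" by blast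
    have "partial_eval (H 0) K \<rho> = 0" unfolding Hn by simp
    then show thesis using d by (intro that[of d]) auto
  qed
  have "((\<lambda>t. \<alpha> * ln (1 - t) + ln (1 + \<beta> * t)) has_real_derivative (\<beta> - \<alpha>)) (at 0)"
    by (auto intro!: derivative_eq_intros)
  from DERIV_pos_inc_right[OF this] obtain d2 where d2: "0 < d2"
    "\<And>t. 0 < t \<Longrightarrow> t < d2 \<Longrightarrow> 0 < \<alpha> * ln (1 - t) + ln (1 + \<beta> * t)" using \<beta> by auto
  have "((\<lambda>t. partial_eval connected_fps K (\<rho> * (1 + \<beta> * t))) \<longlongrightarrow> partial_eval connected_fps K (\<rho> * (1 + \<beta> * 0))) (at_right 0)"
    unfolding partial_eval_def by (intro tendsto_intros)
  then have "eventually (\<lambda>t. partial_eval connected_fps K (\<rho> * (1 + \<beta> * t)) < \<tau>) (at_right 0)"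
    by (rule order_tendstoD(2)) (use partial_eval_less in simp)
  then obtain d3 where d3: "0 < d3" "\<And>t. 0 < t \<Longrightarrow> t < d3 \<Longrightarrow> partial_eval connected_fps K (\<rho> * (1 + \<beta> * t)) < \<tau>"
    unfolding eventually_at_right_field by auto
  define t where "t = min (min d1 d2) (min d3 1) / 2"
  have t: "0 < t" "t < d1" "t < d2" "t < d3" "t < 1" using d1(1) d2(1) d3(1) by (auto simp: t_def)
  define u where "u = 1 - t"
  define x where "x = \<rho> * (1 + \<beta> * t)"
  have u: "0 < u" "u < 1" using t by (auto simp: u_def)
  have bt: "0 < \<beta> * t" using \<beta> t by simp
  have x: "\<rho> \<le> x" using rho bt by (simp add: x_def)
  have "0 < ln (u powr \<alpha> * (1 + \<beta> * t))"
    using d2(2)[OF t(1,3)] u bt by (simp add: u_def ln_mult ln_powr)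
  then have "1 < u powr \<alpha> * (1 + \<beta> * t)" using u bt by (subst (asm) ln_gt_zero_iff) auto
  then have ux: "\<rho> < u powr \<alpha> * x" using rho by (simp add: x_def mult_ac)
  let ?Q = "\<lambda>F K. u ^ fringe_sum h F K"
  interpret block_class_weight \<G> ?Q by (rule fringe_weight[OF h])
  have split: "u ^ fringe_sum h G {1} = u ^ h G 1 * ?Q (below_root G 1) (root_children G 1)" if "G \<in> conn_graphs n" for G n
    using decompose(4)[OF that, of h] by (simp add: power_add)
  have "partial_eval (weight_fps \<G> ?Q) m x \<le> \<tau>" for m
  proof (rule perturbed_bound[where H = "H t" and K = K])
    show "nonneg (weight_fps \<G> ?Q)" using u by (intro nonneg_weight_fps) auto
    show "fps_nth (weight_fps \<G> ?Q) 0 = 0" "fps_nth (H t) 0 = 0" by (simp_all add: weight_fps_def H_def)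
    show "nonneg (H t)" using u unfolding H_def u_def[symmetric]
      by (auto intro!: divide_nonneg_nonneg sum_nonneg mult_nonneg_nonneg power_le_one)
    show "fps_nth (weight_fps \<G> ?Q) n \<le> fps_nth connected_fps n" for n
    proof -
      have "(\<Sum>G\<in>conn_graphs n. u ^ fringe_sum h G {1}) \<le> (\<Sum>G\<in>conn_graphs n. 1)"
        using u by (intro sum_mono power_le_one) auto
      then show ?thesis by (auto simp: weight_fps_def intro!: divide_right_mono)
    qed
    show "fps_nth (weight_fps \<G> ?Q) (Suc m) + fps_nth (H t) (Suc m) = fps_nth (core_fps \<G> oo weight_fps \<G> ?Q) m" for m
    proof -
      have "(\<Sum>G\<in>conn_graphs (Suc m). u ^ fringe_sum h G {1}) + (\<Sum>G\<in>conn_graphs (Suc m). (1 - u ^ h G 1) * u ^ ?M G) =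
          (\<Sum>G\<in>conn_graphs (Suc m). ?Q (below_root G 1) (root_children G 1))"
        unfolding sum.distrib[symmetric] using split by (intro sum.cong) (auto simp: algebra_simps)
      then show ?thesis unfolding root_sum_fps[symmetric]
        by (simp add: weight_fps_def H_def u_def add_divide_distrib[symmetric])
    qed
    show "\<rho> \<le> x" by (rule x)
    show "partial_eval connected_fps K x \<le> \<tau>" using d3(2)[OF t(1,4)] by (simp add: x_def)
    have "\<tau> * (x / \<rho> - 1) = \<tau> * \<beta> * t" using rho by (simp add: x_def)
    also have "\<dots> \<le> partial_eval (H t) K \<rho>" using d1(2)[OF t(1,2)] by simp
    also have "\<dots> \<le> partial_eval (H t) K x"
      unfolding partial_eval_def using \<open>nonneg (H t)\<close> x rho by (intro sum_mono mult_left_mono power_mono) auto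
    finally show "\<tau> * (x / \<rho> - 1) \<le> partial_eval (H t) K x" .
  qed
  then show ?thesis using u x ux by blast
qed

text \<open>
The exponential Markov inequality: up to the common factor \<open>(n - 1)!\<close> the numerator is at most \<open>\<tau> (u^\<alpha> x)^(-n)\<close>, and the denominator is at
least of order \<open>\<sigma>^n\<close> for a rate \<open>\<sigma> < 1/\<rho>\<close> chosen so close to \<open>1/\<rho>\<close> that the quotient decays.
\<close>

lemma lower_tail:
  assumes h: "\<And>f T u. bij f \<Longrightarrow> pair_graph T \<Longrightarrow> h (relabel f T) (f u) = h T u"
    and \<alpha>: "0 \<le> \<alpha>" "\<alpha> < mean h K"
  shows "\<exists>C q. 0 < q \<and> q < 1 \<and> (\<forall>n\<ge>1.
    real (card {G \<in> conn_graphs n. real (fringe_sum h G {1}) \<le> \<alpha> * real n}) / real (card (conn_graphs n)) \<le> C * q ^ n)"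
proof -
  obtain u x where u: "0 < u" "u < 1" and x: "\<rho> \<le> x" and ux: "\<rho> < u powr \<alpha> * x"
    and bd: "\<And>m. partial_eval (weight_fps \<G> (\<lambda>F K. u ^ fringe_sum h F K)) m x \<le> \<tau>"
    using choose_perturbation[OF h \<alpha>] by blast
  define v where "v = u powr \<alpha> * x"
  have v: "0 < v" "\<rho> < v" using ux rho by (auto simp: v_def)
  have x0: "0 < x" using x rho by simp
  obtain \<sigma> where \<sigma>: "1 / v < \<sigma>" "\<sigma> < 1 / \<rho>" using dense[of "1 / v" "1 / \<rho>"] v rho by (auto simp: frac_less2)
  have \<sigma>0: "0 < \<sigma>" using \<sigma>(1) v by (meson less_trans zero_less_divide_1_iff)
  obtain \<kappa> where \<kappa>: "0 < \<kappa>" "\<And>n. 1 \<le> n \<Longrightarrow> \<kappa> * \<sigma> ^ n \<le> fps_nth connected_fps n" using a_lower[OF \<sigma>0 \<sigma>(2)] by blast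
  define q where "q = 1 / (\<sigma> * v)"
  have q: "0 < q" "q < 1" using \<sigma> \<sigma>0 v by (auto simp: q_def field_simps)
  show ?thesis
  proof (rule exI[of _ "\<tau> / \<kappa>"], rule exI[of _ q], intro conjI q allI impI)
    fix n :: nat assume n: "1 \<le> n"
    let ?S = "{G \<in> conn_graphs n. real (fringe_sum h G {1}) \<le> \<alpha> * real n}"
    have ca: "real (card (conn_graphs n)) = fps_nth connected_fps n * fact (n - 1)" using n by (simp add: connected_fps_nth)
    have "real (card ?S) * (u powr \<alpha>) ^ n = (\<Sum>G\<in>?S. u powr (\<alpha> * real n))"
      using u by (simp add: powr_realpow[symmetric] powr_powr)
    also have "\<dots> \<le> (\<Sum>G\<in>?S. u ^ fringe_sum h G {1})"
    proof (rule sum_mono)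
      fix G assume "G \<in> ?S"
      then have "u powr (\<alpha> * real n) \<le> u powr real (fringe_sum h G {1})" using u by (intro powr_mono') auto
      then show "u powr (\<alpha> * real n) \<le> u ^ fringe_sum h G {1}" using u by (simp add: powr_realpow)
    qed
    also have "\<dots> \<le> (\<Sum>G\<in>conn_graphs n. u ^ fringe_sum h G {1})" using u finite_conn_graphs by (intro sum_mono2) auto
    also have "\<dots> = fps_nth (weight_fps \<G> (\<lambda>F K. u ^ fringe_sum h F K)) n * fact (n - 1)"
      using n by (simp add: weight_fps_def)
    finally have "real (card ?S) * (u powr \<alpha>) ^ n * x ^ n \<le>
        (fps_nth (weight_fps \<G> (\<lambda>F K. u ^ fringe_sum h F K)) n * x ^ n) * fact (n - 1)"
      using x0 by (simp add: mult_ac mult_left_mono)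
    also have "\<dots> \<le> \<tau> * fact (n - 1)"
    proof (rule mult_right_mono)
      have nn: "nonneg (weight_fps \<G> (\<lambda>F K. u ^ fringe_sum h F K))" using u by (intro nonneg_weight_fps) auto
      have "fps_nth (weight_fps \<G> (\<lambda>F K. u ^ fringe_sum h F K)) n * x ^ n \<le> partial_eval (weight_fps \<G> (\<lambda>F K. u ^ fringe_sum h F K)) n x"
        unfolding partial_eval_def using nn x0 by (intro member_le_sum) auto
      then show "fps_nth (weight_fps \<G> (\<lambda>F K. u ^ fringe_sum h F K)) n * x ^ n \<le> \<tau>" using bd[of n] by linarith
    qed simp
    finally have 1: "real (card ?S) * v ^ n \<le> \<tau> * fact (n - 1)" by (simp add: v_def power_mult_distrib mult_ac)
    have "(real (card ?S) * v ^ n) * (\<kappa> * \<sigma> ^ n) \<le> (\<tau> * fact (n - 1)) * fps_nth connected_fps n"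
      using \<kappa>(1) \<sigma>0 tau_pos by (intro mult_mono[OF 1 \<kappa>(2)[OF n]]) auto
    then have 2: "real (card ?S) * (\<kappa> * (\<sigma> * v) ^ n) \<le> \<tau> * real (card (conn_graphs n))"
      unfolding ca by (simp add: power_mult_distrib mult_ac)
    have cp: "0 < real (card (conn_graphs n))" unfolding ca using a_pos[OF n] by simp
    have k0: "0 < \<kappa> * (\<sigma> * v) ^ n" using \<kappa> \<sigma>0 v by simp
    have "real (card ?S) / real (card (conn_graphs n)) \<le> \<tau> / (\<kappa> * (\<sigma> * v) ^ n)"
      using 2 cp k0 by (simp add: divide_le_eq le_divide_eq mult_ac)
    then show "real (card ?S) / real (card (conn_graphs n)) \<le> \<tau> / \<kappa> * q ^ n" by (simp add: q_def power_divide)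
  qed
qed

end

section \<open>The hypothesis of subcriticality\<close>

lemma labelled_connected:
  assumes "block_class \<G>" "1 \<le> n"
  shows "labelled {G \<in> \<G>. is_connected G} n = rooted_in \<G> {1..n} {1}"
proof -
  interpret block_class \<G> by fact
  have "is_connected G \<longleftrightarrow> pconnected G" if "G \<in> \<G>" for G
    unfolding is_connected_def using graphs[OF that] by (intro connected_with_proj) (auto simp: pair_graph_iff)
  then show ?thesis using assms(2) graphs by (auto simp: labelled_def rooted_in_def rooted_parts_single)
qed

text \<open>
The hypothesis leaves two degenerate cases to exclude. The radius \<open>\<rho>\<close> is not infinite, because the value
of the series would be infinite too; and it is not 0, because \<open>\<Phi>\<close> converges at some \<open>y > 0\<close> and
then \<open>C\<close> converges at \<open>y/\<Phi>(y)\<close>.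
\<close>

lemma subcritical_family_class:
  assumes "subcritical_family \<C>"
  obtains \<G> \<rho> \<tau> y1 where "subcritical_class \<G> \<rho> \<tau> y1" "\<And>n. 1 \<le> n \<Longrightarrow> labelled \<C> n = rooted_in \<G> {1..n} {1}"
proof -
  obtain \<G> \<B> where G: "\<forall>G\<in>\<G>. pair_graph G" "iso_closed \<G>" "block_stable \<G>"
    and C: "\<C> = {G \<in> \<G>. is_connected G}" and B: "\<B> = {G \<in> \<G>. two_connected (with_proj G)}"
    and sc: "ereal_eval (fps_X * fps_deriv (egf \<C>)) (fps_conv_radius (egf \<C>)) < fps_conv_radius (egf \<B>)"
    using assms unfolding subcritical_family_def by blast
  interpret block_class \<G> by (rule block_class.intro) (use G in auto)
  have lab: "labelled \<C> n = rooted_in \<G> {1..n} {1}" if "1 \<le> n" for n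
    unfolding C by (rule labelled_connected[OF block_class_axioms that])
  let ?p = "core_fps \<G>" and ?R = "fps_conv_radius (egf \<C>)" and ?\<eta> = "fps_conv_radius (egf \<B>)"
  have cf: "fps_X * fps_deriv (egf \<C>) = connected_fps"
  proof (rule fps_ext)
    fix n
    show "fps_nth (fps_X * fps_deriv (egf \<C>)) n = fps_nth connected_fps n"
      by (cases n) (simp_all add: egf_def weight_fps_def lab field_simps del: of_nat_Suc)
  qed
  have nn: "nonneg connected_fps" by (rule nonneg_weight_fps) simp
  have c0: "fps_nth connected_fps 0 = 0" by (simp add: weight_fps_def)
  have c1: "fps_nth connected_fps 1 = 1" using connected_fps_Suc[of 0] core_fps_0 by simp
  have R0: "0 \<le> ?R" "0 \<le> ?\<eta>" unfolding fps_conv_radius_def by (rule conv_radius_nonneg)+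
  have radius_ge: "ereal x \<le> ?R" if "summable (\<lambda>n. fps_nth connected_fps n * x ^ n)" "0 \<le> x" for x
  proof -
    have "summable (\<lambda>n. fps_nth (egf \<C>) (Suc n) * x ^ Suc n)"
    proof (rule summable_comparison_test')
      show "summable (\<lambda>n. fps_nth connected_fps (Suc n) * x ^ Suc n)" using that(1) by (subst summable_Suc_iff)
      fix n
      have "real (card (rooted_in \<G> {1..Suc n} {1})) / fact (Suc n) \<le> real (card (rooted_in \<G> {1..Suc n} {1})) / fact n"
        by (intro divide_left_mono) (auto intro: fact_mono)
      then have "fps_nth (egf \<C>) (Suc n) \<le> fps_nth connected_fps (Suc n)"
        using lab[of "Suc n"] by (simp add: egf_def weight_fps_def)
      moreover have "0 \<le> fps_nth (egf \<C>) (Suc n)" by (simp add: egf_def)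
      ultimately show "norm (fps_nth (egf \<C>) (Suc n) * x ^ Suc n) \<le> fps_nth connected_fps (Suc n) * x ^ Suc n"
        using that(2) by (auto simp: abs_mult intro!: mult_right_mono)
    qed
    then have "summable (\<lambda>n. fps_nth (egf \<C>) n * x ^ n)" by (subst (asm) summable_Suc_iff)
    from conv_radius_geI[OF this] show ?thesis using that(2) by (simp add: fps_conv_radius_def)
  qed
  have core_summable: "summable (\<lambda>k. fps_nth ?p k * z ^ k)" if z: "0 \<le> z" "ereal z < ?\<eta>" for z
  proof -
    obtain y where y: "ereal z < ereal y" "ereal y < ?\<eta>" using ereal_dense2[OF z(2)] by blast
    then have y0: "0 < y" "z < y" using z by auto
    let ?b = "\<lambda>i. real (card (blocks_in \<G> {1..i + 2})) / fact i"
    have bl: "labelled \<B> n = blocks_in \<G> {1..n}" for n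
      unfolding B blocks_in_def labelled_def two_connected_with_proj by auto
    have "fps_nth (fps_deriv (fps_deriv (egf \<B>))) i = ?b i" for i
      by (simp add: egf_def bl field_simps del: of_nat_Suc) 
    moreover have "summable (\<lambda>i. fps_nth (fps_deriv (fps_deriv (egf \<B>))) i * y ^ i)"
    proof (rule summable_fps)
      have "?\<eta> \<le> fps_conv_radius (fps_deriv (fps_deriv (egf \<B>)))"
        using fps_conv_radius_deriv order_trans by blast
      then show "ereal (norm y) < fps_conv_radius (fps_deriv (fps_deriv (egf \<B>)))" using y y0 by (auto intro: less_le_trans)
    qed
    ultimately have "summable (\<lambda>i. ?b i * y ^ i)" by simp
    from exp_type_recursion_bounded[OF _ _ y0(1) core_fps_recursion this] nonneg_core_fps
    obtain Cc where "\<forall>k. fps_nth ?p k * y ^ k \<le> Cc" by auto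
    then show ?thesis using nonneg_core_fps z y0 by (intro bounded_coeffs_summable) auto
  qed
  have ev: "ereal_eval connected_fps ?R < ?\<eta>" using sc cf by simp
  have tn: "0 \<le> ereal (fps_nth connected_fps n) * ?R ^ n" for n using nn R0 by simp
  have fin: "ereal_eval connected_fps ?R \<noteq> \<infinity>" using ev by auto
  have "?R \<noteq> \<infinity>"
  proof
    assume "?R = \<infinity>"
    then have "ereal (fps_nth connected_fps 1) * ?R ^ 1 = \<infinity>" using c1 by simp
    moreover have "ereal (fps_nth connected_fps 1) * ?R ^ 1 \<noteq> \<infinity>"
      by (rule suminf_PInfty[where i = 1, OF tn fin[unfolded ereal_eval_def]])
    ultimately show False by simp
  qed
  then obtain \<rho> where \<rho>: "?R = ereal \<rho>" using R0 by (cases ?R) auto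
  have \<rho>0: "0 \<le> \<rho>" using R0 \<rho> by simp
  have e: "ereal_eval connected_fps ?R = (\<Sum>n. ereal (fps_nth connected_fps n * \<rho> ^ n))"
    unfolding ereal_eval_def \<rho> by (intro suminf_cong) (simp add: ereal_power)
  have sm: "summable (\<lambda>n. fps_nth connected_fps n * \<rho> ^ n)"
    using fin nn \<rho>0 unfolding e by (intro summable_ereal) auto
  define \<tau> where "\<tau> = (\<Sum>n. fps_nth connected_fps n * \<rho> ^ n)"
  have \<tau>0: "0 \<le> \<tau>" unfolding \<tau>_def using sm nn \<rho>0 by (intro suminf_nonneg) auto
  have \<tau>\<eta>: "ereal \<tau> < ?\<eta>" using ev unfolding e \<tau>_def suminf_ereal'[OF sm] .
  obtain y1 where y1: "ereal \<tau> < ereal y1" "ereal y1 < ?\<eta>" using ereal_dense2[OF \<tau>\<eta>] by blast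
  then have y10: "0 < y1" "\<tau> < y1" using \<tau>0 by auto
  have ps: "summable (\<lambda>k. fps_nth ?p k * y1 ^ k)" using core_summable y1 y10 by simp
  have \<rho>pos: "0 < \<rho>"
  proof -
    have e1: "1 \<le> eval_fps ?p y1" using partial_sum_le_eval[OF nonneg_core_fps ps, of y1 0] core_fps_0 y10 by simp
    define x where "x = y1 / eval_fps ?p y1"
    have x: "0 < x" using y10 e1 by (simp add: x_def)
    have "partial_eval connected_fps m x \<le> y1" for m
      using x y10 ps e1 by (intro partial_eval_bounded_by_fixpoint[OF nonneg_core_fps nn c0]) (auto simp: connected_fps_Suc x_def)
    then have "ereal x \<le> ?R" using x nn by (intro radius_ge summable_of_partial_eval_bounded) auto
    then show ?thesis using x \<rho> by simp
  qed
  have "subcritical_class \<G> \<rho> \<tau> y1"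
  proof unfold_locales
    show "\<not> summable (\<lambda>n. fps_nth connected_fps n * x ^ n)" if "\<rho> < x" for x
      using radius_ge[of x] that \<rho> \<rho>pos by auto
    show "(\<lambda>n. fps_nth connected_fps n * \<rho> ^ n) sums \<tau>" unfolding \<tau>_def using sm by (rule summable_sums)
  qed (use nonneg_core_fps nn c0 connected_fps_Suc core_fps_0 core_fps_1 core_fps_2 \<rho>pos y10 ps in auto)
  then show thesis using that lab by blast
qed

section \<open>Convergence from lower bounds\<close>

lemma pmf_integral_ge:
  fixes k :: "'c \<Rightarrow> real"
  assumes k: "\<And>x. 0 \<le> k x" "\<And>x. k x \<le> B" and A: "finite A" and l: "\<And>c. c \<in> A \<Longrightarrow> l c \<le> pmf \<mu> c"
  shows "(\<Sum>c\<in>A. k c * l c) \<le> measure_pmf.expectation \<mu> k"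
proof -
  have ik: "integrable (measure_pmf \<mu>) k"
    by (rule measure_pmf.integrable_const_bound[where B = B]) (use k in auto)
  have "(\<Sum>c\<in>A. k c * l c) \<le> (\<Sum>c\<in>A. k c * pmf \<mu> c)" using k l by (intro sum_mono mult_left_mono) auto
  also have "\<dots> = measure_pmf.expectation \<mu> (\<lambda>x. k x * indicator A x)"
    by (subst integral_measure_pmf_real[OF A]) (auto simp: indicator_def intro!: sum.cong)
  also have "\<dots> \<le> measure_pmf.expectation \<mu> k"
    by (intro integral_mono integrable_real_mult_indicator ik) (use k in \<open>auto simp: indicator_def\<close>)
  finally show ?thesis .
qed

text \<open>
Pointwise lower bounds \<open>l\<close> of almost full mass determine the expectation of \<open>f\<close>: the lower bound of
\<open>pmf_integral_ge\<close> applies to the nonnegative functions \<open>B + f\<close> and \<open>B - f\<close>.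
\<close>

lemma pmf_integral_approx:
  fixes f :: "'c \<Rightarrow> real"
  assumes f: "\<And>x. \<bar>f x\<bar> \<le> B" and A: "finite A" and l: "\<And>c. c \<in> A \<Longrightarrow> l c \<le> pmf \<mu> c"
    and m: "1 - \<delta> \<le> (\<Sum>c\<in>A. l c)"
  shows "\<bar>measure_pmf.expectation \<mu> f - (\<Sum>c\<in>A. f c * l c)\<bar> \<le> B * \<delta>"
proof -
  have B: "0 \<le> B" using f[of undefined] by linarith
  have lower: "(\<Sum>c\<in>A. g c * l c) - B * \<delta> \<le> measure_pmf.expectation \<mu> g" if g: "\<And>x. \<bar>g x\<bar> \<le> B" for g :: "'c \<Rightarrow> real"
  proof -
    have ig: "integrable (measure_pmf \<mu>) g"
      by (rule measure_pmf.integrable_const_bound[where B = B]) (use g in auto)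
    have b: "0 \<le> g x + B" "g x + B \<le> 2 * B" for x using g[of x] by (auto simp: abs_le_iff)
    have "(\<Sum>c\<in>A. (g c + B) * l c) \<le> measure_pmf.expectation \<mu> (\<lambda>x. g x + B)"
      by (rule pmf_integral_ge[OF b A l])
    also have "\<dots> = measure_pmf.expectation \<mu> g + B" using ig by simp
    finally have "(\<Sum>c\<in>A. g c * l c) + B * (\<Sum>c\<in>A. l c) \<le> measure_pmf.expectation \<mu> g + B"
      by (simp add: distrib_right sum.distrib sum_distrib_left)
    moreover have "B * (1 - \<delta>) \<le> B * (\<Sum>c\<in>A. l c)" using m B by (rule mult_left_mono)
    ultimately show ?thesis by (simp add: algebra_simps)
  qed
  have "(\<Sum>c\<in>A. - f c * l c) - B * \<delta> \<le> measure_pmf.expectation \<mu> (\<lambda>x. - f x)" using f by (intro lower) auto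
  then show ?thesis using lower[of f] f by (simp add: sum_negf abs_le_iff)
qed

text \<open>
The total mass of the bounds cannot exceed 1, so their supremum over \<open>K\<close> is a probability distribution. It
satisfies the same lower bounds as the distributions \<open>p n\<close>, so all these expectations are close to one another.
\<close>

lemma converges_in_distr_of_lower_bounds:
  fixes p :: "nat \<Rightarrow> 'c pmf" and L :: "nat \<Rightarrow> 'c \<Rightarrow> real" and A :: "nat \<Rightarrow> 'c set"
  assumes A: "\<And>K. finite (A K)" and L: "\<And>K c. 0 \<le> L K c" and supp: "\<And>K c. c \<notin> A K \<Longrightarrow> L K c = 0"
    and mono: "\<And>c. incseq (\<lambda>K. L K c)"
    and lower: "\<And>K c \<epsilon>. 0 < \<epsilon> \<Longrightarrow> eventually (\<lambda>n. L K c - \<epsilon> \<le> pmf (p n) c) sequentially"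
    and mass: "\<And>\<delta>. 0 < \<delta> \<Longrightarrow> \<delta> < 1 \<Longrightarrow> \<exists>K. 1 - \<delta> \<le> (\<Sum>c\<in>A K. L K c)"
  shows "\<exists>q. converges_in_distr p q"
proof -
  have ev: "eventually (\<lambda>n. \<forall>c\<in>S. L K c - \<epsilon> \<le> pmf (p n) c) sequentially" if "0 < \<epsilon>" "finite S" for K \<epsilon> S
    using lower[OF that(1)] that(2) by (simp add: eventually_ball_finite)
  have le1: "(\<Sum>c\<in>S. L K c) \<le> 1" if S: "finite S" for K S
  proof (rule field_le_epsilon)
    fix e :: real assume e: "0 < e"
    define \<epsilon> where "\<epsilon> = e / (real (card S) + 1)"
    have \<epsilon>: "0 < \<epsilon>" using e by (simp add: \<epsilon>_def)
    obtain n where n: "\<forall>c\<in>S. L K c - \<epsilon> \<le> pmf (p n) c"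
      using eventually_happens'[OF sequentially_bot ev[OF \<epsilon> S]] by blast
    have "(\<Sum>c\<in>S. L K c) - real (card S) * \<epsilon> \<le> (\<Sum>c\<in>S. pmf (p n) c)"
      using sum_mono[of S "\<lambda>c. L K c - \<epsilon>" "pmf (p n)"] n by (simp add: sum_subtractf)
    also have "\<dots> = measure (p n) S" using S by (simp add: measure_measure_pmf_finite)
    also have "\<dots> \<le> 1" by simp
    finally have "(\<Sum>c\<in>S. L K c) \<le> 1 + real (card S) * \<epsilon>" by simp
    also have "real (card S) * \<epsilon> \<le> e" using e by (simp add: \<epsilon>_def field_simps)
    finally show "(\<Sum>c\<in>S. L K c) \<le> 1 + e" by simp
  qed
  have L1: "L K c \<le> 1" for K c using le1[of "{c}" K] by simp
  define q where "q c = (SUP K. L K c)" for c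
  have bdd: "bdd_above (range (\<lambda>K. L K c))" for c using L1 by (intro bdd_aboveI[of _ 1]) auto
  have Lq: "L K c \<le> q c" for K c unfolding q_def using bdd by (intro cSUP_upper) auto
  have q0: "0 \<le> q c" for c using L[of 0 c] Lq[of 0 c] by linarith
  have nnL: "(\<integral>\<^sup>+ c. ennreal (L K c) \<partial>count_space UNIV) = ennreal (\<Sum>c\<in>A K. L K c)" for K
  proof -
    have "(\<integral>\<^sup>+ c. ennreal (L K c) \<partial>count_space UNIV) = (\<Sum>c\<in>A K. ennreal (L K c))"
      using A supp by (intro nn_integral_count_space') auto
    then show ?thesis using L by (simp add: sum_ennreal)
  qed
  have qS: "ennreal (q c) = (SUP K. ennreal (L K c))" for c
  proof -
    have "(\<lambda>K. L K c) \<longlonglongrightarrow> q c" unfolding q_def using bdd mono by (rule LIMSEQ_incseq_SUP)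
    then have "(\<lambda>K. ennreal (L K c)) \<longlonglongrightarrow> ennreal (q c)" by (rule tendsto_ennrealI)
    moreover have "incseq (\<lambda>K. ennreal (L K c))" using mono[of c] by (auto simp: incseq_def intro: ennreal_leI)
    then have "(\<lambda>K. ennreal (L K c)) \<longlonglongrightarrow> (SUP K. ennreal (L K c))" by (rule LIMSEQ_SUP)
    ultimately show ?thesis by (rule LIMSEQ_unique)
  qed
  have "(\<integral>\<^sup>+ c. ennreal (q c) \<partial>count_space UNIV) = (SUP K. (\<integral>\<^sup>+ c. ennreal (L K c) \<partial>count_space UNIV))"
    unfolding qS using mono
    by (intro nn_integral_monotone_convergence_SUP) (auto simp: incseq_def le_fun_def intro: ennreal_leI)
  also have "\<dots> = 1"
  proof (rule antisym)
    show "(SUP K. (\<integral>\<^sup>+ c. ennreal (L K c) \<partial>count_space UNIV)) \<le> 1"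
      unfolding nnL using le1[OF A] by (intro SUP_least) (auto simp: ennreal_le_1)
    show "1 \<le> (SUP K. (\<integral>\<^sup>+ c. ennreal (L K c) \<partial>count_space UNIV))"
    proof (rule ennreal_le_epsilon)
      fix e :: real assume e: "0 < e"
      have "0 < min e (1 / 2)" "min e (1 / 2) < 1" using e by (simp_all add: min_less_iff_disj)
      then obtain K where K: "1 - min e (1 / 2) \<le> (\<Sum>c\<in>A K. L K c)" using mass by blast
      have "1 \<le> ennreal ((\<Sum>c\<in>A K. L K c) + e)"
        using K by (subst ennreal_1[symmetric], intro ennreal_leI) linarith
      also have "\<dots> = ennreal (\<Sum>c\<in>A K. L K c) + ennreal e"
        using L e by (intro ennreal_plus sum_nonneg) auto
      also have "\<dots> \<le> (SUP K. (\<integral>\<^sup>+ c. ennreal (L K c) \<partial>count_space UNIV)) + ennreal e"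
        unfolding nnL by (intro add_right_mono SUP_upper) auto
      finally show "1 \<le> (SUP K. (\<integral>\<^sup>+ c. ennreal (L K c) \<partial>count_space UNIV)) + ennreal e" .
    qed
  qed
  finally have q1: "(\<integral>\<^sup>+ c. ennreal (q c) \<partial>count_space UNIV) = 1" .
  have pq: "pmf (embed_pmf q) c = q c" for c by (rule pmf_embed_pmf[OF q0 q1])
  have "converges_in_distr p (embed_pmf q)"
    unfolding converges_in_distr_def
  proof (intro allI impI)
    fix f :: "'c \<Rightarrow> real" assume "bounded (range f)"
    then obtain B where B: "0 < B" "\<And>x. \<bar>f x\<bar> \<le> B" unfolding bounded_pos by auto
    show "(\<lambda>n. measure_pmf.expectation (p n) f) \<longlonglongrightarrow> measure_pmf.expectation (embed_pmf q) f"
    proof (rule LIMSEQ_I)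
      fix e :: real assume e: "0 < e"
      \<comment> \<open>Both expectations are within \<open>2 B \<delta>\<close> of the same finite sum: one \<open>\<delta>\<close> for the mass outside
        \<open>A K\<close>, one for lowering each of the finitely many bounds by \<open>\<epsilon>\<close>.\<close>
      define \<delta> where "\<delta> = min (e / (8 * B)) (1 / 2)"
      have \<delta>: "0 < \<delta>" "\<delta> < 1" "B * \<delta> \<le> e / 8" using e B by (auto simp: \<delta>_def min_def field_simps)
      obtain K where K: "1 - \<delta> \<le> (\<Sum>c\<in>A K. L K c)" using mass[OF \<delta>(1,2)] by blast
      define \<epsilon> where "\<epsilon> = \<delta> / (real (card (A K)) + 1)"
      have \<epsilon>: "0 < \<epsilon>" using \<delta> by (simp add: \<epsilon>_def)
      have ce: "real (card (A K)) * \<epsilon> \<le> \<delta>" using \<delta> by (simp add: \<epsilon>_def field_simps)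
      have m: "1 - 2 * \<delta> \<le> (\<Sum>c\<in>A K. L K c - \<epsilon>)" using K ce by (simp add: sum_subtractf)
      let ?s = "\<Sum>c\<in>A K. f c * (L K c - \<epsilon>)"
      have bq: "\<bar>measure_pmf.expectation (embed_pmf q) f - ?s\<bar> \<le> B * (2 * \<delta>)"
      proof (rule pmf_integral_approx[OF B(2) A _ m])
        fix c show "L K c - \<epsilon> \<le> pmf (embed_pmf q) c" using Lq[of K c] \<epsilon> pq[of c] by simp
      qed
      have "eventually (\<lambda>n. norm (measure_pmf.expectation (p n) f - measure_pmf.expectation (embed_pmf q) f) < e) sequentially"
        using ev[OF \<epsilon> A[of K], of K]
      proof eventually_elim
        case (elim n)
        have "\<bar>measure_pmf.expectation (p n) f - ?s\<bar> \<le> B * (2 * \<delta>)"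
          using elim by (intro pmf_integral_approx[OF B(2) A _ m]) auto
        then show ?case using bq \<delta>(3) e by (auto simp: abs_le_iff abs_less_iff)
      qed
      then show "\<exists>no. \<forall>n\<ge>no. norm (measure_pmf.expectation (p n) f - measure_pmf.expectation (embed_pmf q) f) < e"
        by (simp add: eventually_sequentially)
    qed
  qed
  then show ?thesis by blast
qed

section \<open>Almost sure convergence\<close>

context subcritical_class begin

definition class_mass :: "nat \<Rightarrow> nat \<Rightarrow> (ngraph \<times> nat) set \<Rightarrow> real" where
  "class_mass r K c = mean (class_count r c) K"

definition classes :: "nat \<Rightarrow> nat \<Rightarrow> (ngraph \<times> nat) set set" where
  "classes r K = (\<Union>n\<in>{1..K}. \<Union>G\<in>conn_graphs n. (\<lambda>w. ball_class r (G, w)) ` {1..n})"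

lemma finite_classes: "finite (classes r K)"
  unfolding classes_def using finite_conn_graphs by auto

lemma mean_mono: "incseq (mean h)"
proof -
  have "mean h K \<le> mean h (Suc K)" for K
    using rho tau_pos unfolding mean_def
    by (intro divide_right_mono sum_mono2) (auto intro!: divide_nonneg_nonneg mult_nonneg_nonneg sum_nonneg)
  then show ?thesis by (rule incseq_SucI)
qed

lemma mean_nonneg: "0 \<le> mean h K"
  unfolding mean_def using rho tau_pos by (intro divide_nonneg_nonneg sum_nonneg mult_nonneg_nonneg) auto

lemma class_count_outside:
  assumes "G \<in> conn_graphs n" "n \<in> {1..K}" "c \<notin> classes r K" shows "class_count r c G 1 = 0"
proof -
  have v: "pverts G = {1..n}" using assms by (simp add: rooted_in_def)
  have "ball_class r (G, w) \<in> classes r K" if "w \<in> {1..n}" for w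
    using assms(1,2) that unfolding classes_def by blast
  then have "{w \<in> pverts G. depth G {1} w = r \<and> ball_class r (G, w) = c} = {}" using assms(3) v by auto
  then show ?thesis unfolding class_count_def by (metis card.empty)
qed

lemma class_mass_outside:
  assumes c: "c \<notin> classes r K" shows "class_mass r K c = 0"
proof -
  have "(\<Sum>n=1..K. \<rho> ^ n / fact (n - 1) * (\<Sum>G\<in>conn_graphs n. real (class_count r c G 1))) = 0"
  proof (rule sum.neutral, rule ballI)
    fix n assume n: "n \<in> {1..K}"
    have "(\<Sum>G\<in>conn_graphs n. real (class_count r c G 1)) = 0"
      using class_count_outside[OF _ n c] by (intro sum.neutral) auto
    then show "\<rho> ^ n / fact (n - 1) * (\<Sum>G\<in>conn_graphs n. real (class_count r c G 1)) = 0" by (simp only: mult_zero_right)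
  qed
  then show ?thesis unfolding class_mass_def mean_def by (simp only: div_0)
qed

lemma class_count_sum:
  assumes G: "G \<in> conn_graphs n" and n: "n \<in> {1..K}"
  shows "(\<Sum>c\<in>classes r K. class_count r c G 1) = level r G {1}"
proof -
  have v: "pverts G = {1..n}" using G by (simp add: rooted_in_def)
  have sub: "ball_class r (G, w) \<in> classes r K" if "w \<in> pverts G" for w
    using G n that v unfolding classes_def by blast
  have "level r G {1} = (\<Sum>w\<in>{w \<in> pverts G. depth G {1} w = r}. 1)" by (simp add: level_def)
  also have "\<dots> = (\<Sum>c\<in>classes r K. \<Sum>w\<in>{w \<in> {w \<in> pverts G. depth G {1} w = r}. ball_class r (G, w) = c}. 1)"
    using sub finite_classes v by (intro sum.group[symmetric]) auto
  also have "\<dots> = (\<Sum>c\<in>classes r K. class_count r c G 1)"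
    unfolding class_count_def by (intro sum.cong refl) (auto intro!: arg_cong[of _ _ card])
  finally show ?thesis by simp
qed

lemma class_mass_sum: "(\<Sum>c\<in>classes r K. class_mass r K c) = mean (\<lambda>G x. level r G {x}) K"
proof -
  have "(\<Sum>c\<in>classes r K. class_mass r K c) =
      (\<Sum>n=1..K. \<Sum>c\<in>classes r K. \<rho> ^ n / fact (n - 1) * (\<Sum>G\<in>conn_graphs n. real (class_count r c G 1))) / \<tau>"
    unfolding class_mass_def mean_def sum_divide_distrib[symmetric] by (subst sum.swap) simp
  also have "\<dots> = (\<Sum>n=1..K. \<rho> ^ n / fact (n - 1) * (\<Sum>G\<in>conn_graphs n. real (level r G {1}))) / \<tau>"
  proof (intro arg_cong[where f = "\<lambda>x. x / \<tau>"] sum.cong refl)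
    fix n assume n: "n \<in> {1..K}"
    have "(\<Sum>c\<in>classes r K. \<Sum>G\<in>conn_graphs n. real (class_count r c G 1)) = (\<Sum>G\<in>conn_graphs n. real (level r G {1}))"
    proof (subst sum.swap, rule sum.cong[OF refl])
      fix G assume G: "G \<in> conn_graphs n"
      show "(\<Sum>c\<in>classes r K. real (class_count r c G 1)) = real (level r G {1})"
        unfolding class_count_sum[OF G n, symmetric] by simp
    qed
    then show "(\<Sum>c\<in>classes r K. \<rho> ^ n / fact (n - 1) * (\<Sum>G\<in>conn_graphs n. real (class_count r c G 1))) =
        \<rho> ^ n / fact (n - 1) * (\<Sum>G\<in>conn_graphs n. real (level r G {1}))"
      by (simp only: sum_distrib_left[symmetric])
  qed
  finally show ?thesis by (simp add: mean_def)
qed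

definition root_law :: "nat \<Rightarrow> ngraph \<Rightarrow> (ngraph \<times> nat) set pmf" where
  "root_law r G = map_pmf (ball_class r) (map_pmf (\<lambda>v. (G, v)) (pmf_of_set (pverts G)))"

lemma pmf_root_law:
  assumes "G \<in> conn_graphs n" "1 \<le> n"
  shows "pmf (root_law r G) c = real (card {w \<in> pverts G. ball_class r (G, w) = c}) / real n"
proof -
  have v: "pverts G = {1..n}" using assms by (simp add: rooted_in_def)
  have "pmf (root_law r G) c = measure (pmf_of_set (pverts G)) {w. ball_class r (G, w) = c}"
    unfolding root_law_def by (simp add: map_pmf_comp pmf_map vimage_def)
  also have "\<dots> = real (card (pverts G \<inter> {w. ball_class r (G, w) = c})) / real (card (pverts G))"
    using v assms(2) by (subst measure_pmf_of_set) auto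
  also have "pverts G \<inter> {w. ball_class r (G, w) = c} = {w \<in> pverts G. ball_class r (G, w) = c}" by auto
  finally show ?thesis using v by simp
qed

text \<open>
The tails are summable, so the first Borel-Cantelli lemma applies to arbitrary joint distributions.
\<close>

lemma AE_lower:
  fixes M :: "'w measure" and R :: "nat \<Rightarrow> 'w \<Rightarrow> ngraph"
  assumes M: "prob_space M" and R: "\<And>n. n \<ge> 1 \<Longrightarrow> uniformly_random M (R n) (conn_graphs n)"
    and \<alpha>: "0 \<le> \<alpha>" "\<alpha> < class_mass r K c"
  shows "AE \<omega> in M. eventually (\<lambda>n. \<alpha> \<le> pmf (root_law r (R (Suc n) \<omega>)) c) sequentially"
proof -
  interpret prob_space M by fact
  let ?h = "class_count r c"
  have "\<exists>C q. 0 < q \<and> q < 1 \<and> (\<forall>n\<ge>1.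
      real (card {G \<in> conn_graphs n. real (fringe_sum ?h G {1}) \<le> \<alpha> * real n}) / real (card (conn_graphs n)) \<le> C * q ^ n)"
    by (rule lower_tail[OF class_count_relabel \<alpha>(1) \<alpha>(2)[unfolded class_mass_def]])
  then obtain C q where q: "0 < q" "q < 1" and tail: "\<forall>n\<ge>1.
      real (card {G \<in> conn_graphs n. real (fringe_sum ?h G {1}) \<le> \<alpha> * real n}) / real (card (conn_graphs n)) \<le> C * q ^ n"
    by (elim exE conjE)
  define S where "S n = {G \<in> conn_graphs n. real (fringe_sum ?h G {1}) \<le> \<alpha> * real n}" for n
  define E where "E n = R (Suc n) -` S (Suc n) \<inter> space M" for n
  have meas: "R (Suc n) \<in> M \<rightarrow>\<^sub>M count_space (conn_graphs (Suc n))"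
    and law: "distr M (count_space (conn_graphs (Suc n))) (R (Suc n)) = uniform_count_measure (conn_graphs (Suc n))" for n
    using R[of "Suc n"] by (auto simp: uniformly_random_def)
  have sub: "S n \<subseteq> conn_graphs n" for n by (auto simp: S_def)
  have ES: "E n \<in> sets M" for n
    unfolding E_def using meas[of n] sub[of "Suc n"] by (intro measurable_sets) auto
  have mE: "measure M (E n) = real (card (S (Suc n))) / real (card (conn_graphs (Suc n)))" for n
  proof -
    have "measure M (E n) = measure (distr M (count_space (conn_graphs (Suc n))) (R (Suc n))) (S (Suc n))"
      unfolding E_def using meas[of n] sub[of "Suc n"] by (subst measure_distr) auto
    then show ?thesis unfolding law using sub finite_conn_graphs by (subst (asm) measure_uniform_count_measure) auto
  qed
  have "summable (\<lambda>n. measure M (E n))"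
  proof (rule summable_comparison_test')
    show "summable (\<lambda>n. C * q * q ^ n)" using q by (intro summable_mult summable_geometric) auto
    fix n show "norm (measure M (E n)) \<le> C * q * q ^ n"
      using tail[rule_format, of "Suc n"] unfolding mE S_def by (simp add: mult_ac)
  qed
  then have "AE \<omega> in M. eventually (\<lambda>n. \<omega> \<in> space M - E n) sequentially"
    using ES by (intro borel_cantelli_AE1) (auto simp: less_top[symmetric])
  then show ?thesis
  proof (rule AE_mp, intro AE_I2 impI)
    fix \<omega> assume \<omega>: "\<omega> \<in> space M" and "eventually (\<lambda>n. \<omega> \<in> space M - E n) sequentially"
    from this(2) show "eventually (\<lambda>n. \<alpha> \<le> pmf (root_law r (R (Suc n) \<omega>)) c) sequentially"
    proof eventually_elim
      case (elim n)
      let ?G = "R (Suc n) \<omega>"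
      have G: "?G \<in> conn_graphs (Suc n)" using measurable_space[OF meas \<omega>] by simp
      then have "\<alpha> * real (Suc n) < real (fringe_sum ?h ?G {1})" using elim \<omega> by (auto simp: E_def S_def)
      also have "\<dots> \<le> real (card {w \<in> pverts ?G. ball_class r (?G, w) = c})"
        using fringe_class_count_le[OF decompose(1)[OF G]] by simp
      finally show ?case using pmf_root_law[OF G] by (simp add: le_divide_eq)
    qed
  qed
qed

text \<open>
Countably many events suffice, since for each \<open>r\<close> and \<open>K\<close> only finitely many classes have positive mass;
for all other classes the lower bound is trivial.
\<close>

theorem AE_benjamini_schramm:
  fixes M :: "'w measure" and R :: "nat \<Rightarrow> 'w \<Rightarrow> ngraph"
  assumes M: "prob_space M" and R: "\<And>n. n \<ge> 1 \<Longrightarrow> uniformly_random M (R n) (conn_graphs n)"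
  shows "AE \<omega> in M. benjamini_schramm_convergent (\<lambda>n. R (Suc n) \<omega>)"
proof -
  have *: "AE \<omega> in M. eventually (\<lambda>n. class_mass r K c - 1 / real (Suc m) \<le> pmf (root_law r (R (Suc n) \<omega>)) c) sequentially"
    for r K m c
  proof (cases "class_mass r K c - 1 / real (Suc m) < 0")
    case True
    then have "class_mass r K c - 1 / real (Suc m) \<le> pmf \<mu> c" for \<mu> using pmf_nonneg[of \<mu> c] by linarith
    then show ?thesis by simp
  next
    case False
    then show ?thesis by (intro AE_lower[OF M R, of _ r K c]) auto
  qed
  have "AE \<omega> in M. \<forall>r K m. \<forall>c\<in>classes r K.
      eventually (\<lambda>n. class_mass r K c - 1 / real (Suc m) \<le> pmf (root_law r (R (Suc n) \<omega>)) c) sequentially"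
    unfolding AE_all_countable
    by (intro allI AE_ball_countable' * countable_finite finite_classes)
  then show ?thesis
  proof (rule AE_mp, intro AE_I2 impI)
    fix \<omega> assume a: "\<forall>r K m. \<forall>c\<in>classes r K.
      eventually (\<lambda>n. class_mass r K c - 1 / real (Suc m) \<le> pmf (root_law r (R (Suc n) \<omega>)) c) sequentially"
    have "\<exists>q. converges_in_distr (\<lambda>n. root_law r (R (Suc n) \<omega>)) q" for r
    proof (rule converges_in_distr_of_lower_bounds[of "classes r" "class_mass r"])
      show "incseq (\<lambda>K. class_mass r K c)" for c using mean_mono by (simp add: class_mass_def)
      show "\<exists>K. 1 - \<delta> \<le> (\<Sum>c\<in>classes r K. class_mass r K c)" if "0 < \<delta>" "\<delta> < 1" for \<delta>
        using mean_level[OF that] by (simp add: class_mass_sum)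
      show "eventually (\<lambda>n. class_mass r K c - \<epsilon> \<le> pmf (root_law r (R (Suc n) \<omega>)) c) sequentially" if e: "0 < \<epsilon>" for K c \<epsilon>
      proof (cases "c \<in> classes r K")
        case True
        obtain m where m: "1 / real (Suc m) < \<epsilon>" using reals_Archimedean[OF e] by (auto simp: inverse_eq_divide)
        have "eventually (\<lambda>n. class_mass r K c - 1 / real (Suc m) \<le> pmf (root_law r (R (Suc n) \<omega>)) c) sequentially"
          using a True by blast
        then show ?thesis by eventually_elim (use m in linarith)
      next
        case False
        then have "class_mass r K c - \<epsilon> \<le> pmf \<mu> c" for \<mu>
          using class_mass_outside[OF False] e pmf_nonneg[of \<mu> c] by linarith
        then show ?thesis by simp
      qed
    qed (simp_all add: finite_classes class_mass_outside, simp add: class_mass_def mean_nonneg)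
    then show "benjamini_schramm_convergent (\<lambda>n. R (Suc n) \<omega>)"
      by (simp add: benjamini_schramm_convergent_def weakly_convergent_def root_law_def)
  qed
qed

end

theorem theorem1p1:
  fixes \<C> :: "ngraph set"
    and M :: "'w measure"
    and R :: "nat \<Rightarrow> 'w \<Rightarrow> ngraph"
  assumes "subcritical_family \<C>"
    and "prob_space M"
    and "\<And>n. n \<ge> 1 \<Longrightarrow> uniformly_random M (R n) (labelled \<C> n)"
  shows "AE \<omega> in M. benjamini_schramm_convergent (\<lambda>n. R (Suc n) \<omega>)"
proof -
  obtain \<G> \<rho> \<tau> y1 where c: "subcritical_class \<G> \<rho> \<tau> y1"
    and l: "\<And>n. 1 \<le> n \<Longrightarrow> labelled \<C> n = rooted_in \<G> {1..n} {1}"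
    using subcritical_family_class[OF assms(1)] by blast
  show ?thesis using subcritical_class.AE_benjamini_schramm[OF c assms(2)] assms(3) l by simp
qed

end
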